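(* Consider three equal masses $m>0$ in the plane with the Newtonian potential $U(x)=\sum_{0\le i<j\le 2} m^2|x_i-x_j|^{-1}$ (the homogeneous potential of degree $-\alpha$ with $\alpha=1$). Then one obtains a Newtonian $2\pi$-periodic, choreographic, collision-free solution $x_i(t)=\gamma\big(t+\tfrac{2\pi i}{3}\big)$, $i=0,1,2$, with $\gamma$ in the class $\mathcal H_{\mathrm{eight}}$ and with a node at the origin for $t\equiv 0\ (\mathrm{mod}\ \pi)$. This is precisely the configuration (the figure-eight orbit of three equal masses) discovered by Chenciner and Montgomery (2000).
   Context: $\mathbb T:=\mathbb R/(2\pi\mathbb Z)$. A loop $\gamma=(x,y)\in H^1(\mathbb T;\mathbb R^2)$ belongs to the symmetric class $\mathcal H_{\mathrm{eight}}$ if $\gamma(0)=(0,0)$ and, for all $t$: (A$_x$) $\gamma(t+\pi)=(x(t),-y(t))$; (Y$^\star$) $\gamma(\tfrac{\pi}{2}+t)=\big(-x(\tfrac{\pi}{2}-t),\,y(\tfrac{\pi}{2}-t)\big)$. Collision-free means $x_i(t)\neq x_j(t)$ for all $t$ and all $i\ne j$. A node at the origin for $t\equiv 0\ (\mathrm{mod}\ \pi)$ means that $\gamma(t)=(0,0)$ at these times, so that the origin is a self-intersection point of the loop. "Newtonian solution" means that, after a suitable time reparametrization, the motion solves Newton's equation $m\,\ddot x_i=\nabla_{x_i}U(x)$, $i=0,1,2$. The Chenciner–Montgomery figure-eight is the planar, collision-free periodic orbit of the Newtonian three-body problem with equal masses in which the three bodies travel along the same figure-eight curve with equal phase shifts.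 *)

theory Defs
  imports "HOL-Complex_Analysis.Complex_Analysis"
begin

text \<open>
  The Euclidean plane is the type \<^typ>\<open>complex\<close>: the point with coordinates
  \<open>(x, y)\<close> is \<^term>\<open>Complex x y\<close>, and the norm and inner product are the Euclidean ones.
  A function on the circle of length \<open>T\<close> is a \<open>T\<close>-periodic function on the reals.
\<close>

definition has_period :: "real \<Rightarrow> (real \<Rightarrow> 'a) \<Rightarrow> bool" where
  "has_period T f \<longleftrightarrow> (\<forall>t. f (t + T) = f t)"

definition smooth_fun :: "(real \<Rightarrow> real) \<Rightarrow> bool" where
  "smooth_fun f \<longleftrightarrow> (\<forall>k t. ((deriv ^^ k) f) differentiable (at t))"

definition L2_circle :: "(real \<Rightarrow> complex) \<Rightarrow> bool" where
  "L2_circle f \<longleftrightarrow> f \<in> borel_measurable lborel \<and>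
     set_integrable lborel {0..2*pi} (\<lambda>t. (norm (f t))\<^sup>2)"

text \<open>Weak derivative on the circle: the test functions are smooth and periodic, so that
  integration by parts leaves no boundary terms.\<close>

definition weak_derivative_circle :: "(real \<Rightarrow> complex) \<Rightarrow> (real \<Rightarrow> complex) \<Rightarrow> bool" where
  "weak_derivative_circle f g \<longleftrightarrow>
     (\<forall>\<phi>. smooth_fun \<phi> \<and> has_period (2*pi) \<phi> \<longrightarrow>
        set_lebesgue_integral lborel {0..2*pi} (\<lambda>t. deriv \<phi> t *\<^sub>R f t) =
        - set_lebesgue_integral lborel {0..2*pi} (\<lambda>t. \<phi> t *\<^sub>R g t))"

text \<open>The Sobolev space \<open>H\<^sup>1\<close> of loops. Each class has a unique continuous representative; it is
  the one meant here, since pointwise conditions are imposed on loops.\<close>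

definition H1_loops :: "(real \<Rightarrow> complex) set" where
  "H1_loops = {\<gamma>. has_period (2*pi) \<gamma> \<and> continuous_on UNIV \<gamma> \<and> L2_circle \<gamma> \<and>
     (\<exists>g. L2_circle g \<and> weak_derivative_circle \<gamma> g)}"

definition H_eight :: "(real \<Rightarrow> complex) set" where
  "H_eight = {\<gamma> \<in> H1_loops. \<gamma> 0 = 0 \<and>
     (\<forall>t. \<gamma> (t + pi) = Complex (Re (\<gamma> t)) (- Im (\<gamma> t))) \<and>
     (\<forall>t. \<gamma> (pi/2 + t) = Complex (- Re (\<gamma> (pi/2 - t))) (Im (\<gamma> (pi/2 - t))))}"

definition node_at_origin :: "(real \<Rightarrow> complex) \<Rightarrow> bool" where
  "node_at_origin \<gamma> \<longleftrightarrow> (\<forall>k::int. \<gamma> (of_int k * pi) = 0)"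

text \<open>A motion of three bodies is \<open>x :: nat \<Rightarrow> real \<Rightarrow> complex\<close>, where \<open>x i t\<close> is the position of
  body \<open>i\<close> at time \<open>t\<close>; only the indices \<open>0, 1, 2\<close> are used.\<close>

definition choreography :: "real \<Rightarrow> (real \<Rightarrow> complex) \<Rightarrow> nat \<Rightarrow> real \<Rightarrow> complex" where
  "choreography T \<gamma> = (\<lambda>i t. \<gamma> (t + T * real i / 3))"

definition collision_free :: "(nat \<Rightarrow> real \<Rightarrow> complex) \<Rightarrow> bool" where
  "collision_free x \<longleftrightarrow> (\<forall>t. \<forall>i<3. \<forall>j<3. i \<noteq> j \<longrightarrow> x i t \<noteq> x j t)"

definition newton_potential :: "real \<Rightarrow> (nat \<Rightarrow> complex) \<Rightarrow> real" where
  "newton_potential m p = (\<Sum>j<3. \<Sum>i<j. m\<^sup>2 * inverse (norm (p i - p j)))"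

text \<open>Newton's equation \<open>m x\<^sub>i'' = \<nabla>\<^bsub>x\<^sub>i\<^esub> U(x)\<close>, with \<open>v\<close> and \<open>a\<close> the velocities and accelerations.
  The partial gradient is the gradient of \<open>U\<close> in the position of body \<open>i\<close>, the others being fixed.\<close>

definition solves_newton :: "real \<Rightarrow> (nat \<Rightarrow> real \<Rightarrow> complex) \<Rightarrow> bool" where
  "solves_newton m x \<longleftrightarrow> (\<exists>v a. \<forall>i<3. \<forall>t.
     (x i has_vector_derivative v i t) (at t) \<and>
     (v i has_vector_derivative a i t) (at t) \<and>
     GDERIV (\<lambda>z. newton_potential m ((\<lambda>j. x j t)(i := z))) (x i t) :> (m *\<^sub>R a i t))"

text \<open>The time reparametrization is a constant change of the unit of time, which keeps
  periodicity and equal phase shifts meaningful in physical time.\<close>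

definition newtonian_solution :: "real \<Rightarrow> (nat \<Rightarrow> real \<Rightarrow> complex) \<Rightarrow> bool" where
  "newtonian_solution m x \<longleftrightarrow> (\<exists>\<omega>>0. solves_newton m (\<lambda>i s. x i (\<omega> * s)))"

text \<open>A figure-eight curve consists of two simple closed lobes that share only the node, lie
  outside each other and are traversed in opposite senses. The last condition says that the curve
  crosses itself at the node instead of merely touching itself.\<close>

definition figure_eight_curve :: "real \<Rightarrow> (real \<Rightarrow> complex) \<Rightarrow> bool" where
  "figure_eight_curve T q \<longleftrightarrow>
     T > 0 \<and> has_period T q \<and> continuous_on UNIV q \<and>
     (\<exists>a b. a < b \<and> b < a + T \<and> q a = q b \<and>
       (let L1 = subpath a b q; L2 = subpath b (a + T) q in
          simple_path L1 \<and> simple_path L2 \<and>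
          path_image L1 - {q a} \<subseteq> outside (path_image L2) \<and>
          path_image L2 - {q a} \<subseteq> outside (path_image L1) \<and>
          (\<forall>z \<in> inside (path_image L1). \<forall>w \<in> inside (path_image L2).
             winding_number L1 z = - winding_number L2 w)))"

text \<open>The Chenciner--Montgomery configuration: three equal masses chase each other with equal
  phase shifts along one figure-eight curve, without collisions, under Newtonian gravitation.\<close>

definition figure_eight_orbit :: "real \<Rightarrow> real \<Rightarrow> (real \<Rightarrow> complex) \<Rightarrow> bool" where
  "figure_eight_orbit m T q \<longleftrightarrow>
     figure_eight_curve T q \<and>
     collision_free (choreography T q) \<and>
     newtonian_solution m (choreography T q)"

end

theory Submission
  imports Defs
begin

text \<open>
  For a choreography \<open>\<gamma>\<close> the mutual differences are time shifts of one loop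
  \<open>\<eta> t = \<gamma> (t + \<pi>/3) - \<gamma> (t - \<pi>/3)\<close>, and Newton's equation becomes \<open>\<eta>'' = - P (\<eta> / |\<eta>|\<^sup>3)\<close>, where \<open>P\<close>
  removes the harmonics divisible by 3. In the symmetry class, \<open>\<eta>\<close> is a cosine series with real
  coefficients in even and imaginary coefficients in odd harmonics, and the equation is the
  Euler--Lagrange equation of \<open>\<integral> |\<eta>'|\<^sup>2 / 2 + 1 / |\<eta>|\<close>. An explicit trigonometric polynomial \<open>z0\<close>
  with eight modes is nearly critical for this functional and the second variation at \<open>z0\<close> is
  positive definite: with a trigonometric polynomial \<open>s0\<close> close to \<open>1 / |z0|\<close> both facts reduce to
  integer arithmetic. Hence the minimiser over a small ball around \<open>z0\<close> in \<open>H\<^sup>1\<close> is interior and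
  solves the equation. It is uniformly close to \<open>z0\<close>, and the equation itself bounds its
  second derivative; together this determines the shape of the curve.
\<close>

section \<open>Averages over the circle and Laurent polynomials\<close>


text \<open>Each pair of bodies shows the same \<eta> at shifted times, so excluding collisions
  means keeping one function away from 0. Minimising replaces a fixed-point argument: a lower bound
  for the functional suffices, and no linearised operator has to be inverted. If rho is the size of
  the perturbation in the weighted norm, the functional exceeds its value at \<open>z0\<close> by at
  least 3/20 rho^2 - 23/10000 rho - 6/1000000. At the radius 1/50 this is 8/1000000, so the minimum
  avoids the boundary. On that ball the perturbation is uniformly at most 26/1000, while
  |\<open>z0\<close>| is at least 47/100. Only harmonics not divisible by 3 are varied, which is why
  the equation holds only up to P. The part removed by P has period \<open>2 * pi / 3\<close> and
  cancels when \<gamma> is recovered from two shifts of \<eta>. Uniform closeness decides no sign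
  near a zero of a coordinate and no slope. There the acceleration bound is decisive: it turns
  values at distance 1/10 into signs and slopes.\<close>

text \<open>Twice the mean over a period: with this factor the cosines \<open>cos (k * t)\<close>, \<open>k > 0\<close>, are orthonormal.\<close>

definition avg :: "(real \<Rightarrow> real) \<Rightarrow> real" where
  "avg F = integral {0..2*pi} F / pi"

lemma avg_add:
  "continuous_on UNIV F \<Longrightarrow> continuous_on UNIV G \<Longrightarrow> avg (\<lambda>t. F t + G t) = avg F + avg G"
  unfolding avg_def
  by (subst integral_add)
    (auto intro!: integrable_continuous_interval continuous_on_subset[of UNIV] simp: add_divide_distrib)

lemma avg_diff:
  "continuous_on UNIV F \<Longrightarrow> continuous_on UNIV G \<Longrightarrow> avg (\<lambda>t. F t - G t) = avg F - avg G"
  unfolding avg_def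
  by (subst integral_diff)
    (auto intro!: integrable_continuous_interval continuous_on_subset[of UNIV] simp: diff_divide_distrib)

lemma avg_cmult: "avg (\<lambda>t. c * F t) = c * avg F"
  unfolding avg_def by simp

lemma avg_sum:
  "(\<And>i. i \<in> I \<Longrightarrow> continuous_on UNIV (F i)) \<Longrightarrow> avg (\<lambda>t. \<Sum>i\<in>I. F i t) = (\<Sum>i\<in>I. avg (F i))"
proof (induction I rule: infinite_finite_induct)
  case (insert i I)
  then show ?case
    by (simp add: avg_add continuous_on_sum)
qed (simp_all add: avg_def)

lemma avg_mono:
  "continuous_on UNIV F \<Longrightarrow> continuous_on UNIV G \<Longrightarrow> (\<And>t. F t \<le> G t) \<Longrightarrow> avg F \<le> avg G"
  unfolding avg_def
  by (intro divide_right_mono integral_le)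
    (auto intro!: integrable_continuous_interval continuous_on_subset[of UNIV])

lemma avg_const: "avg (\<lambda>t. c) = 2 * c"
  unfolding avg_def by simp

lemma avg_cos: "avg (\<lambda>t. cos (real_of_int j * t)) = (if j = 0 then 2 else 0)"
proof (cases "j = 0")
  case False
  have "((\<lambda>t. cos (real_of_int j * t)) has_integral
      (sin (real_of_int j * (2*pi)) / j - sin (real_of_int j * 0) / j)) {0..2*pi}"
    by (rule fundamental_theorem_of_calculus)
      (use False in \<open>auto intro!: derivative_eq_intros simp: has_real_derivative_iff_has_vector_derivative[symmetric]\<close>)
  moreover have "sin (real_of_int j * (2*pi)) = 0"
    using sin_times_pi_eq_0[of "real_of_int j * 2"] by (auto simp: algebra_simps)
  ultimately show ?thesis
    using False by (simp add: avg_def integral_unique)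
qed (simp add: avg_def)

lemma avg_cos_cos:
  "avg (\<lambda>t. cos (real_of_int i * t) * cos (real_of_int j * t)) = of_bool (i = j) + of_bool (i = - j)"
proof -
  have "(\<lambda>t. cos (real_of_int i * t) * cos (real_of_int j * t)) =
      (\<lambda>t. 1/2 * (cos (real_of_int (i - j) * t) + cos (real_of_int (i + j) * t)))"
    by (simp only: cos_times_cos of_int_add of_int_diff) (auto simp: algebra_simps)
  then have "avg (\<lambda>t. cos (real_of_int i * t) * cos (real_of_int j * t)) =
      1/2 * (avg (\<lambda>t. cos (real_of_int (i - j) * t)) + avg (\<lambda>t. cos (real_of_int (i + j) * t)))"
    by (simp only: avg_cmult) (subst avg_add, auto intro!: continuous_intros)
  then show ?thesis
    unfolding avg_cos by (auto simp: eq_neg_iff_add_eq_0)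
qed

text \<open>A list of length \<open>n\<close> stands for the Laurent polynomial in \<open>e\<^bsup>it\<^esup>\<close> with exponents
  \<open>-(n-1), -(n-3), \<dots>, n-1\<close>; with this centred indexing, convolution of lists is multiplication.\<close>

fun padd :: "int list \<Rightarrow> int list \<Rightarrow> int list" where
  "padd [] q = q"
| "padd p [] = p"
| "padd (a # p) (b # q) = (a + b) # padd p q"

fun pmul :: "int list \<Rightarrow> int list \<Rightarrow> int list" where
  "pmul [] q = []"
| "pmul (a # p) q = padd (map ((*) a) q) (0 # pmul p q)"

text \<open>An ordinary polynomial; its variable will be \<open>cis (2 * t)\<close>, because
  neighbouring exponents of the Laurent polynomial differ by 2.\<close>

definition hor :: "int list \<Rightarrow> complex \<Rightarrow> complex" where
  "hor p w = (\<Sum>i<length p. of_int (p ! i) * w ^ i)"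

definition freq :: "int list \<Rightarrow> nat \<Rightarrow> int" where
  "freq p i = 2 * int i - (int (length p) - 1)"

definition lau :: "int list \<Rightarrow> real \<Rightarrow> complex" where
  "lau p t = (\<Sum>i<length p. of_int (p ! i) * cis (of_int (freq p i) * t))"

definition cf :: "int list \<Rightarrow> int \<Rightarrow> int" where
  "cf p j = (let d = j + (int (length p) - 1) in
     if d \<ge> 0 \<and> even d \<and> d div 2 < int (length p) then p ! nat (d div 2) else 0)"

lemma hor_Nil [simp]: "hor [] w = 0"
  by (simp add: hor_def)

lemma hor_Cons [simp]: "hor (a # p) w = of_int a + w * hor p w"
  unfolding hor_def length_Cons
  by (subst sum.lessThan_Suc_shift) (simp add: sum_distrib_left mult_ac)

lemma hor_padd: "hor (padd p q) w = hor p w + hor q w"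
  by (induction p q rule: padd.induct) (auto simp: algebra_simps)

lemma hor_map: "hor (map ((*) a) q) w = of_int a * hor q w"
  by (induction q) (auto simp: algebra_simps)

lemma hor_pmul: "hor (pmul p q) w = hor p w * hor q w"
  by (induction p) (auto simp: hor_padd hor_map algebra_simps)

lemma length_padd [simp]: "length (padd p q) = max (length p) (length q)"
  by (induction p q rule: padd.induct) auto

lemma length_pmul: "p \<noteq> [] \<Longrightarrow> q \<noteq> [] \<Longrightarrow> length (pmul p q) = length p + length q - 1"
proof (induction p)
  case (Cons a p)
  then show ?case
    by (cases "p = []") (auto simp: max_def neq_Nil_conv)
qed simp

text \<open>Splits off the centring factor. Under convolution the lengths minus one add, hence so do
  the centring exponents, and \<open>lau\<close> inherits multiplicativity from
  \<open>hor\<close>.\<close>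

lemma lau_hor: "lau p t = cis (- (real (length p) - 1) * t) * hor p (cis (2 * t))"
proof -
  have "cis (of_int (freq p i) * t) = cis (- (real (length p) - 1) * t) * cis (2 * t) ^ i" for i
    unfolding Complex.DeMoivre cis_mult by (rule arg_cong[where f = cis]) (simp add: freq_def algebra_simps)
  then show ?thesis
    unfolding lau_def hor_def by (simp add: sum_distrib_left mult_ac)
qed

lemma lau_pmul: "p \<noteq> [] \<Longrightarrow> q \<noteq> [] \<Longrightarrow> lau (pmul p q) t = lau p t * lau q t"
proof -
  assume a: "p \<noteq> []" "q \<noteq> []"
  have "length p + length q \<ge> 1" using a by (cases p) auto
  then have "cis (- (real (length (pmul p q)) - 1) * t) =
      cis (- (real (length p) - 1) * t) * cis (- (real (length q) - 1) * t)"
    unfolding length_pmul[OF a] cis_mult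
    by (simp add: of_nat_diff algebra_simps)
  then show ?thesis
    by (simp add: lau_hor hor_pmul)
qed

lemma lau_padd: "length p = length q \<Longrightarrow> lau (padd p q) t = lau p t + lau q t"
  by (simp add: lau_hor hor_padd algebra_simps)

text \<open>The extra leading zero shifts all indices by one and the greater length shifts the
  centre back. This aligns lists whose lengths differ by an even number.\<close>

lemma lau_pad: "lau (0 # p @ [0]) t = lau p t"
proof -
  have "hor (p @ [0]) w = hor p w" for w by (induction p) auto
  moreover have "cis (- (real (length (0 # p @ [0])) - 1) * t) * cis (2 * t) =
      cis (- (real (length p) - 1) * t)"
    by (simp add: cis_mult algebra_simps)
  ultimately show ?thesis
    by (simp add: lau_hor flip: mult.assoc)
qed

lemma norm_lau_le: "norm (lau p t) \<le> of_int (sum_list (map abs p))"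
proof -
  have "norm (lau p t) \<le> (\<Sum>i<length p. norm (of_int (p ! i) * cis (of_int (freq p i) * t)))"
    unfolding lau_def by (rule norm_sum)
  also have "\<dots> = (\<Sum>i<length p. of_int \<bar>p ! i\<bar>)"
    by (simp add: norm_mult)
  also have "\<dots> = of_int (sum_list (map abs p))"
    by (simp add: sum_list_sum_nth atLeast0LessThan)
  finally show ?thesis .
qed

lemma Re_lau: "Re (lau p t) = (\<Sum>i<length p. of_int (p ! i) * cos (of_int (freq p i) * t))"
  by (simp add: lau_def)

text \<open>Reversing the list negates every frequency, so for palindromic coefficients the sine sum
  equals its own negative.\<close>

lemma Im_lau: "rev p = p \<Longrightarrow> Im (lau p t) = 0"
proof -
  assume a: "rev p = p"
  have "Im (lau p t) = (\<Sum>i<length p. of_int (p ! i) * sin (of_int (freq p i) * t))"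
    by (simp add: lau_def)
  also have "\<dots> = (\<Sum>i<length p. of_int (p ! (length p - Suc i)) * sin (of_int (freq p (length p - Suc i)) * t))"
    by (rule sum.nat_diff_reindex[symmetric])
  also have "\<dots> = (\<Sum>i<length p. - (of_int (p ! i) * sin (of_int (freq p i) * t)))"
  proof (rule sum.cong)
    fix i assume "i \<in> {..<length p}"
    then have i: "i < length p" by simp
    have "p ! (length p - Suc i) = p ! i"
      using rev_nth[OF i] a by simp
    moreover have "freq p (length p - Suc i) = - freq p i"
      using i by (simp add: freq_def of_nat_diff)
    ultimately show "of_int (p ! (length p - Suc i)) * sin (of_int (freq p (length p - Suc i)) * t) =
        - (of_int (p ! i) * sin (of_int (freq p i) * t))"
      by simp
  qed simp
  also have "\<dots> = - Im (lau p t)"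
    by (simp add: lau_def sum_negf)
  finally show ?thesis by simp
qed

lemma continuous_lau [continuous_intros]: "continuous_on A (lau p)"
  unfolding lau_def by (auto intro!: continuous_intros)

lemma cf_sum: "cf p j = (\<Sum>i<length p. if freq p i = j then p ! i else 0)"
proof -
  define d where "d = j + (int (length p) - 1)"
  have fr: "freq p i = j \<longleftrightarrow> 2 * int i = d" for i
    by (auto simp: freq_def d_def)
  show ?thesis
  proof (cases "d \<ge> 0 \<and> even d \<and> d div 2 < int (length p)")
    case True
    have "freq p i = j \<longleftrightarrow> i = nat (d div 2)" for i
      unfolding fr using True by (auto elim!: evenE)
    moreover have "nat (d div 2) < length p"
      using True by auto
    ultimately show ?thesis
      using True by (simp add: cf_def Let_def flip: d_def)
  next
    case False
    then have "freq p i \<noteq> j" if "i < length p" for i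
      using that unfolding fr by auto
    then show ?thesis
      using False by (auto simp: cf_def Let_def simp flip: d_def)
  qed
qed

text \<open>Both exponents \<open>j\<close> and \<open>- j\<close> contribute; for
  \<open>j = 0\<close> the same coefficient counts twice, in accordance with \<open>avg\<close>
  being twice the mean.\<close>

lemma avg_lau:
  "avg (\<lambda>t. Re (lau p t) * cos (of_int j * t)) = of_int (cf p j + cf p (- j))"
proof -
  have "avg (\<lambda>t. Re (lau p t) * cos (of_int j * t)) =
      avg (\<lambda>t. \<Sum>i<length p. of_int (p ! i) * (cos (of_int (freq p i) * t) * cos (of_int j * t)))"
    by (simp add: Re_lau sum_distrib_right sum_distrib_left mult_ac)
  also have "\<dots> = (\<Sum>i<length p. of_int (p ! i) * (of_bool (freq p i = j) + of_bool (freq p i = - j)))"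
    by (simp add: avg_sum continuous_intros avg_cmult avg_cos_cos)
  also have "\<dots> = (\<Sum>i<length p. of_int (if freq p i = j then p ! i else 0)) +
      (\<Sum>i<length p. of_int (if freq p i = - j then p ! i else 0))"
    unfolding sum.distrib[symmetric] by (intro sum.cong) auto
  finally show ?thesis
    by (simp add: cf_sum)
qed

text \<open>Comes from \<open>cos k * cos m = (cos (k + m) + cos (k - m)) / 2\<close>, with two
  coefficients for each of the two frequencies. Up to a factor these are the matrix entries of
  multiplication by \<open>p\<close> in the cosine basis.\<close>

definition ent :: "int list \<Rightarrow> int \<Rightarrow> int \<Rightarrow> int" where
  "ent p k m = cf p (k + m) + cf p (- k - m) + cf p (k - m) + cf p (m - k)"

lemma avg_lau_cos_cos:
  "avg (\<lambda>t. Re (lau p t) * (cos (of_int k * t) * cos (of_int m * t))) = of_int (ent p k m) / 2"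
proof -
  have "(\<lambda>t. Re (lau p t) * (cos (of_int k * t) * cos (of_int m * t))) =
     (\<lambda>t. 1/2 * (Re (lau p t) * cos (of_int (k + m) * t) + Re (lau p t) * cos (of_int (k - m) * t)))"
    by (auto simp: cos_times_cos algebra_simps)
  then have "avg (\<lambda>t. Re (lau p t) * (cos (of_int k * t) * cos (of_int m * t))) =
     1/2 * (avg (\<lambda>t. Re (lau p t) * cos (of_int (k + m) * t)) + avg (\<lambda>t. Re (lau p t) * cos (of_int (k - m) * t)))"
    by (simp only: avg_cmult) (subst avg_add, auto intro!: continuous_intros)
  also have "\<dots> = of_int (ent p k m) / 2"
    unfolding avg_lau ent_def by (simp add: algebra_simps)
  finally show ?thesis .
qed

section \<open>The approximate solution\<close>


text \<open>Numerically computed coefficients, in units of \<open>10\<^sup>-\<^sup>5\<close>: \<open>LX\<close> and \<open>LY\<close> are the two coordinates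
  of \<open>z0\<close> and \<open>LS\<close> approximates \<open>1 / |z0|\<close>. A cosine of amplitude \<open>a\<close> contributes \<open>a / 2\<close> at two opposite
  exponents, so that these lists stand for \<open>2 * 10\<^sup>5 = lau_scale\<close> times the functions.\<close>

definition LX :: "int list" where
  "LX = [97, -360, 0, -6691, 40508, 0, 40508, -6691, 0, -360, 97]"
definition LY :: "int list" where
  "LY = [-50, 0, -702, 3035, 0, 131606, 131606, 0, 3035, -702, 0, -50]"
definition LS :: "int list" where
  "LS = [-52, 160, -470, 1377, -3726, 15266, -64440, 2 * 124319, -64440, 15266, -3726, 1377, -470, 160, -52]"

text \<open>Stands for the squared norm of \<open>z0\<close> at scale
  \<open>lau_scale\<^sup>2\<close>. The square of \<open>LX\<close> has two entries fewer than that
  of \<open>LY\<close>, hence the padding.\<close>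

definition "LP = padd (0 # pmul LX LX @ [0]) (pmul LY LY)"
definition "LS2 = pmul LS LS"
definition "LS3 = pmul LS2 LS"
definition "LS5 = pmul LS3 LS2"

definition lau_scale :: int where "lau_scale = 200000"

definition amp :: "nat \<Rightarrow> int" where
  "amp k = (if k = 1 then 131606 else if k = 2 then 40508 else if k = 4 then - 6691
     else if k = 5 then 3035 else if k = 7 then - 702 else if k = 8 then - 360
     else if k = 10 then 97 else if k = 11 then - 50 else 0)"

text \<open>For \<open>q\<close> the product of \<open>LS3\<close> with \<open>LX\<close> or
  \<open>LY\<close>, this is \<open>lau_scale ^ 4\<close> times the coefficient at \<open>k\<close>
  of \<open>- z0'' - s0 ^ 3 * z0\<close>. The leading 2 is
  \<open>lau_scale / 10 ^ 5\<close>.\<close>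

definition resid_num :: "int list \<Rightarrow> nat \<Rightarrow> int" where
  "resid_num q k = 2 * int k ^ 2 * amp k * lau_scale ^ 3 - (cf q (int k) + cf q (- int k))"

text \<open>Dividing by \<open>k\<^sup>2\<close> gives the norm dual to the weighted norm of the
  perturbations. The added 1 turns the rounded-down quotient into an upper bound.\<close>

definition resid_sum :: "int list \<Rightarrow> nat list \<Rightarrow> int" where
  "resid_sum q ks = (\<Sum>k\<leftarrow>ks. resid_num q k ^ 2 div int k ^ 2 + 1)"

text \<open>The next frequency not divisible by 3 is 10. From there on
  \<open>k\<^sup>2 \<ge> 100\<close>, and a crude constant 70 for the potential term is good enough
  without any matrix.\<close>

definition low_modes :: "nat list" where "low_modes = [1, 2, 4, 5, 7, 8]"

text \<open>The second variation on the modes in \<open>low_modes\<close>, where a factor \<open>400 * lau_scale ^ 7\<close> clears the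
  denominators; \<open>low_S\<close>, \<dots>, \<open>low_YY\<close> below are the only Fourier coefficients that enter.\<close>

definition symcf :: "int list \<Rightarrow> int list" where
  "symcf p = map (\<lambda>j. cf p (int j) + cf p (- int j)) [0..<17]"

definition form_num :: "int list \<Rightarrow> int list \<Rightarrow> int list \<Rightarrow> int list \<Rightarrow> nat \<Rightarrow> nat \<Rightarrow> int" where
  "form_num p wxx wxy wyy k m =
     (if even k = even m then 265 * lau_scale ^ 4 * (p ! (k + m) + p ! nat \<bar>int k - int m\<bar>) else 0)
     - 252 * (let w = if even k then if even m then wxx else wxy else if even m then wxy else wyy
        in w ! (k + m) + w ! nat \<bar>int k - int m\<bar>)"

text \<open>The Perron vector of the comparison matrix of the low modes, rounded.\<close>

definition weight :: "nat \<Rightarrow> int" where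
  "weight k = (if k = 1 then 5944 else if k = 2 then 5000 else if k = 4 then 333
     else if k = 5 then 640 else if k = 7 then 308 else 139)"

fun row_sum :: "(nat \<Rightarrow> int) \<Rightarrow> nat list \<Rightarrow> nat \<Rightarrow> int" where
  "row_sum f [] k = 0"
| "row_sum f (m # ms) k = (if m = k then 0 else \<bar>f m\<bar> * weight m) + row_sum f ms k"

text \<open>A weighted row sum against 7/10 of the kinetic entry \<open>k\<^sup>2\<close>, with the
  denominators 10 and \<open>400 * lau_scale ^ 7\<close> cleared. The diagonal enters with its sign,
  only the other entries enter by modulus.\<close>

definition row_ok :: "int list \<Rightarrow> int list \<Rightarrow> int list \<Rightarrow> int list \<Rightarrow> nat \<Rightarrow> bool" where
  "row_ok p wxx wxy wyy k \<longleftrightarrow>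
     10 * (form_num p wxx wxy wyy k k * weight k + row_sum (form_num p wxx wxy wyy k) low_modes k)
     \<le> 7 * 400 * int k ^ 2 * lau_scale ^ 7 * weight k"

definition low_S :: "int list" where
  "low_S =
    [44737223815674344, 0, - 28940648943931176, 0, 13516729921055376, 0, - 5459840533305708, 0,
     2182442923515006, 0, - 875770010020044, 0, 347696377053028, 0, - 132276649893408, 0,
     43717278856332]"

definition low_XX :: "int list" where
  "low_XX =
    [34733529772149518771600472665665449864, 0, - 31943196138820985081114843497664833036, 0,
     26189591831214052700365250288290850274, 0, - 18684970497002559410472019921582081348, 0,
     11548674065477237323852059947310630772, 0, - 6369404821514920976501881455688108908, 0,
     3248365239949305560274830731476300048, 0, - 1567735902245327551715790257520909964, 0,
     723165111156175356991852484105165266]"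

definition low_XY :: "int list" where
  "low_XY =
    [0, - 3737240715315063369686677299594269772, 0, 13139137706023357837958096790869506232, 0,
     - 15574907368137665024363487743993851112, 0, 12153050743864359252095796789281139360, 0,
     - 7565643753745864198762737190507576826, 0, 4149090957871435278340064207266887156, 0,
     - 2108263431039467253820938801995073052, 0, 1015331328652291931658546249918157866, 0]"

definition low_YY :: "int list" where
  "low_YY =
    [36846069976278029444335141427706854720, 0, - 14361732654303929432045281576092040484, 0,
     - 4562933634786104456494206292023348840, 0, 9949221685213156114175805823603719544, 0,
     - 8056908526405397132242031351177489944, 0, 4968543593251653695506288124956108560, 0,
     - 2693532336763704918623067891236527028, 0, 1360404147503265682614128927818747666, 0,
     - 662812095833089539669854140205815188]"

section \<open>Exact integer evaluations\<close>

lemma scale_defect_check: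
  "10000 * sum_list (map abs (padd (pmul LS2 LP) (replicate 25 0 @ [- (lau_scale ^ 4)] @ replicate 25 0)))
     \<le> 5 * lau_scale ^ 4"
  by code_simp

lemma length_LS2_LP: "length (pmul LS2 LP) = 51"
  by code_simp

text \<open>The two lists are the even and the odd frequencies below 54 that are not divisible by 3.
  Perturbations see no others, since the products have degree at most 53.\<close>

lemma residual_check:
  "10 ^ 8 * (resid_sum (pmul LS3 LX) [2,4,8,10,14,16,20,22,26,28,32,34,38,40,44,46,50,52] +
     resid_sum (pmul LS3 LY) [1,5,7,11,13,17,19,23,25,29,31,35,37,41,43,47,49,53])
     \<le> 23\<^sup>2 * lau_scale ^ 8"
  by code_simp

text \<open>The long convolutions are evaluated here once, so that the test of the rows works on
  literal coefficients.\<close>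

lemma symcf_checks:
  "symcf LS3 = low_S"
  "symcf (pmul LS5 (pmul LX LX)) = low_XX"
  "symcf (pmul LS5 (pmul LX LY)) = low_XY"
  "symcf (pmul LS5 (pmul LY LY)) = low_YY"
  by code_simp+

lemma form_check: "list_all (row_ok low_S low_XX low_XY low_YY) low_modes"
  by code_simp

section \<open>Expansion of the Newtonian potential\<close>


text \<open>The Taylor coefficient 3/8 is lowered to 1/3. After squaring, the deviation from 1 is
  \<open>x\<^sup>2\<close> times a cubic that is nonpositive on this range.\<close>

lemma rsqrt_lower:
  fixes x :: real
  assumes "-1 < x" "x \<le> 1/8"
  shows "1 - x/2 + x\<^sup>2/3 \<le> 1 / sqrt (1 + x)"
proof -
  have pos: "0 < 1 - x/2 + x\<^sup>2/3"
    using assms zero_le_power2[of x] by linarith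
  have "-1/12 + 7/12 * x - 2/9 * x\<^sup>2 + x^3/9 \<le> 0"
  proof -
    have "x^3 \<le> x\<^sup>2"
      using assms mult_left_mono[of x 1 "x\<^sup>2"] by (simp add: power2_eq_square power3_eq_cube)
    then show ?thesis using assms zero_le_power2[of x] by linarith
  qed
  then have "x\<^sup>2 * (-1/12 + 7/12 * x - 2/9 * x\<^sup>2 + x^3/9) \<le> 0"
    by (rule mult_nonneg_nonpos[OF zero_le_power2])
  moreover have "(1 + x) * (1 - x/2 + x\<^sup>2/3)\<^sup>2 = 1 + x\<^sup>2 * (-1/12 + 7/12 * x - 2/9 * x\<^sup>2 + x^3/9)"
    by (simp add: field_simps power2_eq_square power3_eq_cube)
  ultimately have "(1 + x) * (1 - x/2 + x\<^sup>2/3)\<^sup>2 \<le> 1" by linarith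
  then have "sqrt ((1 + x) * (1 - x/2 + x\<^sup>2/3)\<^sup>2) \<le> 1" by simp
  then have "sqrt (1 + x) * (1 - x/2 + x\<^sup>2/3) \<le> 1"
    using pos assms by (simp add: real_sqrt_mult)
  then show ?thesis
    using assms by (simp add: field_simps)
qed

text \<open>Deliberately coarse, with 3/8 raised to 1: it serves only where \<open>x\<close> is tiny
  or where any quadratic error will do.\<close>

lemma rsqrt_upper:
  fixes x :: real
  assumes "-1/2 \<le> x"
  shows "1 / sqrt (1 + x) \<le> 1 - x/2 + x\<^sup>2"
proof -
  have pos: "0 < 1 - x/2 + x\<^sup>2"
  proof -
    have "1 - x/2 + x\<^sup>2 = (x - 1/4)\<^sup>2 + 15/16" by (simp add: power2_eq_square algebra_simps)
    then show ?thesis using zero_le_power2[of "x - 1/4"] by linarith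
  qed
  have "0 \<le> 5/4 + 5/4 * x + x^3"
  proof (cases "x \<ge> 0")
    case False
    have "(-x)^3 \<le> (1/2)^3" using False assms by (intro power_mono) auto
    then have "x^3 \<ge> -1/8" by (simp add: power3_eq_cube)
    then show ?thesis using assms by simp
  qed simp
  then have "0 \<le> x\<^sup>2 * (5/4 + 5/4 * x + x^3)" by simp
  moreover have "(1 + x) * (1 - x/2 + x\<^sup>2)\<^sup>2 = 1 + x\<^sup>2 * (5/4 + 5/4 * x + x^3)"
    by (simp add: field_simps power2_eq_square power3_eq_cube)
  ultimately have "1 \<le> (1 + x) * (1 - x/2 + x\<^sup>2)\<^sup>2" by linarith
  then have "1 \<le> sqrt ((1 + x) * (1 - x/2 + x\<^sup>2)\<^sup>2)" by simp
  then have "1 \<le> sqrt (1 + x) * (1 - x/2 + x\<^sup>2)"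
    using pos assms by (simp add: real_sqrt_mult)
  then show ?thesis
    using assms by (simp add: field_simps)
qed

lemma norm_add_sq:
  fixes z h :: complex
  shows "(norm (z + h))\<^sup>2 = (norm z)\<^sup>2 + 2 * (z \<bullet> h) + (norm h)\<^sup>2"
  by (simp add: power2_norm_eq_inner inner_add_left inner_add_right inner_commute)

lemma inverse_norm_scaled:
  fixes z :: complex
  assumes "0 < s"
  shows "inverse (norm z) = s * (1 / sqrt (1 + (s\<^sup>2 * (norm z)\<^sup>2 - 1)))"
proof -
  have "sqrt (1 + (s\<^sup>2 * (norm z)\<^sup>2 - 1)) = s * norm z"
    using assms by (simp add: real_sqrt_mult)
  then show ?thesis using assms by (simp add: field_simps)
qed

text \<open>Second-order expansion of \<open>1/|z + h|\<close> in which \<open>1/|z|\<close> is replaced by an approximation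
  \<open>s\<close>: for trigonometric polynomials \<open>z\<close> and \<open>s\<close> the coefficients are again such polynomials.\<close>

lemma inverse_norm_expansion:
  fixes z h :: complex
  assumes s: "0 < s" "s \<le> 21/10"
    and d: "\<bar>s\<^sup>2 * (norm z)\<^sup>2 - 1\<bar> \<le> 5/10000"
    and h: "norm h \<le> 26/1000"
  shows "inverse (norm (z + h)) - inverse (norm z) \<ge>
    - (s^3 * (z \<bullet> h)) - 1/2 * (53/52) * (s^3 * (norm h)\<^sup>2) + 1/2 * (54/25) * (s^5 * (z \<bullet> h)\<^sup>2)
    - 3/1000000"
proof -
  define p where "p = (norm z)\<^sup>2"
  define x0 where "x0 = s\<^sup>2 * p - 1"
  define w where "w = 2 * (z \<bullet> h) + (norm h)\<^sup>2"
  define x where "x = x0 + s\<^sup>2 * w"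
  have x0: "\<bar>x0\<bar> \<le> 5/10000" using d by (simp add: x0_def p_def)
  have xeq: "x = s\<^sup>2 * (norm (z + h))\<^sup>2 - 1"
    unfolding norm_add_sq by (simp add: x_def x0_def p_def w_def algebra_simps)
  have sz: "s * norm z \<le> 1001/1000"
  proof -
    have "(s * norm z)\<^sup>2 \<le> (1001/1000)\<^sup>2"
      using x0 unfolding x0_def p_def power_mult_distrib abs_le_iff by (simp add: power2_eq_square)
    then show ?thesis by (rule power2_le_imp_le) simp
  qed
  have sh: "s * norm h \<le> 546/10000"
    using mult_mono[OF s(2) h] s by simp
  have szh: "\<bar>s\<^sup>2 * (z \<bullet> h)\<bar> \<le> (s * norm z) * (s * norm h)"
  proof -
    have "s\<^sup>2 * \<bar>z \<bullet> h\<bar> \<le> s\<^sup>2 * (norm z * norm h)"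
      by (intro mult_left_mono Cauchy_Schwarz_ineq2) simp
    then show ?thesis by (simp add: abs_mult power2_eq_square mult_ac)
  qed
  also have "\<dots> \<le> 1001/1000 * (546/10000)"
    using s by (intro mult_mono sz sh) auto
  finally have szh: "\<bar>s\<^sup>2 * (z \<bullet> h)\<bar> \<le> 5466/100000" by simp
  have sh2: "s\<^sup>2 * (norm h)\<^sup>2 \<le> (546/10000)\<^sup>2"
    unfolding power_mult_distrib[symmetric] using s by (intro power_mono sh) auto
  have sh2': "0 \<le> s\<^sup>2 * (norm h)\<^sup>2" by simp
  have sw: "s\<^sup>2 * w = 2 * (s\<^sup>2 * (z \<bullet> h)) + s\<^sup>2 * (norm h)\<^sup>2"
    by (simp add: w_def algebra_simps)
  have xu: "x \<le> 1/8" and xl: "-1 < x"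
  proof -
    have "s\<^sup>2 * (norm h)\<^sup>2 \<le> 3/1000" using sh2 by (simp add: power_divide)
    then show "x \<le> 1/8" "-1 < x" using x0 szh sh2' unfolding x_def sw by linarith+
  qed
  have lower: "s * (1 - x/2 + x\<^sup>2/3) \<le> inverse (norm (z + h))"
    unfolding inverse_norm_scaled[OF s(1)] xeq[symmetric]
    by (rule mult_left_mono[OF rsqrt_lower[OF xl xu]]) (use s in simp)
  have upper: "inverse (norm z) \<le> s * (1 - x0/2 + x0\<^sup>2)"
    unfolding inverse_norm_scaled[OF s(1)] p_def[symmetric] x0_def[symmetric]
    by (rule mult_left_mono[OF rsqrt_upper]) (use s x0 in auto)
  \<comment> \<open>Young's inequality. Used twice it leaves \<open>9/10 * 9/10 * 4/3\<close>, that
    is half of 54/25, as the coefficient of the squared inner product; with the exact Taylor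
    coefficient it would be half of 3.\<close>
  have sq: "(a + b)\<^sup>2 \<ge> 9/10 * b\<^sup>2 - 9 * a\<^sup>2" for a b :: real
  proof -
    have "0 \<le> (10 * a + b)\<^sup>2" by simp
    then show ?thesis by (simp add: power2_eq_square algebra_simps)
  qed
  have x2: "x\<^sup>2 \<ge> 9/10 * (s\<^sup>2 * w)\<^sup>2 - 9 * x0\<^sup>2"
    unfolding x_def by (rule sq)
  have w2: "(s\<^sup>2 * w)\<^sup>2 \<ge> 9/10 * (2 * (s\<^sup>2 * (z \<bullet> h)))\<^sup>2 - 9 * (s\<^sup>2 * (norm h)\<^sup>2)\<^sup>2"
    unfolding sw using sq[where a = "s\<^sup>2 * (norm h)\<^sup>2" and b = "2 * (s\<^sup>2 * (z \<bullet> h))"] by (simp add: add.commute)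
  have h4: "(s\<^sup>2 * (norm h)\<^sup>2)\<^sup>2 \<le> (546/10000)\<^sup>2 * (s\<^sup>2 * (norm h)\<^sup>2)"
    unfolding power2_eq_square[of "s\<^sup>2 * (norm h)\<^sup>2"] by (rule mult_right_mono[OF sh2 sh2'])
  have x02: "x0\<^sup>2 \<le> (5/10000)\<^sup>2"
    using x0 by (subst power2_abs[symmetric], intro power_mono) auto
  \<comment> \<open>The terms linear in \<open>x0\<close> cancel between the lower and the upper
    bound, so the defect of \<open>s\<close> enters only through \<open>x0\<^sup>2\<close>. The
    excess of 53/52 over 1 pays for the term quadratic in
    \<open>s\<^sup>2 * (norm h)\<^sup>2\<close>.\<close>
  have "- x/2 + x\<^sup>2/3 + x0/2 - x0\<^sup>2 \<ge>
     - (s\<^sup>2 * (z \<bullet> h)) - 1/2 * (53/52) * (s\<^sup>2 * (norm h)\<^sup>2) + 1/2 * (54/25) * (s\<^sup>2 * (z \<bullet> h))\<^sup>2 - 1/1000000"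
  proof -
    define A where "A = s\<^sup>2 * (z \<bullet> h)"
    define B where "B = s\<^sup>2 * (norm h)\<^sup>2"
    have "(s\<^sup>2 * w)\<^sup>2 \<ge> 18/5 * A\<^sup>2 - 9 * B\<^sup>2"
      using w2 by (simp add: A_def[symmetric] B_def[symmetric] power_mult_distrib)
    moreover have "B\<^sup>2 \<le> 3/1000 * B"
      using h4 sh2' mult_right_mono[of "(546/10000)\<^sup>2" "3/1000" B]
      by (simp add: B_def[symmetric] power_divide)
    moreover have "x0\<^sup>2 \<le> 1/4000000" using x02 by (simp add: power_divide)
    moreover have "0 \<le> B" using sh2' by (simp add: B_def)
    moreover have "x = x0 + 2 * A + B" by (simp add: x_def sw A_def B_def)
    ultimately show ?thesis
      using x2 unfolding A_def[symmetric] B_def[symmetric] by linarith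
  qed
  then have "s * (- x/2 + x\<^sup>2/3 + x0/2 - x0\<^sup>2) \<ge>
     s * (- (s\<^sup>2 * (z \<bullet> h)) - 1/2 * (53/52) * (s\<^sup>2 * (norm h)\<^sup>2) + 1/2 * (54/25) * (s\<^sup>2 * (z \<bullet> h))\<^sup>2 - 1/1000000)"
    by (rule mult_left_mono) (use s in simp)
  moreover have "s * (- (s\<^sup>2 * (z \<bullet> h)) - 1/2 * (53/52) * (s\<^sup>2 * (norm h)\<^sup>2) + 1/2 * (54/25) * (s\<^sup>2 * (z \<bullet> h))\<^sup>2 - 1/1000000)
     = - (s^3 * (z \<bullet> h)) - 1/2 * (53/52) * (s^3 * (norm h)\<^sup>2) + 1/2 * (54/25) * (s^5 * (z \<bullet> h)\<^sup>2) - s / 1000000"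
    by (simp add: power2_eq_square eval_nat_numeral algebra_simps)
  moreover have "inverse (norm (z + h)) - inverse (norm z) \<ge> s * (- x/2 + x\<^sup>2/3 + x0/2 - x0\<^sup>2)"
    using lower upper by (simp add: algebra_simps)
  ultimately show ?thesis using s by linarith
qed

text \<open>Exact gradient and a generous quadratic error. At a minimiser this one-sided estimate is
  enough, because it is applied to increments of both signs.\<close>

lemma inverse_norm_upper:
  fixes z w :: complex
  assumes m: "0 < m" "m \<le> norm z" and w: "norm w \<le> m / 8"
  shows "inverse (norm (z + w)) \<le> inverse (norm z) - (z \<bullet> w) / norm z ^ 3 + 5 / m ^ 3 * (norm w)\<^sup>2"
proof -
  define r where "r = norm z"
  define x where "x = (2 * (z \<bullet> w) + (norm w)\<^sup>2) / r\<^sup>2"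
  have r: "0 < r" "m \<le> r" "norm w \<le> r / 8" using m w by (auto simp: r_def)
  have zw: "\<bar>z \<bullet> w\<bar> \<le> r * norm w"
    unfolding r_def by (rule Cauchy_Schwarz_ineq2)
  have w2: "(norm w)\<^sup>2 \<le> r / 8 * norm w"
    unfolding power2_eq_square by (intro mult_right_mono r(3)) simp
  have num: "\<bar>2 * (z \<bullet> w) + (norm w)\<^sup>2\<bar> \<le> 17/8 * (r * norm w)"
    using zw w2 zero_le_power2[of "norm w"] by linarith
  also have "\<dots> \<le> 17/8 * (r * (r / 8))"
    using r by (intro mult_left_mono) auto
  also have "\<dots> \<le> 1/2 * r\<^sup>2" by (simp add: power2_eq_square)
  finally have "\<bar>x\<bar> \<le> 1/2"
    using r by (simp add: x_def abs_divide divide_le_eq)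
  then have x: "-1/2 \<le> x" by linarith
  have xeq: "x = (1/r)\<^sup>2 * (norm (z + w))\<^sup>2 - 1"
    unfolding norm_add_sq using r by (simp add: x_def field_simps flip: r_def)
  have "inverse (norm (z + w)) \<le> 1/r * (1 - x/2 + x\<^sup>2)"
    using mult_left_mono[OF rsqrt_upper[OF x], of "1/r"] r inverse_norm_scaled[of "1/r" "z + w"]
    by (simp only: xeq[symmetric]) simp
  also have "\<dots> = inverse r - (z \<bullet> w) / r ^ 3 - (norm w)\<^sup>2 / (2 * r ^ 3) + x\<^sup>2 / r"
    using r by (simp add: x_def field_simps power3_eq_cube power2_eq_square)
  also have "\<dots> \<le> inverse r - (z \<bullet> w) / r ^ 3 + x\<^sup>2 / r"
    using r by simp
  also have "x\<^sup>2 / r \<le> 5 / m ^ 3 * (norm w)\<^sup>2"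
  proof -
    have "\<bar>x\<bar> \<le> 17/8 * (r * norm w) / r\<^sup>2"
      using divide_right_mono[OF num, of "r\<^sup>2"] r by (simp add: x_def abs_divide)
    then have "\<bar>x\<bar> \<le> 17/8 * norm w / r"
      using r by (simp add: power2_eq_square)
    then have "x\<^sup>2 \<le> (17/8 * norm w / r)\<^sup>2"
      by (subst power2_abs[symmetric]) (intro power_mono, auto)
    also have "\<dots> \<le> 5 * (norm w)\<^sup>2 / r\<^sup>2"
      using divide_right_mono[of "289/64 * (norm w)\<^sup>2" "5 * (norm w)\<^sup>2" "r\<^sup>2"]
      by (simp add: power_mult_distrib power_divide)
    finally have "x\<^sup>2 / r \<le> 5 * (norm w)\<^sup>2 / r\<^sup>2 / r"
      using r by (intro divide_right_mono) auto
    also have "\<dots> = 5 / r ^ 3 * (norm w)\<^sup>2" by (simp add: power2_eq_square power3_eq_cube)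
    also have "\<dots> \<le> 5 / m ^ 3 * (norm w)\<^sup>2"
      using m r by (intro mult_right_mono divide_left_mono power_mono) auto
    finally show ?thesis .
  qed
  finally show ?thesis by (simp add: r_def)
qed

section \<open>Cosine series in a weighted sequence space\<close>


text \<open>Real cosines in even and imaginary cosines in odd frequencies: real combinations are
  even in \<open>t\<close> and are conjugated by the shift by \<open>pi\<close>, so the symmetry is
  built into the basis.\<close>

definition emode :: "nat \<Rightarrow> real \<Rightarrow> complex" where
  "emode k t = (if even k then of_real (cos (real k * t)) else \<i> * of_real (cos (real k * t)))"

definition ser :: "(nat \<Rightarrow> real) \<Rightarrow> real \<Rightarrow> complex" where
  "ser h t = (\<Sum>k. h k *\<^sub>R emode k t)"

lemma norm_emode_le: "norm (emode k t) \<le> 1"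
  by (simp add: emode_def norm_mult)

lemma continuous_emode [continuous_intros]: "continuous_on A (emode k)"
  unfolding emode_def by (cases "even k") (auto intro!: continuous_intros)

lemma inner_emode_emode:
  "emode k t \<bullet> emode l t = (if even k = even l then cos (real k * t) * cos (real l * t) else 0)"
  by (auto simp: emode_def inner_complex_def)

lemma avg_emode_emode:
  assumes "k > 0"
  shows "avg (\<lambda>t. emode k t \<bullet> emode l t) = of_bool (k = l)"
  using avg_cos_cos[of "int k" "int l"] assms
  by (cases "even k = even l") (auto simp: inner_emode_emode avg_const[of 0, simplified])

lemma avg_norm_diff_le:
  assumes "continuous_on UNIV F" "continuous_on UNIV G" "\<And>t. \<bar>F t - G t\<bar> \<le> e"
  shows "\<bar>avg F - avg G\<bar> \<le> 2 * e"
proof -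
  have le: "F t \<le> G t + e" "G t \<le> F t + e" for t
    using assms(3)[of t] by linarith+
  have "avg F \<le> avg (\<lambda>t. G t + e)" "avg G \<le> avg (\<lambda>t. F t + e)"
    by (intro avg_mono continuous_intros assms(1,2) le)+
  then show ?thesis
    using assms(1,2) by (simp add: avg_add avg_const continuous_on_const abs_le_iff)
qed

lemma avg_tendsto:
  assumes "\<And>n. continuous_on UNIV (F n)" "continuous_on UNIV G"
    and "\<And>n t. \<bar>F n t - G t\<bar> \<le> e n" "e \<longlonglongrightarrow> 0"
  shows "(\<lambda>n. avg (F n)) \<longlonglongrightarrow> avg G"
proof -
  have "(\<lambda>n. avg (F n) - avg G) \<longlonglongrightarrow> 0"
  proof (rule tendsto_rabs_zero_cancel, rule tendsto_sandwich[where f = "\<lambda>_. 0"])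
    show "\<forall>\<^sub>F n in sequentially. \<bar>avg (F n) - avg G\<bar> \<le> 2 * e n"
      using avg_norm_diff_le assms(1-3) by (intro always_eventually) blast
    show "(\<lambda>n. 2 * e n) \<longlonglongrightarrow> 0"
      using tendsto_mult_left[OF assms(4), of 2] by simp
  qed auto
  then show ?thesis by (rule LIM_zero_cancel)
qed

lemma summable_ser: "summable (\<lambda>k. \<bar>h k\<bar>) \<Longrightarrow> summable (\<lambda>k. h k *\<^sub>R emode k t)"
proof (rule summable_comparison_test')
  fix k show "norm (h k *\<^sub>R emode k t) \<le> \<bar>h k\<bar>"
    using norm_emode_le[of k t] by (simp add: mult_left_le)
qed

lemma ser_partial_bound:
  assumes "summable (\<lambda>k. \<bar>h k\<bar>)"
  shows "norm (ser h t - (\<Sum>k<n. h k *\<^sub>R emode k t)) \<le> (\<Sum>k. \<bar>h k\<bar>) - (\<Sum>k<n. \<bar>h k\<bar>)"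
proof -
  have "ser h t - (\<Sum>k<n. h k *\<^sub>R emode k t) = (\<Sum>k. h (k + n) *\<^sub>R emode (k + n) t)"
    unfolding ser_def by (rule suminf_minus_initial_segment[symmetric]) (rule summable_ser[OF assms])
  also have "norm \<dots> \<le> (\<Sum>k. \<bar>h (k + n)\<bar>)"
  proof (rule norm_suminf_le)
    show "norm (h (k + n) *\<^sub>R emode (k + n) t) \<le> \<bar>h (k + n)\<bar>" for k
      using norm_emode_le[of "k + n" t] by (simp add: mult_left_le)
    show "summable (\<lambda>k. \<bar>h (k + n)\<bar>)"
      using summable_ignore_initial_segment[OF assms] .
  qed
  also have "\<dots> = (\<Sum>k. \<bar>h k\<bar>) - (\<Sum>k<n. \<bar>h k\<bar>)"
    by (rule suminf_minus_initial_segment[OF assms])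
  finally show ?thesis .
qed

lemma norm_ser_le: "summable (\<lambda>k. \<bar>h k\<bar>) \<Longrightarrow> norm (ser h t) \<le> (\<Sum>k. \<bar>h k\<bar>)"
  using ser_partial_bound[of h t 0] by simp

lemma tail_tendsto_0: "summable (\<lambda>k. \<bar>h k\<bar>) \<Longrightarrow> (\<lambda>n. (\<Sum>k. \<bar>h k\<bar>) - (\<Sum>k<n. \<bar>h k\<bar>)) \<longlonglongrightarrow> (0::real)"
  using tendsto_diff[OF tendsto_const summable_LIMSEQ, of "\<lambda>k. \<bar>h k\<bar>" "\<Sum>k. \<bar>h k\<bar>"] by simp

lemma continuous_ser:
  assumes "summable (\<lambda>k. \<bar>h k\<bar>)"
  shows "continuous_on A (ser h)"
proof (rule uniform_limit_theorem[where F = sequentially])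
  show "uniform_limit A (\<lambda>n t. \<Sum>k<n. h k *\<^sub>R emode k t) (ser h) sequentially"
    unfolding ser_def
  proof (rule Weierstrass_m_test[OF _ assms])
    show "norm (h k *\<^sub>R emode k t) \<le> \<bar>h k\<bar>" for k t
      using norm_emode_le[of k t] by (simp add: mult_left_le)
  qed
qed (auto intro!: always_eventually continuous_intros)

lemma ser_add:
  "summable (\<lambda>k. \<bar>g k\<bar>) \<Longrightarrow> summable (\<lambda>k. \<bar>h k\<bar>) \<Longrightarrow> ser (\<lambda>k. g k + h k) t = ser g t + ser h t"
  unfolding ser_def by (simp add: scaleR_add_left suminf_add summable_ser)

lemma ser_diff:
  "summable (\<lambda>k. \<bar>g k\<bar>) \<Longrightarrow> summable (\<lambda>k. \<bar>h k\<bar>) \<Longrightarrow> ser (\<lambda>k. g k - h k) t = ser g t - ser h t"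
  unfolding ser_def by (simp add: scaleR_diff_left suminf_diff summable_ser)

lemma ser_finite:
  assumes "finite K" "\<And>k. k \<notin> K \<Longrightarrow> h k = 0"
  shows "ser h t = (\<Sum>k\<in>K. h k *\<^sub>R emode k t)"
  unfolding ser_def by (rule suminf_finite) (use assms in auto)

lemma summable_abs_finite:
  "finite K \<Longrightarrow> (\<And>k. k \<notin> K \<Longrightarrow> h k = 0) \<Longrightarrow> summable (\<lambda>k. \<bar>h k :: real\<bar>)"
  by (rule summable_finite) auto

text \<open>Absolute summability gives uniform convergence, so averaging commutes with the series.
  With a mode for \<open>u\<close> this yields the coefficients, with the series itself for
  \<open>u\<close> it yields Parseval's identity.\<close>

lemma avg_inner_ser:
  assumes h: "summable (\<lambda>k. \<bar>h k\<bar>)" and u: "continuous_on UNIV u" "\<And>t. norm (u t) \<le> B"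
  shows "(\<lambda>k. h k * avg (\<lambda>t. u t \<bullet> emode k t)) sums avg (\<lambda>t. u t \<bullet> ser h t)"
  unfolding sums_def
proof -
  define e where "e n = B * ((\<Sum>k. \<bar>h k\<bar>) - (\<Sum>k<n. \<bar>h k\<bar>))" for n
  have B: "0 \<le> B" using u(2)[of 0] norm_ge_zero order_trans by blast
  have eq: "(\<Sum>k<n. h k * avg (\<lambda>t. u t \<bullet> emode k t)) = avg (\<lambda>t. u t \<bullet> (\<Sum>k<n. h k *\<^sub>R emode k t))" for n
    by (simp add: inner_sum_right avg_sum avg_cmult continuous_intros u)
  show "(\<lambda>n. \<Sum>k<n. h k * avg (\<lambda>t. u t \<bullet> emode k t)) \<longlonglongrightarrow> avg (\<lambda>t. u t \<bullet> ser h t)"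
    unfolding eq
  proof (rule avg_tendsto)
    show "\<bar>u t \<bullet> (\<Sum>k<n. h k *\<^sub>R emode k t) - u t \<bullet> ser h t\<bar> \<le> e n" for n t
    proof -
      have "\<bar>u t \<bullet> (\<Sum>k<n. h k *\<^sub>R emode k t) - u t \<bullet> ser h t\<bar> =
          \<bar>u t \<bullet> (ser h t - (\<Sum>k<n. h k *\<^sub>R emode k t))\<bar>"
        by (simp add: inner_diff_right abs_minus_commute)
      also have "\<dots> \<le> norm (u t) * norm (ser h t - (\<Sum>k<n. h k *\<^sub>R emode k t))"
        by (rule Cauchy_Schwarz_ineq2)
      also have "\<dots> \<le> e n"
        unfolding e_def by (intro mult_mono u(2) ser_partial_bound h B norm_ge_zero)
      finally show ?thesis .
    qed
    show "e \<longlonglongrightarrow> 0"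
      unfolding e_def using tendsto_mult_left[OF tail_tendsto_0[OF h], of B] by simp
  qed (auto intro!: continuous_intros u continuous_ser[OF h])
qed

lemma avg_ser_emode:
  assumes h: "summable (\<lambda>k. \<bar>h k\<bar>)" and "h 0 = 0"
  shows "avg (\<lambda>t. emode l t \<bullet> ser h t) = h l"
proof -
  have "(\<lambda>k. h k * avg (\<lambda>t. emode l t \<bullet> emode k t)) sums avg (\<lambda>t. emode l t \<bullet> ser h t)"
    by (rule avg_inner_ser[OF h _ norm_emode_le]) (rule continuous_emode)
  moreover have "(\<lambda>k. h k * avg (\<lambda>t. emode l t \<bullet> emode k t)) = (\<lambda>k. if k = l then h k else 0)"
  proof
    fix k show "h k * avg (\<lambda>t. emode l t \<bullet> emode k t) = (if k = l then h k else 0)"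
      using avg_emode_emode[of k l] assms(2) by (cases "k = 0") (auto simp: inner_commute)
  qed
  ultimately show ?thesis
    using sums_unique2[OF sums_single[of l h]] by (metis sums_unique2 sums_single)
qed

lemma avg_norm_ser:
  assumes h: "summable (\<lambda>k. \<bar>h k\<bar>)" and "h 0 = 0"
  shows "(\<lambda>k. (h k)\<^sup>2) sums avg (\<lambda>t. (norm (ser h t))\<^sup>2)"
proof -
  have "(\<lambda>k. h k * avg (\<lambda>t. ser h t \<bullet> emode k t)) sums avg (\<lambda>t. ser h t \<bullet> ser h t)"
    by (rule avg_inner_ser[OF h continuous_ser[OF h] norm_ser_le[OF h]])
  then show ?thesis
    using avg_ser_emode[OF assms] by (simp add: inner_commute power2_eq_square flip: power2_norm_eq_inner)
qed

text \<open>Multiples of 3 include 0, so the mean vanishes. Bounding partial sums instead of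
  \<open>hnorm2\<close> includes convergence of the series and passes to coefficientwise
  limits.\<close>

definition hball :: "real \<Rightarrow> (nat \<Rightarrow> real) set" where
  "hball r = {h. (\<forall>k. 3 dvd k \<longrightarrow> h k = 0) \<and> (\<forall>n. (\<Sum>k<n. (real k * h k)\<^sup>2) \<le> r\<^sup>2)}"

definition hnorm2 :: "(nat \<Rightarrow> real) \<Rightarrow> real" where
  "hnorm2 h = (\<Sum>k. (real k * h k)\<^sup>2)"

lemma hball_zero_mult_3: "h \<in> hball r \<Longrightarrow> 3 dvd k \<Longrightarrow> h k = 0"
  by (simp add: hball_def)

lemma hball_partial: "h \<in> hball r \<Longrightarrow> (\<Sum>k<n. (real k * h k)\<^sup>2) \<le> r\<^sup>2"
  by (simp add: hball_def)

lemma summable_hnorm2: "h \<in> hball r \<Longrightarrow> summable (\<lambda>k. (real k * h k)\<^sup>2)"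
  by (rule summableI_nonneg_bounded[where x = "r\<^sup>2"]) (auto simp: hball_def)

lemma hnorm2_le: "h \<in> hball r \<Longrightarrow> hnorm2 h \<le> r\<^sup>2"
  unfolding hnorm2_def by (rule suminf_le_const[OF summable_hnorm2]) (auto simp: hball_def)

lemma hballI:
  assumes "\<And>k. 3 dvd k \<Longrightarrow> h k = 0" "summable (\<lambda>k. (real k * h k)\<^sup>2)" "hnorm2 h \<le> r\<^sup>2"
  shows "h \<in> hball r"
  unfolding hball_def
proof (intro CollectI conjI allI impI)
  fix n show "(\<Sum>k<n. (real k * h k)\<^sup>2) \<le> r\<^sup>2"
    using sum_le_suminf[OF assms(2), of "{..<n}"] assms(3) by (simp add: hnorm2_def)
qed (use assms in auto)

section \<open>Embedding of the ball into bounded functions, and its compactness\<close>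

lemma summable_inverse_squares: "summable (\<lambda>k. 1 / (real k)\<^sup>2)"
  using inverse_power_summable[of 2, where ?'a = real] by (simp add: inverse_eq_divide power_one_over)

text \<open>Cauchy-Schwarz with the weights \<open>k\<close> and \<open>1 / k\<close>: a Sobolev
  embedding with explicit constant. The index set is arbitrary because tails of the series need the
  estimate as well.\<close>

lemma sum_abs_le:
  assumes "h \<in> hball r" "0 \<le> r" "finite K"
  shows "(\<Sum>k\<in>K. \<bar>h k\<bar>) \<le> r * sqrt (\<Sum>k\<in>K. 1 / (real k)\<^sup>2)"
proof -
  have "(\<Sum>k\<in>K. \<bar>h k\<bar>) = (\<Sum>k\<in>K. \<bar>real k * h k\<bar> * (1 / real k))"
  proof (rule sum.cong)
    fix k show "\<bar>h k\<bar> = \<bar>real k * h k\<bar> * (1 / real k)"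
      using hball_zero_mult_3[OF assms(1), of 0] by (cases "k = 0") (auto simp: abs_mult)
  qed simp
  also have "(\<dots>)\<^sup>2 \<le> (\<Sum>k\<in>K. (real k * h k)\<^sup>2) * (\<Sum>k\<in>K. 1 / (real k)\<^sup>2)"
    using Cauchy_Schwarz_ineq_sum[of "\<lambda>k. \<bar>real k * h k\<bar>" "\<lambda>k. 1 / real k" K]
    by (simp add: power_divide)
  also have "\<dots> \<le> r\<^sup>2 * (\<Sum>k\<in>K. 1 / (real k)\<^sup>2)"
  proof (rule mult_right_mono)
    obtain n where n: "K \<subseteq> {..<n}" using finite_nat_iff_bounded assms(3) by blast
    have "(\<Sum>k\<in>K. (real k * h k)\<^sup>2) \<le> (\<Sum>k<n. (real k * h k)\<^sup>2)"
      by (rule sum_mono2) (use n in auto)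
    then show "(\<Sum>k\<in>K. (real k * h k)\<^sup>2) \<le> r\<^sup>2"
      using hball_partial[OF assms(1), of n] by linarith
  qed (auto intro!: sum_nonneg)
  finally have "sqrt ((\<Sum>k\<in>K. \<bar>h k\<bar>)\<^sup>2) \<le> sqrt (r\<^sup>2 * (\<Sum>k\<in>K. 1 / (real k)\<^sup>2))"
    by (rule real_sqrt_le_mono)
  then show ?thesis
    using assms by (simp add: real_sqrt_mult sum_nonneg)
qed

lemma sum_inverse_squares_le: "finite K \<Longrightarrow> (\<Sum>k\<in>K. 1 / (real k)\<^sup>2) \<le> (13/10)\<^sup>2"
proof -
  assume "finite K"
  have "(\<Sum>k\<in>K. 1 / (real k)\<^sup>2) \<le> (\<Sum>k. 1 / (real k)\<^sup>2)"
    by (rule sum_le_suminf[OF summable_inverse_squares \<open>finite K\<close>]) auto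
  also have "\<dots> = (\<Sum>k. 1 / (real (Suc k))\<^sup>2)"
    using suminf_split_head[OF summable_inverse_squares] by simp
  also have "\<dots> = pi\<^sup>2 / 6"
    using inverse_squares_sums by (simp add: sums_iff add.commute)
  also have "\<dots> \<le> (13/10)\<^sup>2"
  proof -
    have "pi\<^sup>2 \<le> (3.1416)\<^sup>2" using pi_approx by (intro power_mono) auto
    then show ?thesis by (simp add: power2_eq_square)
  qed
  finally show ?thesis .
qed

lemma hball_sum_abs_le:
  assumes "h \<in> hball r" "0 \<le> r" "finite K"
  shows "(\<Sum>k\<in>K. \<bar>h k\<bar>) \<le> 13/10 * r"
proof -
  have "sqrt (\<Sum>k\<in>K. 1 / (real k)\<^sup>2) \<le> 13/10"
    using real_sqrt_le_mono[OF sum_inverse_squares_le[OF assms(3)]] by simp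
  then show ?thesis
    using sum_abs_le[OF assms] mult_left_mono[of _ "13/10" r] assms(2) by fastforce
qed

lemma hball_summable_abs: "h \<in> hball r \<Longrightarrow> 0 \<le> r \<Longrightarrow> summable (\<lambda>k. \<bar>h k\<bar>)"
  by (rule summableI_nonneg_bounded[where x = "13/10 * r"], simp, rule hball_sum_abs_le) auto

lemma hball_norm_ser_le: "h \<in> hball r \<Longrightarrow> 0 \<le> r \<Longrightarrow> norm (ser h t) \<le> 13/10 * r"
  using order_trans[OF norm_ser_le[OF hball_summable_abs]
      suminf_le_const[OF hball_summable_abs hball_sum_abs_le]] by blast

lemma hball_diff:
  assumes "g \<in> hball r" "h \<in> hball r"
  shows "(\<lambda>k. g k - h k) \<in> hball (2 * r)"
  unfolding hball_def
proof (intro CollectI conjI allI impI)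
  fix n
  have "(\<Sum>k<n. (real k * (g k - h k))\<^sup>2) \<le> (\<Sum>k<n. 2 * (real k * g k)\<^sup>2 + 2 * (real k * h k)\<^sup>2)"
  proof (rule sum_mono)
    fix k
    have "0 \<le> (real k * g k + real k * h k)\<^sup>2" by simp
    then show "(real k * (g k - h k))\<^sup>2 \<le> 2 * (real k * g k)\<^sup>2 + 2 * (real k * h k)\<^sup>2"
      by (simp add: power2_eq_square algebra_simps)
  qed
  also have "\<dots> = 2 * (\<Sum>k<n. (real k * g k)\<^sup>2) + 2 * (\<Sum>k<n. (real k * h k)\<^sup>2)"
    by (simp add: sum.distrib sum_distrib_left)
  also have "\<dots> \<le> (2 * r)\<^sup>2"
    using hball_partial[OF assms(1), of n] hball_partial[OF assms(2), of n] by (simp add: power_mult_distrib)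
  finally show "(\<Sum>k<n. (real k * (g k - h k))\<^sup>2) \<le> (2 * r)\<^sup>2" .
qed (use assms in \<open>auto simp: hball_def\<close>)

text \<open>Tychonoff's theorem for a product of intervals gives coefficientwise convergence. The
  limit stays in the ball since each defining condition involves finitely many coefficients.\<close>

lemma hball_compact:
  assumes "\<And>n. hs n \<in> hball r" "0 \<le> r"
  obtains h \<sigma> where "h \<in> hball r" "strict_mono (\<sigma> :: nat \<Rightarrow> nat)" "\<And>k. (\<lambda>n. hs (\<sigma> n) k) \<longlonglongrightarrow> h k"
proof -
  define P where "P = PiE (UNIV :: nat set) (\<lambda>_. {-(13/10 * r)..13/10 * r})"
  have "compactin (product_topology (\<lambda>_. euclidean) UNIV) P"
    unfolding P_def by (subst compactin_PiE) auto
  then have "compact P"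
    by (simp add: euclidean_product_topology)
  then have "seq_compact P" by (rule compact_imp_seq_compact)
  moreover have "hs n \<in> P" for n
  proof -
    have le: "\<bar>hs n k\<bar> \<le> 13/10 * r" for k
      using hball_sum_abs_le[OF assms(1)[of n] assms(2), of "{k}"] by simp
    have "-(13/10 * r) \<le> hs n k \<and> hs n k \<le> 13/10 * r" for k
      using le[of k] by linarith
    then show ?thesis unfolding P_def PiE_UNIV_domain Pi_iff by auto
  qed
  ultimately obtain h \<sigma> where h: "strict_mono (\<sigma> :: nat \<Rightarrow> nat)" "(hs \<circ> \<sigma>) \<longlonglongrightarrow> h"
    by (metis seq_compactE)
  have lim: "(\<lambda>n. hs (\<sigma> n) k) \<longlonglongrightarrow> h k" for k
  proof -
    have "isCont (\<lambda>x :: nat \<Rightarrow> real. x k) h"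
      by (metis UNIV_I continuous_on_eq_continuous_at continuous_on_product_coordinates open_UNIV)
    from isCont_tendsto_compose[OF this h(2)] show ?thesis by (simp add: o_def)
  qed
  have "h \<in> hball r"
    unfolding hball_def
  proof (intro CollectI conjI allI impI)
    show "h k = 0" if "3 dvd k" for k
      using LIMSEQ_unique[OF lim[of k]] assms(1) that by (simp add: hball_def)
    show "(\<Sum>k<n. (real k * h k)\<^sup>2) \<le> r\<^sup>2" for n
    proof (rule LIMSEQ_le_const2)
      show "(\<lambda>i. \<Sum>k<n. (real k * hs (\<sigma> i) k)\<^sup>2) \<longlonglongrightarrow> (\<Sum>k<n. (real k * h k)\<^sup>2)"
        by (intro tendsto_intros lim)
    qed (use assms(1) in \<open>auto simp: hball_def\<close>)
  qed
  with h(1) lim show thesis by (rule that[rotated])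
qed

text \<open>Compactness of the embedding: the tail beyond \<open>N\<close> is small uniformly in
  \<open>n\<close> because the inverse squares are summable, and below \<open>N\<close> only
  finitely many coefficients have to converge.\<close>

lemma hball_uniform:
  assumes hs: "\<And>n. hs n \<in> hball r" and h: "h \<in> hball r" and r: "0 \<le> r"
    and lim: "\<And>k. (\<lambda>n. hs n k) \<longlonglongrightarrow> h k"
  shows "(\<lambda>n. \<Sum>k. \<bar>hs n k - h k\<bar>) \<longlonglongrightarrow> 0"
proof (rule LIMSEQ_I)
  fix e :: real assume e: "0 < e"
  define T where "T N = sqrt ((\<Sum>k. 1 / (real k)\<^sup>2) - (\<Sum>k<N. 1 / (real k)\<^sup>2))" for N
  have "T \<longlonglongrightarrow> sqrt 0"
    unfolding T_def using tendsto_diff[OF tendsto_const summable_LIMSEQ[OF summable_inverse_squares], of "\<Sum>k. 1 / (real k)\<^sup>2"]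
    by (intro tendsto_real_sqrt) simp
  then have "(\<lambda>N. 2 * r * T N) \<longlonglongrightarrow> 0"
    using tendsto_mult_left[of T 0 _ "2 * r"] by simp
  then obtain N where N: "\<bar>2 * r * T N\<bar> < e / 2"
    using LIMSEQ_D[of _ 0 "e/2"] e by (metis diff_zero half_gt_zero le_refl real_norm_def)
  have "(\<lambda>n. \<Sum>k<N. \<bar>hs n k - h k\<bar>) \<longlonglongrightarrow> (\<Sum>k<N. \<bar>h k - h k\<bar>)"
    by (intro tendsto_intros lim)
  then obtain n0 where n0: "\<And>n. n \<ge> n0 \<Longrightarrow> (\<Sum>k<N. \<bar>hs n k - h k\<bar>) < e / 2"
    using LIMSEQ_D[of _ 0 "e/2"] e by (force simp: sum_nonneg)
  have "(\<Sum>k. \<bar>hs n k - h k\<bar>) < e" if "n \<ge> n0" for n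
  proof -
    have D: "(\<lambda>k. hs n k - h k) \<in> hball (2 * r)" by (rule hball_diff[OF hs h])
    have "(\<Sum>k. \<bar>hs n k - h k\<bar>) \<le> (\<Sum>k<N. \<bar>hs n k - h k\<bar>) + 2 * r * T N"
    proof (rule suminf_le_const)
      show "summable (\<lambda>k. \<bar>hs n k - h k\<bar>)" using hball_summable_abs[OF D] r by simp
      fix m
      have "(\<Sum>k<m. \<bar>hs n k - h k\<bar>) \<le> (\<Sum>k\<in>{..<N} \<union> {N..<N + m}. \<bar>hs n k - h k\<bar>)"
        by (rule sum_mono2) auto
      also have "\<dots> = (\<Sum>k<N. \<bar>hs n k - h k\<bar>) + (\<Sum>k\<in>{N..<N + m}. \<bar>hs n k - h k\<bar>)"
        by (rule sum.union_disjoint) auto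
      also have "(\<Sum>k\<in>{N..<N + m}. \<bar>hs n k - h k\<bar>) \<le> 2 * r * sqrt (\<Sum>k\<in>{N..<N + m}. 1 / (real k)\<^sup>2)"
        using sum_abs_le[OF D] r by simp
      also have "(\<Sum>k\<in>{N..<N + m}. 1 / (real k)\<^sup>2) \<le> (\<Sum>k. 1 / (real k)\<^sup>2) - (\<Sum>k<N. 1 / (real k)\<^sup>2)"
      proof -
        have "(\<Sum>k<N. 1 / (real k)\<^sup>2) + (\<Sum>k\<in>{N..<N + m}. 1 / (real k)\<^sup>2) = (\<Sum>k\<in>{..<N} \<union> {N..<N + m}. 1 / (real k)\<^sup>2)"
          by (rule sum.union_disjoint[symmetric]) auto
        also have "\<dots> \<le> (\<Sum>k. 1 / (real k)\<^sup>2)"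
          by (rule sum_le_suminf[OF summable_inverse_squares]) auto
        finally show ?thesis by linarith
      qed
      finally show "(\<Sum>k<m. \<bar>hs n k - h k\<bar>) \<le> (\<Sum>k<N. \<bar>hs n k - h k\<bar>) + 2 * r * T N"
        using r by (simp add: T_def mult_left_mono real_sqrt_le_mono)
    qed
    then show ?thesis using n0[OF that] N by linarith
  qed
  moreover have "0 \<le> (\<Sum>k. \<bar>hs n k - h k\<bar>)" for n
    using hball_summable_abs[OF hball_diff[OF hs h]] r by (intro suminf_nonneg) auto
  ultimately show "\<exists>no. \<forall>n\<ge>no. norm ((\<Sum>k. \<bar>hs n k - h k\<bar>) - 0) < e"
    by (intro exI[of _ n0]) auto
qed

section \<open>The linearised defect of the approximate solution\<close>


definition a0 :: "nat \<Rightarrow> real" where "a0 k = of_int (amp k) / 100000"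
definition z0 :: "real \<Rightarrow> complex" where "z0 = ser a0"
definition s0 :: "real \<Rightarrow> real" where "s0 t = Re (lau LS t) / of_int lau_scale"

definition amp_modes :: "nat set" where "amp_modes = {1, 2, 4, 5, 7, 8, 10, 11}"

lemma a0_eq_0: "k \<notin> amp_modes \<Longrightarrow> a0 k = 0"
  by (simp add: a0_def amp_def amp_modes_def)

lemma summable_a0: "summable (\<lambda>k. \<bar>a0 k\<bar>)"
  by (rule summable_abs_finite[of amp_modes]) (auto simp: amp_modes_def intro: a0_eq_0[unfolded amp_modes_def])

lemma z0_sum: "z0 t = (\<Sum>k\<in>amp_modes. a0 k *\<^sub>R emode k t)"
  unfolding z0_def by (rule ser_finite) (auto simp: a0_eq_0, simp add: amp_modes_def)

lemma Re_z0:
  "Re (z0 t) = (40508 * cos (2 * t) - 6691 * cos (4 * t) - 360 * cos (8 * t) + 97 * cos (10 * t)) / 100000"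
  unfolding z0_sum amp_modes_def by (simp add: emode_def a0_def amp_def field_simps)

lemma Im_z0:
  "Im (z0 t) = (131606 * cos t + 3035 * cos (5 * t) - 702 * cos (7 * t) - 50 * cos (11 * t)) / 100000"
  unfolding z0_sum amp_modes_def by (simp add: emode_def a0_def amp_def field_simps)

lemma continuous_z0 [continuous_intros]: "continuous_on A z0"
  unfolding z0_def by (rule continuous_ser[OF summable_a0])

lemma continuous_s0 [continuous_intros]: "continuous_on A s0"
  unfolding s0_def by (auto intro!: continuous_intros simp: lau_scale_def)

lemma norm_z0_le: "norm (z0 t) \<le> (\<Sum>k. \<bar>a0 k\<bar>)"
  unfolding z0_def by (rule norm_ser_le[OF summable_a0])

lemma lau_real: "rev p = p \<Longrightarrow> lau p t = of_real (Re (lau p t))"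
  by (simp add: complex_eq_iff Im_lau)

lemma lau_LX: "lau LX t = of_real (of_int lau_scale * Re (z0 t))"
proof -
  have "Re (lau LX t) = of_int lau_scale * Re (z0 t)"
    unfolding Re_lau Re_z0 by (simp add: LX_def freq_def lau_scale_def numeral_eq_Suc lessThan_Suc)
  moreover have "rev LX = LX" by (simp add: LX_def)
  ultimately show ?thesis using lau_real by metis
qed

lemma lau_LY: "lau LY t = of_real (of_int lau_scale * Im (z0 t))"
proof -
  have "Re (lau LY t) = of_int lau_scale * Im (z0 t)"
    unfolding Re_lau Im_z0 by (simp add: LY_def freq_def lau_scale_def numeral_eq_Suc lessThan_Suc)
  moreover have "rev LY = LY" by (simp add: LY_def)
  ultimately show ?thesis using lau_real by metis
qed

lemma lau_LS: "lau LS t = of_real (of_int lau_scale * s0 t)"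
proof -
  have "rev LS = LS" by (simp add: LS_def)
  then show ?thesis using lau_real[of LS t] by (simp add: s0_def lau_scale_def)
qed

lemma lau_central: "lau (replicate n 0 @ [c] @ replicate n 0) t = of_int c"
proof (induction n)
  case (Suc n)
  have "replicate (Suc n) 0 @ [c] @ replicate (Suc n) 0 = 0 # (replicate n 0 @ [c] @ replicate n 0) @ [0]"
    by (simp add: replicate_append_same[symmetric])
  then show ?case using Suc by (simp only: lau_pad)
qed (simp add: lau_def freq_def)

lemma pmul_not_Nil [simp]: "p \<noteq> [] \<Longrightarrow> q \<noteq> [] \<Longrightarrow> pmul p q \<noteq> []"
  using length_pmul[of p q] by (cases p; cases q) auto

lemma not_Nil [simp]: "LX \<noteq> []" "LY \<noteq> []" "LS \<noteq> []" "LS2 \<noteq> []" "LS3 \<noteq> []" "LS5 \<noteq> []" "LP \<noteq> []"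
proof -
  show base: "LX \<noteq> []" "LY \<noteq> []" "LS \<noteq> []" by (simp_all add: LX_def LY_def LS_def)
  show 2: "LS2 \<noteq> []" unfolding LS2_def by (intro pmul_not_Nil base)
  show 3: "LS3 \<noteq> []" unfolding LS3_def by (intro pmul_not_Nil base 2)
  show "LS5 \<noteq> []" unfolding LS5_def by (intro pmul_not_Nil 2 3)
  show "LP \<noteq> []" unfolding LP_def by (simp flip: length_greater_0_conv)
qed

lemma lau_LS2: "lau LS2 t = of_real (of_int lau_scale ^ 2 * s0 t ^ 2)"
  unfolding LS2_def by (simp add: lau_pmul lau_LS power2_eq_square)

lemma lau_LS3: "lau LS3 t = of_real (of_int lau_scale ^ 3 * s0 t ^ 3)"
  unfolding LS3_def by (simp add: lau_pmul lau_LS lau_LS2 power2_eq_square power3_eq_cube)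

lemma lau_LS5: "lau LS5 t = of_real (of_int lau_scale ^ 5 * s0 t ^ 5)"
  unfolding LS5_def by (simp add: lau_pmul lau_LS2 lau_LS3 eval_nat_numeral)

lemma lau_LP: "lau LP t = of_real (of_int lau_scale ^ 2 * (norm (z0 t))\<^sup>2)"
proof -
  have "lau LP t = lau LX t * lau LX t + lau LY t * lau LY t"
    unfolding LP_def
    by (subst lau_padd) (simp_all add: length_pmul lau_pad lau_pmul, simp_all add: LX_def LY_def)
  then show ?thesis
    unfolding cmod_power2 by (simp add: lau_LX lau_LY power2_eq_square algebra_simps)
qed

text \<open>The supremum of a trigonometric polynomial is at most the sum of the moduli of its
  coefficients. Here the polynomial has degree at most 50, and the 1 is subtracted at the central
  one of 51 list entries.\<close>

lemma s0_defect: "\<bar>(s0 t)\<^sup>2 * (norm (z0 t))\<^sup>2 - 1\<bar> \<le> 5/10000"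
proof -
  define q where "q = padd (pmul LS2 LP) (replicate 25 0 @ [- (lau_scale ^ 4)] @ replicate 25 0)"
  have "lau q t = lau (pmul LS2 LP) t + of_int (- (lau_scale ^ 4))"
    unfolding q_def lau_central[symmetric, where c = "- (lau_scale ^ 4)" and n = 25 and t = t]
    by (rule lau_padd) (simp add: length_LS2_LP)
  also have "\<dots> = of_real (of_int lau_scale ^ 4 * ((s0 t)\<^sup>2 * (norm (z0 t))\<^sup>2 - 1))"
    by (simp add: lau_pmul lau_LS2 lau_LP eval_nat_numeral algebra_simps)
  finally have "norm (lau q t) = of_int lau_scale ^ 4 * \<bar>(s0 t)\<^sup>2 * (norm (z0 t))\<^sup>2 - 1\<bar>"
    by (simp only: norm_of_real abs_mult) (simp add: lau_scale_def)
  then have "of_int lau_scale ^ 4 * \<bar>(s0 t)\<^sup>2 * (norm (z0 t))\<^sup>2 - 1\<bar> \<le> of_int (sum_list (map abs q))"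
    using norm_lau_le[of q t] by simp
  moreover have "real_of_int (10000 * sum_list (map abs q)) \<le> real_of_int (5 * lau_scale ^ 4)"
    unfolding of_int_le_iff q_def by (rule scale_defect_check)
  ultimately show ?thesis by (simp add: lau_scale_def)
qed

lemma s0_le: "s0 t \<le> 21/10"
  using abs_Re_le_cmod[of "lau LS t"] norm_lau_le[of LS t]
  by (simp add: s0_def LS_def lau_scale_def)

text \<open>The constant coefficient exceeds the sum of the moduli of all others; \<open>q\<close>
  is \<open>LS\<close> with that coefficient removed.\<close>

lemma s0_pos: "0 < s0 t"
proof -
  define q :: "int list" where
    "q = [-52, 160, -470, 1377, -3726, 15266, -64440, 0, -64440, 15266, -3726, 1377, -470, 160, -52]"
  have "LS = padd q (replicate 7 0 @ [248638] @ replicate 7 0)"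
    by (simp add: LS_def q_def numeral_eq_Suc)
  then have "lau LS t = lau q t + 248638"
    using lau_padd[of q "replicate 7 0 @ [248638] @ replicate 7 0" t] lau_central[where n = 7 and c = 248638 and t = t]
    by (simp add: q_def)
  moreover have "\<bar>Re (lau q t)\<bar> \<le> 200000"
    using abs_Re_le_cmod[of "lau q t"] norm_lau_le[of q t] by (simp add: q_def)
  ultimately show ?thesis by (simp add: s0_def lau_scale_def)
qed

text \<open>Since \<open>s0\<close> nearly equals the inverse norm, its upper bound 21/10 keeps
  \<open>z0\<close> away from collision.\<close>

lemma norm_z0_ge: "47/100 \<le> norm (z0 t)"
proof -
  have "(s0 t)\<^sup>2 \<le> (21/10)\<^sup>2"
    using s0_pos[of t] s0_le[of t] by (intro power_mono) auto
  then have "(s0 t)\<^sup>2 * (norm (z0 t))\<^sup>2 \<le> (21/10)\<^sup>2 * (norm (z0 t))\<^sup>2"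
    by (rule mult_right_mono) simp
  then have "(47/100)\<^sup>2 \<le> (norm (z0 t))\<^sup>2"
    using s0_defect[of t] unfolding power_divide by (simp only: power2_eq_square[of 21] power2_eq_square[of 10] power2_eq_square[of 47] power2_eq_square[of 100])
  then show ?thesis by (rule power2_le_imp_le) simp
qed

lemma s0_norm_z0_sq: "(s0 t)\<^sup>2 * (norm (z0 t))\<^sup>2 \<le> 10005/10000"
  using s0_defect[of t] by linarith

definition res_coeff :: "nat \<Rightarrow> real" where
  "res_coeff k = avg (\<lambda>t. (s0 t ^ 3 *\<^sub>R z0 t) \<bullet> emode k t)"

lemma res_coeff_lau:
  "of_int lau_scale ^ 4 * res_coeff k =
    (let q = pmul LS3 (if even k then LX else LY) in of_int (cf q (int k) + cf q (- int k)))"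
proof -
  define q where "q = pmul LS3 (if even k then LX else LY)"
  have "(s0 t ^ 3 *\<^sub>R z0 t) \<bullet> emode k t * of_int lau_scale ^ 4 = Re (lau q t) * cos (of_int (int k) * t)" for t
    by (cases "even k")
      (auto simp: q_def lau_pmul lau_LS3 lau_LX lau_LY emode_def inner_complex_def eval_nat_numeral)
  then have "avg (\<lambda>t. of_int lau_scale ^ 4 * ((s0 t ^ 3 *\<^sub>R z0 t) \<bullet> emode k t)) = avg (\<lambda>t. Re (lau q t) * cos (of_int (int k) * t))"
    by (simp add: mult.commute)
  then show ?thesis
    unfolding avg_lau res_coeff_def Let_def q_def[symmetric] avg_cmult .
qed

lemma lengths: "length LS3 = 43" "length LX = 11" "length LY = 12"
  by (simp_all add: LS3_def LS2_def LS_def LX_def LY_def length_pmul pmul_not_Nil)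

text \<open>A degree count: 42 for \<open>LS3\<close> and at most 11 for the coordinate.\<close>

lemma res_coeff_large: "54 \<le> k \<Longrightarrow> res_coeff k = 0"
proof -
  assume k: "54 \<le> k"
  define q where "q = pmul LS3 (if even k then LX else LY)"
  have "cf q (int k) = 0" "cf q (- int k) = 0"
    using k by (cases "even k"; simp add: cf_def Let_def q_def length_pmul lengths; presburger)+
  then show ?thesis
    using res_coeff_lau[of k] by (simp add: Let_def q_def[symmetric] lau_scale_def)
qed

definition res_modes :: "nat set" where "res_modes = {k. k < 54 \<and> \<not> 3 dvd k}"

definition defect :: "nat \<Rightarrow> real" where
  "defect k = (real k)\<^sup>2 * a0 k - res_coeff k"

lemma defect_sq_le:
  assumes "k > 0"
  shows "(defect k / real k)\<^sup>2 * of_int lau_scale ^ 8 \<le>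
     of_int (resid_num (pmul LS3 (if even k then LX else LY)) k ^ 2 div int k ^ 2 + 1)"
proof -
  define N where "N = resid_num (pmul LS3 (if even k then LX else LY)) k"
  have "of_int lau_scale ^ 4 * defect k = of_int N"
    using res_coeff_lau[of k]
    by (simp add: defect_def N_def resid_num_def Let_def right_diff_distrib a0_def lau_scale_def)
  then have "(of_int lau_scale ^ 4 * defect k)\<^sup>2 = of_int (N\<^sup>2)"
    by simp
  then have "(defect k / real k)\<^sup>2 * of_int lau_scale ^ 8 = of_int (N\<^sup>2) / of_int ((int k)\<^sup>2)"
    by (simp add: power_divide power_mult_distrib field_simps flip: power_mult)
  also have "\<dots> \<le> of_int (N\<^sup>2 div (int k)\<^sup>2 + 1)"
  proof -
    have "real_of_int (N\<^sup>2) / real_of_int ((int k)\<^sup>2) < real_of_int (N\<^sup>2 div (int k)\<^sup>2) + 1"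
      by (metis floor_divide_of_int_eq real_of_int_floor_add_one_gt)
    then show ?thesis by simp
  qed
  finally show ?thesis by (simp add: N_def)
qed

lemma defect_sum_le: "(\<Sum>k\<in>res_modes. (defect k / real k)\<^sup>2) \<le> (23/10000)\<^sup>2"
proof -
  define E :: "nat list" where "E = [2,4,8,10,14,16,20,22,26,28,32,34,38,40,44,46,50,52]"
  define D :: "nat list" where "D = [1,5,7,11,13,17,19,23,25,29,31,35,37,41,43,47,49,53]"
  have R: "res_modes = set E \<union> set D"
  proof -
    have "res_modes = set (filter (\<lambda>k. \<not> 3 dvd k) [0..<54])" by (auto simp: res_modes_def)
    also have "filter (\<lambda>k. \<not> 3 dvd k) [0..<54] = [1,2,4,5,7,8,10,11,13,14,16,17,19,20,22,23,25,26,28,29,31,32,34,35,37,38,40,41,43,44,46,47,49,50,52,53]"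
      by (simp add: upt_rec[of _ "54"] dvd_eq_mod_eq_0)
    also have "set \<dots> = set E \<union> set D" by (auto simp: E_def D_def)
    finally show ?thesis .
  qed
  have disj: "set E \<inter> set D = {}" by (simp add: E_def D_def)
  have EV: "even k \<and> k > 0" if "k \<in> set E" for k using that by (auto simp: E_def)
  have OD: "odd k \<and> k > 0" if "k \<in> set D" for k using that by (auto simp: D_def)
  have "(\<Sum>k\<in>res_modes. (defect k / real k)\<^sup>2) * of_int lau_scale ^ 8 =
      (\<Sum>k\<in>set E. (defect k / real k)\<^sup>2 * of_int lau_scale ^ 8) + (\<Sum>k\<in>set D. (defect k / real k)\<^sup>2 * of_int lau_scale ^ 8)"
    unfolding R by (subst sum.union_disjoint) (auto simp: disj distrib_right sum_distrib_right)
  also have "(\<Sum>k\<in>set E. (defect k / real k)\<^sup>2 * of_int lau_scale ^ 8) \<le> of_int (resid_sum (pmul LS3 LX) E)"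
  proof -
    have "resid_sum (pmul LS3 LX) E = (\<Sum>k\<in>set E. resid_num (pmul LS3 LX) k ^ 2 div int k ^ 2 + 1)"
      unfolding resid_sum_def by (rule sum_list_distinct_conv_sum_set) (simp add: E_def)
    moreover have "(defect k / real k)\<^sup>2 * of_int lau_scale ^ 8 \<le>
        of_int (resid_num (pmul LS3 LX) k ^ 2 div int k ^ 2 + 1)" if "k \<in> set E" for k
      using defect_sq_le[of k] EV[OF that] by (simp del: of_int_add)
    ultimately show ?thesis
      by (simp only: of_int_sum sum_mono)
  qed
  also have "(\<Sum>k\<in>set D. (defect k / real k)\<^sup>2 * of_int lau_scale ^ 8) \<le> of_int (resid_sum (pmul LS3 LY) D)"
  proof -
    have "resid_sum (pmul LS3 LY) D = (\<Sum>k\<in>set D. resid_num (pmul LS3 LY) k ^ 2 div int k ^ 2 + 1)"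
      unfolding resid_sum_def by (rule sum_list_distinct_conv_sum_set) (simp add: D_def)
    moreover have "(defect k / real k)\<^sup>2 * of_int lau_scale ^ 8 \<le>
        of_int (resid_num (pmul LS3 LY) k ^ 2 div int k ^ 2 + 1)" if "k \<in> set D" for k
      using defect_sq_le[of k] OD[OF that] by (simp del: of_int_add)
    ultimately show ?thesis
      by (simp only: of_int_sum sum_mono)
  qed
  finally have "(\<Sum>k\<in>res_modes. (defect k / real k)\<^sup>2) * of_int lau_scale ^ 8 \<le>
      of_int (resid_sum (pmul LS3 LX) E + resid_sum (pmul LS3 LY) D)" by simp
  moreover have "real_of_int (10 ^ 8 * (resid_sum (pmul LS3 LX) E + resid_sum (pmul LS3 LY) D)) \<le> real_of_int (23\<^sup>2 * lau_scale ^ 8)"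
    unfolding of_int_le_iff E_def D_def by (rule residual_check)
  ultimately have "10 ^ 8 * ((\<Sum>k\<in>res_modes. (defect k / real k)\<^sup>2) * of_int lau_scale ^ 8) \<le> 23\<^sup>2 * of_int lau_scale ^ 8"
    by simp
  then show ?thesis by (simp add: lau_scale_def power_divide)
qed

text \<open>The mixed term in the kinetic energy of \<open>a0 + h\<close>; it is a finite sum
  because \<open>a0\<close> has only eight modes.\<close>

definition linear_part :: "(nat \<Rightarrow> real) \<Rightarrow> real" where
  "linear_part h = (\<Sum>k\<in>amp_modes. (real k)\<^sup>2 * a0 k * h k)"

text \<open>With \<open>s0\<close> in place of the inverse norm, the first variation at
  \<open>z0\<close> is the pairing of \<open>h\<close> with \<open>defect\<close>. Distributing
  \<open>1 / k\<close> and \<open>k\<close> over the two factors leaves the dual norm bounded by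
  \<open>defect_sum_le\<close>.\<close>

lemma linear_part_bound:
  assumes h: "h \<in> hball r" "0 \<le> r"
  shows "\<bar>linear_part h - avg (\<lambda>t. s0 t ^ 3 * (z0 t \<bullet> ser h t))\<bar> \<le> 23/10000 * sqrt (hnorm2 h)"
proof -
  have fin: "finite res_modes" by (simp add: res_modes_def)
  have cont: "continuous_on UNIV (\<lambda>t. s0 t ^ 3 *\<^sub>R z0 t)" by (intro continuous_intros)
  have "norm (s0 t ^ 3 *\<^sub>R z0 t) \<le> (21/10)^3 * (\<Sum>k. \<bar>a0 k\<bar>)" for t
  proof -
    have "\<bar>s0 t ^ 3\<bar> \<le> (21/10)^3"
      using s0_pos[of t] s0_le[of t] by (simp only: power_abs) (intro power_mono, auto)
    then show ?thesis
      unfolding norm_scaleR real_norm_def by (intro mult_mono norm_z0_le) auto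
  qed
  from avg_inner_ser[OF hball_summable_abs[OF h] cont this]
  have "(\<lambda>k. h k * res_coeff k) sums avg (\<lambda>t. s0 t ^ 3 * (z0 t \<bullet> ser h t))"
    by (simp add: res_coeff_def)
  moreover have "(\<lambda>k. h k * res_coeff k) sums (\<Sum>k\<in>res_modes. h k * res_coeff k)"
  proof (rule sums_finite[OF fin])
    fix k assume "k \<notin> res_modes"
    then show "h k * res_coeff k = 0"
      using res_coeff_large[of k] hball_zero_mult_3[OF h(1), of k] by (auto simp: res_modes_def not_less)
  qed
  ultimately have A: "avg (\<lambda>t. s0 t ^ 3 * (z0 t \<bullet> ser h t)) = (\<Sum>k\<in>res_modes. h k * res_coeff k)"
    by (rule sums_unique2)
  have L: "linear_part h = (\<Sum>k\<in>res_modes. (real k)\<^sup>2 * a0 k * h k)"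
    unfolding linear_part_def
    by (rule sum.mono_neutral_left[OF fin]) (auto simp: res_modes_def amp_modes_def a0_eq_0)
  have "linear_part h - avg (\<lambda>t. s0 t ^ 3 * (z0 t \<bullet> ser h t)) = (\<Sum>k\<in>res_modes. defect k * h k)"
    unfolding A L sum_subtractf[symmetric] by (simp add: defect_def algebra_simps)
  also have "\<dots> = (\<Sum>k\<in>res_modes. (defect k / real k) * (real k * h k))"
    by (rule sum.cong) (auto simp: res_modes_def)
  finally have eq: "linear_part h - avg (\<lambda>t. s0 t ^ 3 * (z0 t \<bullet> ser h t)) =
     (\<Sum>k\<in>res_modes. (defect k / real k) * (real k * h k))" .
  have "(linear_part h - avg (\<lambda>t. s0 t ^ 3 * (z0 t \<bullet> ser h t)))\<^sup>2 \<le>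
     (\<Sum>k\<in>res_modes. (defect k / real k)\<^sup>2) * (\<Sum>k\<in>res_modes. (real k * h k)\<^sup>2)"
    unfolding eq by (rule Cauchy_Schwarz_ineq_sum)
  also have "\<dots> \<le> (23/10000)\<^sup>2 * hnorm2 h"
  proof (rule mult_mono[OF defect_sum_le])
    show "(\<Sum>k\<in>res_modes. (real k * h k)\<^sup>2) \<le> hnorm2 h"
      unfolding hnorm2_def by (rule sum_le_suminf[OF summable_hnorm2[OF h(1)] fin]) auto
  qed (auto intro!: sum_nonneg)
  finally have "sqrt ((linear_part h - avg (\<lambda>t. s0 t ^ 3 * (z0 t \<bullet> ser h t)))\<^sup>2) \<le> sqrt ((23/10000)\<^sup>2 * hnorm2 h)"
    by (rule real_sqrt_le_mono)
  then show ?thesis by (simp add: real_sqrt_mult)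
qed

section \<open>Coercivity of the second variation\<close>


text \<open>The Schur test: every mixed product is split by Young's inequality in the ratio of the
  two weights. For constant weights it is the Gershgorin bound.\<close>

lemma weighted_diagonal_dominance:
  fixes M :: "'a \<Rightarrow> 'a \<Rightarrow> real"
  assumes fin: "finite K" and sym: "\<And>k m. M k m = M m k" and w: "\<And>k. k \<in> K \<Longrightarrow> 0 < w k"
    and row: "\<And>k. k \<in> K \<Longrightarrow> M k k * w k + (\<Sum>m\<in>K - {k}. \<bar>M k m\<bar> * w m) \<le> D k * w k"
  shows "(\<Sum>k\<in>K. \<Sum>m\<in>K. l k * l m * M k m) \<le> (\<Sum>k\<in>K. D k * (l k)\<^sup>2)"
proof -
  define P where "P k m = (if m = k then 0 else \<bar>M k m\<bar>)" for k m
  define A where "A k m = w m / w k * (l k)\<^sup>2" for k m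
  have ineq: "l k * l m * M k m \<le> (if m = k then M k k * (l k)\<^sup>2 else 0) + (P k m * A k m / 2 + P k m * A m k / 2)"
    if k: "k \<in> K" and m: "m \<in> K" for k m
  proof (cases "m = k")
    case False
    have wk: "0 < w k" "0 < w m" using w k m by auto
    have "0 \<le> (w m * \<bar>l k\<bar> - w k * \<bar>l m\<bar>)\<^sup>2" by simp
    then have "2 * (w m * w k) * (\<bar>l k\<bar> * \<bar>l m\<bar>) \<le> (w m)\<^sup>2 * (l k)\<^sup>2 + (w k)\<^sup>2 * (l m)\<^sup>2"
      by (simp add: power2_diff power_mult_distrib algebra_simps)
    then have "\<bar>l k\<bar> * \<bar>l m\<bar> \<le> A k m / 2 + A m k / 2"
      using wk by (simp add: A_def field_simps power2_eq_square)
    from mult_left_mono[OF this abs_ge_zero[of "M k m"]]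
    have "\<bar>l k * l m * M k m\<bar> \<le> \<bar>M k m\<bar> * (A k m / 2 + A m k / 2)"
      by (simp add: abs_mult mult_ac)
    then show ?thesis
      using False by (simp add: P_def distrib_left)
  qed (simp add: P_def power2_eq_square)
  have Psym: "P k m = P m k" for k m
    unfolding P_def using sym[of k m] by auto
  have "(\<Sum>k\<in>K. \<Sum>m\<in>K. P k m * A m k / 2) = (\<Sum>k\<in>K. \<Sum>m\<in>K. P m k * A k m / 2)"
    by (rule sum.swap)
  also have "\<dots> = (\<Sum>k\<in>K. \<Sum>m\<in>K. P k m * A k m / 2)"
    by (intro sum.cong refl) (subst Psym, rule refl)
  finally have swap: "(\<Sum>k\<in>K. \<Sum>m\<in>K. P k m * A m k / 2) = (\<Sum>k\<in>K. \<Sum>m\<in>K. P k m * A k m / 2)" .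
  have "(\<Sum>k\<in>K. \<Sum>m\<in>K. l k * l m * M k m) \<le>
      (\<Sum>k\<in>K. \<Sum>m\<in>K. (if m = k then M k k * (l k)\<^sup>2 else 0) + (P k m * A k m / 2 + P k m * A m k / 2))"
    by (intro sum_mono ineq)
  also have "\<dots> = (\<Sum>k\<in>K. M k k * (l k)\<^sup>2) + (\<Sum>k\<in>K. \<Sum>m\<in>K. P k m * A k m)"
    unfolding sum.distrib swap by (simp add: sum.delta fin mult.commute flip: sum.distrib)
  also have "\<dots> = (\<Sum>k\<in>K. (M k k * w k + (\<Sum>m\<in>K - {k}. \<bar>M k m\<bar> * w m)) * ((l k)\<^sup>2 / w k))"
    unfolding sum.distrib[symmetric]
  proof (rule sum.cong)
    fix k assume k: "k \<in> K"
    have "(\<Sum>m\<in>K. P k m * A k m) = (\<Sum>m\<in>K - {k}. \<bar>M k m\<bar> * A k m)"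
      by (rule sum.mono_neutral_cong_right) (auto simp: fin P_def)
    also have "\<dots> = (\<Sum>m\<in>K - {k}. \<bar>M k m\<bar> * w m) * ((l k)\<^sup>2 / w k)"
      unfolding sum_distrib_right by (rule sum.cong) (simp_all add: A_def)
    finally show "M k k * (l k)\<^sup>2 + (\<Sum>m\<in>K. P k m * A k m) =
        (M k k * w k + (\<Sum>m\<in>K - {k}. \<bar>M k m\<bar> * w m)) * ((l k)\<^sup>2 / w k)"
      using w[OF k] by (simp add: field_simps)
  qed simp
  also have "\<dots> \<le> (\<Sum>k\<in>K. D k * w k * ((l k)\<^sup>2 / w k))"
    by (intro sum_mono mult_right_mono row) (use w in \<open>auto simp: less_imp_le\<close>)
  also have "\<dots> = (\<Sum>k\<in>K. D k * (l k)\<^sup>2)"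
    by (rule sum.cong) (use w in \<open>auto simp: less_imp_neq[THEN not_sym]\<close>)
  finally show ?thesis .
qed

text \<open>The constants are those of the expansion made worse by the separation of high modes:
  \<open>53/40 = 53/52 * 13/10\<close> and \<open>63/50 = 54/25 * 7/12\<close>.\<close>

definition low_form :: "nat \<Rightarrow> nat \<Rightarrow> real" where
  "low_form k m = avg (\<lambda>t. 53/40 * (s0 t ^ 3 * (emode k t \<bullet> emode m t))
     - 63/50 * (s0 t ^ 5 * ((z0 t \<bullet> emode k t) * (z0 t \<bullet> emode m t))))"

lemma low_form_sym: "low_form k m = low_form m k"
  unfolding low_form_def by (simp add: inner_commute mult_ac)

lemma avg_s0_cubed:
  "avg (\<lambda>t. s0 t ^ 3 * (emode k t \<bullet> emode m t)) * of_int lau_scale ^ 3 =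
    (if even k = even m then of_int (ent LS3 (int k) (int m)) / 2 else 0)"
proof (cases "even k = even m")
  case True
  have "of_int lau_scale ^ 3 * (s0 t ^ 3 * (emode k t \<bullet> emode m t)) =
      Re (lau LS3 t) * (cos (of_int (int k) * t) * cos (of_int (int m) * t))" for t
    using True by (simp add: lau_LS3 inner_emode_emode del: of_real_mult of_real_power)
  then show ?thesis
    using avg_lau_cos_cos[of LS3 "int k" "int m"] True
    by (simp add: mult.commute[of _ "real_of_int lau_scale ^ 3"] flip: avg_cmult)
next
  case False
  then have "(\<lambda>t. s0 t ^ 3 * (emode k t \<bullet> emode m t)) = (\<lambda>t. 0)"
    by (auto simp: inner_emode_emode)
  then show ?thesis using False by (simp add: avg_const[of 0, simplified])
qed

definition wlist :: "nat \<Rightarrow> nat \<Rightarrow> int list" where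
  "wlist k m = pmul LS5 (if even k then if even m then pmul LX LX else pmul LX LY
     else if even m then pmul LX LY else pmul LY LY)"

lemma avg_s0_fifth:
  "avg (\<lambda>t. s0 t ^ 5 * ((z0 t \<bullet> emode k t) * (z0 t \<bullet> emode m t))) * of_int lau_scale ^ 7 =
    of_int (ent (wlist k m) (int k) (int m)) / 2"
proof -
  have "of_int lau_scale ^ 7 * (s0 t ^ 5 * ((z0 t \<bullet> emode k t) * (z0 t \<bullet> emode m t))) =
      Re (lau (wlist k m) t) * (cos (of_int (int k) * t) * cos (of_int (int m) * t))" for t
    by (auto simp: wlist_def lau_pmul pmul_not_Nil lau_LS5 lau_LX lau_LY emode_def inner_complex_def eval_nat_numeral)
  then show ?thesis
    using avg_lau_cos_cos[of "wlist k m" "int k" "int m"]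
    by (simp add: mult.commute[of _ "real_of_int lau_scale ^ 7"] flip: avg_cmult)
qed

lemma ent_symcf:
  assumes "k + m < 17"
  shows "ent p (int k) (int m) = symcf p ! (k + m) + symcf p ! nat \<bar>int k - int m\<bar>"
proof -
  have nth: "symcf p ! j = cf p (int j) + cf p (- int j)" if "j < 17" for j
    using that by (simp add: symcf_def nth_map_upt)
  show ?thesis
  proof (cases "m \<le> k")
    case True
    then have "nat \<bar>int k - int m\<bar> = k - m" by simp
    then show ?thesis using assms True by (simp add: nth ent_def of_nat_diff)
  next
    case False
    then have "nat \<bar>int k - int m\<bar> = m - k" by simp
    then show ?thesis using assms False by (simp add: nth ent_def of_nat_diff)
  qed
qed

text \<open>The integers 265 and 252 in \<open>form_num\<close> are 400 times 53/40 and 63/50,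
  halved by the 1/2 in the averages of cosine products.\<close>

lemma low_form_num:
  assumes "k + m < 17"
  shows "low_form k m = of_int (form_num low_S low_XX low_XY low_YY k m) / (400 * of_int lau_scale ^ 7)"
proof -
  define N where "N = real_of_int lau_scale"
  have N: "N \<noteq> 0" by (simp add: N_def lau_scale_def)
  have 1: "avg (\<lambda>t. s0 t ^ 3 * (emode k t \<bullet> emode m t)) =
      (if even k = even m then of_int (ent LS3 (int k) (int m)) else 0) / (2 * N ^ 3)"
    using avg_s0_cubed[of k m] N unfolding N_def[symmetric] by (auto simp: field_simps)
  have 2: "avg (\<lambda>t. s0 t ^ 5 * ((z0 t \<bullet> emode k t) * (z0 t \<bullet> emode m t))) =
      of_int (ent (wlist k m) (int k) (int m)) / (2 * N ^ 7)"
    using avg_s0_fifth[of k m] N unfolding N_def[symmetric] by (auto simp: field_simps)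
  have "low_form k m = 53/40 * avg (\<lambda>t. s0 t ^ 3 * (emode k t \<bullet> emode m t))
     - 63/50 * avg (\<lambda>t. s0 t ^ 5 * ((z0 t \<bullet> emode k t) * (z0 t \<bullet> emode m t)))"
    unfolding low_form_def avg_cmult[symmetric] by (rule avg_diff) (intro continuous_intros)+
  also have "\<dots> = (265 * N ^ 4 * (if even k = even m then of_int (ent LS3 (int k) (int m)) else 0)
      - 252 * of_int (ent (wlist k m) (int k) (int m))) / (400 * N ^ 7)"
    unfolding 1 2 using N by (simp add: field_simps eval_nat_numeral)
  also have "\<dots> = of_int (form_num low_S low_XX low_XY low_YY k m) / (400 * N ^ 7)"
    unfolding form_num_def symcf_checks[symmetric] ent_symcf[OF assms] wlist_def N_def
    by (auto simp: Let_def)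
  finally show ?thesis by (simp add: N_def)
qed

lemma low_form_row:
  assumes k: "k \<in> set low_modes"
  shows "low_form k k * of_int (weight k) + (\<Sum>m\<in>set low_modes - {k}. \<bar>low_form k m\<bar> * of_int (weight m))
    \<le> 7/10 * (real k)\<^sup>2 * of_int (weight k)"
proof -
  define F where "F = form_num low_S low_XX low_XY low_YY"
  define c where "c = 400 * real_of_int lau_scale ^ 7"
  have c: "c > 0" by (simp add: c_def lau_scale_def)
  have lf: "low_form k m = of_int (F k m) / c" if "m \<in> set low_modes" for m
    unfolding F_def c_def by (rule low_form_num) (use k that in \<open>auto simp: low_modes_def\<close>)
  have rs: "row_sum f ms k = (\<Sum>m\<in>set ms - {k}. \<bar>f m\<bar> * weight m)" if "distinct ms" for f ms
    using that
  proof (induction ms)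
    case (Cons m ms)
    then show ?case by (cases "m = k") (simp_all add: insert_Diff_if)
  qed simp
  have "row_ok low_S low_XX low_XY low_YY k"
    using form_check k by (simp add: list_all_iff)
  then have "10 * (F k k * weight k + (\<Sum>m\<in>set low_modes - {k}. \<bar>F k m\<bar> * weight m))
      \<le> 7 * 400 * int k ^ 2 * lau_scale ^ 7 * weight k"
    unfolding row_ok_def F_def[symmetric] by (subst (asm) rs) (simp_all add: low_modes_def)
  then have "real_of_int (10 * (F k k * weight k + (\<Sum>m\<in>set low_modes - {k}. \<bar>F k m\<bar> * weight m)))
      \<le> real_of_int (7 * 400 * int k ^ 2 * lau_scale ^ 7 * weight k)"
    by (simp only: of_int_le_iff)
  then have "of_int (F k k) * of_int (weight k) + (\<Sum>m\<in>set low_modes - {k}. \<bar>of_int (F k m)\<bar> * of_int (weight m))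
      \<le> 7/10 * (real k)\<^sup>2 * of_int (weight k) * c"
    by (simp add: c_def mult_ac)
  then have "(of_int (F k k) * of_int (weight k) + (\<Sum>m\<in>set low_modes - {k}. \<bar>of_int (F k m)\<bar> * of_int (weight m))) / c
      \<le> 7/10 * (real k)\<^sup>2 * of_int (weight k)"
    using c by (simp add: pos_divide_le_eq)
  moreover have "(\<Sum>m\<in>set low_modes - {k}. \<bar>low_form k m\<bar> * of_int (weight m)) =
      (\<Sum>m\<in>set low_modes - {k}. \<bar>of_int (F k m)\<bar> * of_int (weight m)) / c"
    unfolding sum_divide_distrib by (rule sum.cong) (use c in \<open>auto simp: lf abs_divide\<close>)
  ultimately show ?thesis
    using lf[OF k] by (simp add: add_divide_distrib)
qed

definition low_part :: "(nat \<Rightarrow> real) \<Rightarrow> real \<Rightarrow> complex" where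
  "low_part h t = (\<Sum>k\<in>set low_modes. h k *\<^sub>R emode k t)"

lemma continuous_low_part [continuous_intros]: "continuous_on A (low_part h)"
  unfolding low_part_def by (intro continuous_intros)

lemma low_part_form:
  "avg (\<lambda>t. 53/40 * (s0 t ^ 3 * (norm (low_part h t))\<^sup>2) - 63/50 * (s0 t ^ 5 * (z0 t \<bullet> low_part h t)\<^sup>2))
    \<le> 7/10 * (\<Sum>k\<in>set low_modes. (real k * h k)\<^sup>2)"
proof -
  define G where "G k m t = 53/40 * (s0 t ^ 3 * (emode k t \<bullet> emode m t))
     - 63/50 * (s0 t ^ 5 * ((z0 t \<bullet> emode k t) * (z0 t \<bullet> emode m t)))" for k m t
  have cG: "continuous_on UNIV (G k m)" for k m
    unfolding G_def by (intro continuous_intros)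
  have 1: "(norm (low_part h t))\<^sup>2 = (\<Sum>k\<in>set low_modes. \<Sum>m\<in>set low_modes. h k * h m * (emode k t \<bullet> emode m t))" for t
    unfolding power2_norm_eq_inner low_part_def by (simp add: inner_sum_left inner_sum_right sum_distrib_left mult_ac inner_commute)
  have 2: "(z0 t \<bullet> low_part h t)\<^sup>2 = (\<Sum>k\<in>set low_modes. \<Sum>m\<in>set low_modes. h k * h m * ((z0 t \<bullet> emode k t) * (z0 t \<bullet> emode m t)))" for t
    unfolding power2_eq_square low_part_def inner_sum_right sum_product by (simp add: mult_ac)
  have "53/40 * (s0 t ^ 3 * (norm (low_part h t))\<^sup>2) - 63/50 * (s0 t ^ 5 * (z0 t \<bullet> low_part h t)\<^sup>2) =
      (\<Sum>k\<in>set low_modes. \<Sum>m\<in>set low_modes. h k * h m * G k m t)" for t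
    unfolding 1 2 G_def by (simp add: sum_distrib_left right_diff_distrib sum_subtractf mult_ac)
  then have "avg (\<lambda>t. 53/40 * (s0 t ^ 3 * (norm (low_part h t))\<^sup>2) - 63/50 * (s0 t ^ 5 * (z0 t \<bullet> low_part h t)\<^sup>2)) =
      avg (\<lambda>t. \<Sum>k\<in>set low_modes. \<Sum>m\<in>set low_modes. h k * h m * G k m t)"
    by simp
  also have "\<dots> = (\<Sum>k\<in>set low_modes. \<Sum>m\<in>set low_modes. h k * h m * low_form k m)"
    by (simp add: avg_sum continuous_intros cG avg_cmult low_form_def G_def[abs_def, symmetric])
      (simp add: G_def low_form_def[symmetric])
  also have "\<dots> \<le> (\<Sum>k\<in>set low_modes. 7/10 * (real k)\<^sup>2 * (h k)\<^sup>2)"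
  proof (rule weighted_diagonal_dominance[where w = "\<lambda>k. of_int (weight k)"])
    show "0 < real_of_int (weight k)" for k by (simp add: weight_def)
    show "low_form k k * of_int (weight k) + (\<Sum>m\<in>set low_modes - {k}. \<bar>low_form k m\<bar> * of_int (weight m))
      \<le> 7/10 * (real k)\<^sup>2 * of_int (weight k)" if "k \<in> set low_modes" for k
      by (rule low_form_row[OF that])
  qed (simp_all add: low_form_sym)
  also have "\<dots> = 7/10 * (\<Sum>k\<in>set low_modes. (real k * h k)\<^sup>2)"
    by (simp add: sum_distrib_left power_mult_distrib mult.assoc)
  finally show ?thesis .
qed

text \<open>Young's inequality with parameters 3/10 and 5/12 decouples low and high modes pointwise,
  so no mixed matrix entries arise. For \<open>g\<close> the total is
  \<open>53/52 * 13/3 * 9.261 + 54/25 * 7/5 * 1.0005 * 9.261 < 70\<close>, where 9.261 bounds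
  \<open>s^3\<close>.\<close>

lemma split_form:
  fixes z l g :: complex
  assumes s: "0 < s" "s \<le> 21/10" and sz: "s\<^sup>2 * (norm z)\<^sup>2 \<le> 10005/10000"
  shows "53/52 * (s^3 * (norm (l + g))\<^sup>2) - 54/25 * (s^5 * (z \<bullet> (l + g))\<^sup>2) \<le>
    53/40 * (s^3 * (norm l)\<^sup>2) - 63/50 * (s^5 * (z \<bullet> l)\<^sup>2) + 70 * (norm g)\<^sup>2"
proof -
  have 1: "(norm (l + g))\<^sup>2 \<le> 13/10 * (norm l)\<^sup>2 + 13/3 * (norm g)\<^sup>2"
  proof -
    have "0 \<le> (norm (3 *\<^sub>R l - 10 *\<^sub>R g))\<^sup>2" by simp
    also have "\<dots> = 9 * (norm l)\<^sup>2 - 60 * (l \<bullet> g) + 100 * (norm g)\<^sup>2"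
      unfolding power2_norm_eq_inner by (simp add: inner_diff_left inner_diff_right inner_commute)
    finally show ?thesis unfolding norm_add_sq by linarith
  qed
  have 2: "(z \<bullet> (l + g))\<^sup>2 \<ge> 7/12 * (z \<bullet> l)\<^sup>2 - 7/5 * (z \<bullet> g)\<^sup>2"
  proof -
    have "0 \<le> (5 * (z \<bullet> l) + 12 * (z \<bullet> g))\<^sup>2" by simp
    then show ?thesis unfolding inner_add_right by (simp add: power2_eq_square algebra_simps)
  qed
  have s3: "s^3 \<le> 9261/1000" and s30: "0 \<le> s^3" and s50: "0 \<le> s^5"
    using power_mono[of s "21/10" 3] s by (auto simp: power_divide)
  have 3: "s^5 * (z \<bullet> g)\<^sup>2 \<le> 10005/10000 * (s^3 * (norm g)\<^sup>2)"
  proof -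
    have "(z \<bullet> g)\<^sup>2 \<le> (norm z)\<^sup>2 * (norm g)\<^sup>2"
      using Cauchy_Schwarz_ineq[of z g] by (simp add: power2_norm_eq_inner)
    then have "s^5 * (z \<bullet> g)\<^sup>2 \<le> s^5 * ((norm z)\<^sup>2 * (norm g)\<^sup>2)"
      using s50 by (rule mult_left_mono)
    also have "\<dots> = (s\<^sup>2 * (norm z)\<^sup>2) * (s^3 * (norm g)\<^sup>2)"
      by (simp add: eval_nat_numeral)
    also have "\<dots> \<le> 10005/10000 * (s^3 * (norm g)\<^sup>2)"
      by (rule mult_right_mono[OF sz]) (use s30 in simp)
    finally show ?thesis .
  qed
  have 4: "s^3 * (norm g)\<^sup>2 \<le> 9261/1000 * (norm g)\<^sup>2"
    by (rule mult_right_mono[OF s3]) simp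
  have 5: "0 \<le> (norm g)\<^sup>2" by simp
  have "s^3 * (norm (l + g))\<^sup>2 \<le> 13/10 * (s^3 * (norm l)\<^sup>2) + 13/3 * (s^3 * (norm g)\<^sup>2)"
    using mult_left_mono[OF 1 s30] by (simp add: algebra_simps)
  moreover have "s^5 * (z \<bullet> (l + g))\<^sup>2 \<ge> 7/12 * (s^5 * (z \<bullet> l)\<^sup>2) - 7/5 * (s^5 * (z \<bullet> g)\<^sup>2)"
    using mult_left_mono[OF 2 s50] by (simp add: algebra_simps)
  ultimately show ?thesis using 3 4 5 by linarith
qed

text \<open>Frequencies from 10 on turn the constant 70 into 70/100 of the kinetic term, the same
  ratio 7/10 as for the low modes. The two kinetic terms then add up exactly.\<close>

lemma form_bound:
  assumes h: "h \<in> hball r" "0 \<le> r"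
  shows "avg (\<lambda>t. 53/52 * (s0 t ^ 3 * (norm (ser h t))\<^sup>2) - 54/25 * (s0 t ^ 5 * (z0 t \<bullet> ser h t)\<^sup>2))
    \<le> 7/10 * hnorm2 h"
proof -
  define g where "g k = (if k \<in> set low_modes then 0 else h k)" for k
  define l where "l k = (if k \<in> set low_modes then h k else 0)" for k
  have sl: "summable (\<lambda>k. \<bar>l k\<bar>)"
    by (rule summable_abs_finite[of "set low_modes"]) (auto simp: l_def)
  have sg: "summable (\<lambda>k. \<bar>g k\<bar>)"
    by (rule summable_comparison_test'[OF hball_summable_abs[OF h]]) (simp add: g_def)
  have "ser l t = low_part h t" for t
    unfolding low_part_def by (subst ser_finite[of "set low_modes"]) (auto simp: l_def)
  moreover have "h = (\<lambda>k. l k + g k)" by (auto simp: l_def g_def)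
  ultimately have split: "ser h t = low_part h t + ser g t" for t
    using ser_add[OF sl sg] by metis
  \<comment> \<open>The frequencies 0, 3, 6, 9 are absent from \<open>h\<close>, and the remaining
    ones below 10 were moved to \<open>l\<close>.\<close>
  have g0: "g k = 0" if "k < 10" for k
  proof -
    have "k \<in> {0,1,2,3,4,5,6,7,8,9}" using that by auto
    then show ?thesis
      using hball_zero_mult_3[OF h(1), of 0] hball_zero_mult_3[OF h(1), of 3]
        hball_zero_mult_3[OF h(1), of 6] hball_zero_mult_3[OF h(1), of 9]
      by (auto simp: g_def low_modes_def)
  qed
  have sgk: "summable (\<lambda>k. (real k * g k)\<^sup>2)"
    by (rule summable_comparison_test'[OF summable_hnorm2[OF h(1)]]) (simp add: g_def)
  have sums_g: "(\<lambda>k. (g k)\<^sup>2) sums avg (\<lambda>t. (norm (ser g t))\<^sup>2)"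
    by (rule avg_norm_ser[OF sg g0]) simp
  have "100 * avg (\<lambda>t. (norm (ser g t))\<^sup>2) \<le> (\<Sum>k. (real k * g k)\<^sup>2)"
  proof -
    have "(\<lambda>k. 100 * (g k)\<^sup>2) sums (100 * avg (\<lambda>t. (norm (ser g t))\<^sup>2))"
      by (rule sums_mult[OF sums_g])
    moreover have le: "100 * (g k)\<^sup>2 \<le> (real k * g k)\<^sup>2" for k
    proof (cases "k < 10")
      case False
      then have "10\<^sup>2 \<le> (real k)\<^sup>2" by (intro power_mono) auto
      then show ?thesis using mult_right_mono[of "10\<^sup>2" "(real k)\<^sup>2" "(g k)\<^sup>2"]
        by (simp add: power_mult_distrib)
    qed (simp add: g0)
    ultimately show ?thesis
      by (intro sums_le[OF le _ summable_sums[OF sgk]])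
  qed
  moreover have "(\<Sum>k\<in>set low_modes. (real k * h k)\<^sup>2) + (\<Sum>k. (real k * g k)\<^sup>2) = hnorm2 h"
  proof -
    have "(\<lambda>k. (real k * l k)\<^sup>2) sums (\<Sum>k\<in>set low_modes. (real k * l k)\<^sup>2)"
      by (rule sums_finite) (auto simp: l_def)
    then have "(\<lambda>k. (real k * l k)\<^sup>2 + (real k * g k)\<^sup>2) sums
        ((\<Sum>k\<in>set low_modes. (real k * l k)\<^sup>2) + (\<Sum>k. (real k * g k)\<^sup>2))"
      by (rule sums_add[OF _ summable_sums[OF sgk]])
    moreover have "(\<lambda>k. (real k * l k)\<^sup>2 + (real k * g k)\<^sup>2) = (\<lambda>k. (real k * h k)\<^sup>2)"
      by (auto simp: l_def g_def)
    moreover have "(\<Sum>k\<in>set low_modes. (real k * l k)\<^sup>2) = (\<Sum>k\<in>set low_modes. (real k * h k)\<^sup>2)"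
      by (simp add: l_def)
    ultimately show ?thesis by (simp add: hnorm2_def sums_iff)
  qed
  moreover have "avg (\<lambda>t. 53/52 * (s0 t ^ 3 * (norm (ser h t))\<^sup>2) - 54/25 * (s0 t ^ 5 * (z0 t \<bullet> ser h t)\<^sup>2))
      \<le> avg (\<lambda>t. (53/40 * (s0 t ^ 3 * (norm (low_part h t))\<^sup>2) - 63/50 * (s0 t ^ 5 * (z0 t \<bullet> low_part h t)\<^sup>2))
        + 70 * (norm (ser g t))\<^sup>2)"
    unfolding split
    by (rule avg_mono)
      (intro continuous_intros continuous_ser[OF sg] split_form[OF s0_pos s0_le s0_norm_z0_sq])+
  moreover have "\<dots> = avg (\<lambda>t. 53/40 * (s0 t ^ 3 * (norm (low_part h t))\<^sup>2) - 63/50 * (s0 t ^ 5 * (z0 t \<bullet> low_part h t)\<^sup>2))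
        + 70 * avg (\<lambda>t. (norm (ser g t))\<^sup>2)"
    by (subst avg_add) (auto intro!: continuous_intros continuous_ser[OF sg] simp: avg_cmult)
  ultimately show ?thesis using low_part_form[of h] by linarith
qed

section \<open>Existence of a minimiser\<close>


definition pot :: "(nat \<Rightarrow> real) \<Rightarrow> real" where
  "pot h = avg (\<lambda>t. inverse (norm (z0 t + ser h t)))"

text \<open>Despite its name this is the Lagrangian action of \<open>z0 + ser h\<close>, kinetic
  term plus inverse distance, with the constant kinetic term of \<open>z0\<close> dropped.\<close>

definition energy :: "(nat \<Rightarrow> real) \<Rightarrow> real" where
  "energy h = linear_part h + hnorm2 h / 2 + pot h"

abbreviation ball0 :: "(nat \<Rightarrow> real) set" where "ball0 \<equiv> hball (1/50)"

lemma norm_ser_ball0: "h \<in> ball0 \<Longrightarrow> norm (ser h t) \<le> 26/1000"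
  using hball_norm_ser_le[of h "1/50" t] by simp

lemma norm_eta_ge: "h \<in> ball0 \<Longrightarrow> 44/100 \<le> norm (z0 t + ser h t)"
  using norm_z0_ge[of t] norm_ser_ball0[of h t] norm_triangle_ineq4[of "z0 t + ser h t" "ser h t"] by simp

lemma eta_nonzero: "h \<in> ball0 \<Longrightarrow> z0 t + ser h t \<noteq> 0"
  using norm_eta_ge[of h t] by auto

lemma summable_ball0: "h \<in> ball0 \<Longrightarrow> summable (\<lambda>k. \<bar>h k\<bar>)"
  by (rule hball_summable_abs) auto

lemma continuous_ser_ball0: "h \<in> ball0 \<Longrightarrow> continuous_on A (ser h)"
  by (rule continuous_ser[OF summable_ball0])

lemma continuous_inv_norm_eta:
  "h \<in> ball0 \<Longrightarrow> continuous_on A (\<lambda>t. inverse (norm (z0 t + ser h t)))"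
  by (intro continuous_intros continuous_ser_ball0) (auto dest: eta_nonzero)

lemma zero_ball0: "(\<lambda>_. 0) \<in> ball0"
  by (simp add: hball_def)

lemma ser_0 [simp]: "ser (\<lambda>_. 0) t = 0"
  by (simp add: ser_def)

text \<open>The coefficient 3/20 is 1/2 from the kinetic term minus half of the 7/10 in
  \<open>form_bound\<close>. The pointwise error 3/1000000 doubles because \<open>avg\<close> is
  twice the mean.\<close>

lemma energy_lower:
  assumes h: "h \<in> ball0"
  shows "energy h \<ge> energy (\<lambda>_. 0) - 23/10000 * sqrt (hnorm2 h) + 3/20 * hnorm2 h - 6/1000000"
proof -
  define Q where "Q t = 53/52 * (s0 t ^ 3 * (norm (ser h t))\<^sup>2) - 54/25 * (s0 t ^ 5 * (z0 t \<bullet> ser h t)\<^sup>2)" for t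
  have cQ: "continuous_on UNIV Q"
    unfolding Q_def by (intro continuous_intros continuous_ser_ball0 h)
  have cL: "continuous_on UNIV (\<lambda>t. s0 t ^ 3 * (z0 t \<bullet> ser h t))"
    by (intro continuous_intros continuous_ser_ball0 h)
  have c0: "continuous_on UNIV (\<lambda>t. inverse (norm (z0 t)))"
    using continuous_inv_norm_eta[OF zero_ball0] by simp
  have "avg (\<lambda>t. inverse (norm (z0 t)) - s0 t ^ 3 * (z0 t \<bullet> ser h t) - 1/2 * Q t - 3/1000000) \<le> pot h"
    unfolding pot_def
  proof (rule avg_mono)
    fix t
    have "inverse (norm (z0 t + ser h t)) - inverse (norm (z0 t)) \<ge>
      - (s0 t ^ 3 * (z0 t \<bullet> ser h t)) - 1/2 * (53/52) * (s0 t ^ 3 * (norm (ser h t))\<^sup>2)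
      + 1/2 * (54/25) * (s0 t ^ 5 * (z0 t \<bullet> ser h t)\<^sup>2) - 3/1000000"
      by (rule inverse_norm_expansion[OF s0_pos s0_le s0_defect norm_ser_ball0[OF h]])
    then show "inverse (norm (z0 t)) - s0 t ^ 3 * (z0 t \<bullet> ser h t) - 1/2 * Q t - 3/1000000
        \<le> inverse (norm (z0 t + ser h t))"
      by (simp add: Q_def field_simps)
  qed (intro continuous_intros cQ cL c0 continuous_inv_norm_eta[OF h])+
  also have "avg (\<lambda>t. inverse (norm (z0 t)) - s0 t ^ 3 * (z0 t \<bullet> ser h t) - 1/2 * Q t - 3/1000000) =
      pot (\<lambda>_. 0) - avg (\<lambda>t. s0 t ^ 3 * (z0 t \<bullet> ser h t)) - 1/2 * avg Q - 2 * (3/1000000)"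
    unfolding pot_def ser_0 add_0_right
    by (simp only: avg_diff cQ cL c0 continuous_intros avg_cmult avg_const)
  finally have "pot (\<lambda>_. 0) - avg (\<lambda>t. s0 t ^ 3 * (z0 t \<bullet> ser h t)) - 1/2 * avg Q - 2 * (3/1000000) \<le> pot h" .
  moreover have "avg Q \<le> 7/10 * hnorm2 h"
    unfolding Q_def by (rule form_bound[OF h]) simp
  moreover have "\<bar>linear_part h - avg (\<lambda>t. s0 t ^ 3 * (z0 t \<bullet> ser h t))\<bar> \<le> 23/10000 * sqrt (hnorm2 h)"
    by (rule linear_part_bound[OF h]) simp
  moreover have "energy (\<lambda>_. 0) = pot (\<lambda>_. 0)"
    by (simp add: energy_def linear_part_def hnorm2_def)
  ultimately show ?thesis
    unfolding energy_def[of h] by linarith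
qed

lemma hnorm2_nonneg: "h \<in> hball r \<Longrightarrow> 0 \<le> hnorm2 h"
  unfolding hnorm2_def by (rule suminf_nonneg[OF summable_hnorm2]) auto

lemma sqrt_hnorm2_le: "h \<in> ball0 \<Longrightarrow> sqrt (hnorm2 h) \<le> 1/50"
  using real_sqrt_le_mono[OF hnorm2_le[of h "1/50"]] by simp

lemma inverse_norm_diff:
  fixes a b :: complex
  assumes "44/100 \<le> norm a" "44/100 \<le> norm b"
  shows "\<bar>inverse (norm a) - inverse (norm b)\<bar> \<le> 6 * norm (a - b)"
proof -
  have pos: "0 < norm a" "0 < norm b" using assms by linarith+
  have "inverse (norm a) - inverse (norm b) = (norm b - norm a) * (inverse (norm a) * inverse (norm b))"
    using pos by (simp add: field_simps)
  then have "\<bar>inverse (norm a) - inverse (norm b)\<bar> = \<bar>norm b - norm a\<bar> * (inverse (norm a) * inverse (norm b))"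
    by (simp add: abs_mult)
  also have "\<dots> \<le> norm (a - b) * (inverse (44/100) * inverse (44/100))"
    using assms pos norm_triangle_ineq3[of b a]
    by (intro mult_mono le_imp_inverse_le) (auto simp: norm_minus_commute)
  also have "\<dots> \<le> 6 * norm (a - b)" by simp
  finally show ?thesis .
qed

text \<open>The direct method: along a coefficientwise convergent minimising sequence
  \<open>pot\<close> and \<open>linear_part\<close> converge, while the kinetic term is only lower
  semicontinuous.\<close>

lemma energy_minimizer:
  obtains h where "h \<in> ball0" "\<And>g. g \<in> ball0 \<Longrightarrow> energy h \<le> energy g"
proof -
  define m where "m = Inf (energy ` ball0)"
  have lb: "energy (\<lambda>_. 0) - 1 \<le> energy g" if g: "g \<in> ball0" for g
    using energy_lower[OF g] sqrt_hnorm2_le[OF g] hnorm2_nonneg[OF g] by linarith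
  have bdd: "bdd_below (energy ` ball0)"
    by (rule bdd_belowI2[OF lb])
  have ne: "energy ` ball0 \<noteq> {}" using zero_ball0 by blast
  have "\<exists>g\<in>ball0. energy g < m + 1 / real (Suc n)" for n
  proof -
    have "m < m + 1 / real (Suc n)" by simp
    then show ?thesis unfolding m_def cInf_less_iff[OF ne bdd] by blast
  qed
  then obtain hs where hs: "\<And>n. hs n \<in> ball0" "\<And>n. energy (hs n) < m + 1 / real (Suc n)"
    by metis
  obtain h \<sigma> where h: "h \<in> ball0" and \<sigma>: "strict_mono (\<sigma> :: nat \<Rightarrow> nat)"
    and lim: "\<And>k. (\<lambda>n. hs (\<sigma> n) k) \<longlonglongrightarrow> h k"
    using hball_compact[of hs "1/50"] hs(1) by auto
  have "(\<lambda>n. pot (hs (\<sigma> n))) \<longlonglongrightarrow> pot h"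
    unfolding pot_def
  proof (rule avg_tendsto)
    define e where "e n = 6 * (\<Sum>k. \<bar>hs (\<sigma> n) k - h k\<bar>)" for n
    show "\<bar>inverse (norm (z0 t + ser (hs (\<sigma> n)) t)) - inverse (norm (z0 t + ser h t))\<bar> \<le> e n" for n t
    proof -
      have "\<bar>inverse (norm (z0 t + ser (hs (\<sigma> n)) t)) - inverse (norm (z0 t + ser h t))\<bar>
          \<le> 6 * norm ((z0 t + ser (hs (\<sigma> n)) t) - (z0 t + ser h t))"
        by (rule inverse_norm_diff[OF norm_eta_ge norm_eta_ge]) (rule hs h)+
      also have "(z0 t + ser (hs (\<sigma> n)) t) - (z0 t + ser h t) = ser (\<lambda>k. hs (\<sigma> n) k - h k) t"
        by (simp add: ser_diff summable_ball0 hs h)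
      also have "norm \<dots> \<le> (\<Sum>k. \<bar>hs (\<sigma> n) k - h k\<bar>)"
        by (rule norm_ser_le[OF hball_summable_abs[OF hball_diff[OF hs(1) h]]]) simp
      finally show ?thesis by (simp add: e_def)
    qed
    have "(\<lambda>n. \<Sum>k. \<bar>hs (\<sigma> n) k - h k\<bar>) \<longlonglongrightarrow> 0"
      by (rule hball_uniform[OF hs(1) h _ lim]) simp
    then show "e \<longlonglongrightarrow> 0"
      unfolding e_def using tendsto_mult_left[of _ 0 _ "6::real"] by simp
  qed (intro continuous_inv_norm_eta hs h)+
  then have pot_lim: "(\<lambda>n. pot (hs (\<sigma> n))) \<longlonglongrightarrow> pot h" .
  have lin_lim: "(\<lambda>n. linear_part (hs (\<sigma> n))) \<longlonglongrightarrow> linear_part h"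
    unfolding linear_part_def by (intro tendsto_intros lim)
  \<comment> \<open>A finite piece of the kinetic sum passes to the limit; \<open>N\<close> is
    released only afterwards.\<close>
  have partial: "(\<Sum>k<N. (real k * h k)\<^sup>2) \<le> 2 * (m - linear_part h - pot h)" for N
  proof -
    have "linear_part h + (\<Sum>k<N. (real k * h k)\<^sup>2) / 2 + pot h \<le> m"
    proof (rule LIMSEQ_le)
      show "(\<lambda>n. linear_part (hs (\<sigma> n)) + (\<Sum>k<N. (real k * hs (\<sigma> n) k)\<^sup>2) / 2 + pot (hs (\<sigma> n)))
          \<longlonglongrightarrow> linear_part h + (\<Sum>k<N. (real k * h k)\<^sup>2) / 2 + pot h"
        by (intro tendsto_intros lim pot_lim lin_lim) auto
      have "(\<lambda>n. m + 1 / real (Suc n)) \<longlonglongrightarrow> m + 0"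
        by (intro tendsto_intros LIMSEQ_inverse_real_of_nat[unfolded inverse_eq_divide])
      from LIMSEQ_subseq_LIMSEQ[OF this \<sigma>]
      show "(\<lambda>n. m + 1 / real (Suc (\<sigma> n))) \<longlonglongrightarrow> m" by (simp add: o_def)
      have "linear_part (hs (\<sigma> n)) + (\<Sum>k<N. (real k * hs (\<sigma> n) k)\<^sup>2) / 2 + pot (hs (\<sigma> n))
          \<le> m + 1 / real (Suc (\<sigma> n))" for n
      proof -
        have "(\<Sum>k<N. (real k * hs (\<sigma> n) k)\<^sup>2) \<le> hnorm2 (hs (\<sigma> n))"
          unfolding hnorm2_def by (rule sum_le_suminf[OF summable_hnorm2[OF hs(1)]]) auto
        then show ?thesis using hs(2)[of "\<sigma> n"] unfolding energy_def by linarith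
      qed
      then show "\<exists>N'. \<forall>n\<ge>N'. linear_part (hs (\<sigma> n)) + (\<Sum>k<N. (real k * hs (\<sigma> n) k)\<^sup>2) / 2 + pot (hs (\<sigma> n))
          \<le> m + 1 / real (Suc (\<sigma> n))" by blast
    qed
    then show ?thesis by (simp add: field_simps)
  qed
  have "hnorm2 h \<le> 2 * (m - linear_part h - pot h)"
    unfolding hnorm2_def by (rule suminf_le_const[OF summable_hnorm2[OF h] partial])
  then have "energy h \<le> m" unfolding energy_def by (simp add: field_simps)
  moreover have "m \<le> energy g" if "g \<in> ball0" for g
    unfolding m_def by (rule cINF_lower[OF bdd that])
  ultimately show thesis using that[OF h] order_trans by blast
qed

text \<open>On the boundary the lower bound, in millionths, is 60 - 46 - 6 = 8 above the value at
  \<open>z0\<close>, which a minimiser cannot exceed.\<close>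

lemma minimizer_interior:
  assumes h: "h \<in> ball0" and min: "\<And>g. g \<in> ball0 \<Longrightarrow> energy h \<le> energy g"
  shows "hnorm2 h < (1/50)\<^sup>2"
proof (rule ccontr)
  assume "\<not> hnorm2 h < (1/50)\<^sup>2"
  then have eq: "hnorm2 h = (1/50)\<^sup>2" using hnorm2_le[OF h] by linarith
  have "sqrt (hnorm2 h) = 1/50" unfolding eq by simp
  then show False
    using energy_lower[OF h] min[OF zero_ball0] by (simp add: eq power_divide)
qed

lemma local_min_linear:
  fixes L C :: real
  assumes "0 < \<delta>" "\<And>\<tau>. \<bar>\<tau>\<bar> < \<delta> \<Longrightarrow> 0 \<le> \<tau> * L + C * \<tau>\<^sup>2"
  shows "L = 0"
proof (rule DERIV_local_min)
  show "((\<lambda>\<tau>. \<tau> * L + C * \<tau>\<^sup>2) has_real_derivative L) (at 0)"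
    by (auto intro!: derivative_eq_intros)
  show "\<forall>y. \<bar>0 - y\<bar> < \<delta> \<longrightarrow> 0 * L + C * 0\<^sup>2 \<le> y * L + C * y\<^sup>2"
    using assms(2) by simp
qed (rule assms)

text \<open>Only the coefficient at \<open>k\<close> is varied. Being interior, \<open>h\<close>
  admits increments of both signs, and an upper bound for \<open>pot\<close> with quadratic error
  forces the linear term \<open>L\<close> to vanish.\<close>

lemma euler_lagrange:
  assumes h: "h \<in> ball0" and min: "\<And>g. g \<in> ball0 \<Longrightarrow> energy h \<le> energy g" and k: "\<not> 3 dvd k"
  shows "(real k)\<^sup>2 * (a0 k + h k) =
    avg (\<lambda>t. ((z0 t + ser h t) \<bullet> emode k t) / norm (z0 t + ser h t) ^ 3)"
proof -
  define \<eta> where "\<eta> t = z0 t + ser h t" for t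
  have c\<eta>: "continuous_on UNIV \<eta>"
    unfolding \<eta>_def by (intro continuous_intros continuous_ser_ball0[OF h])
  have \<eta>: "44/100 \<le> norm (\<eta> t)" for t unfolding \<eta>_def by (rule norm_eta_ge[OF h])
  have \<eta>0: "norm (\<eta> t) \<noteq> 0" for t
    using \<eta>[of t] by linarith
  define F where "F t = (\<eta> t \<bullet> emode k t) / norm (\<eta> t) ^ 3" for t
  have cF: "continuous_on UNIV F"
    unfolding F_def using \<eta>0 by (intro continuous_intros c\<eta>) auto
  define gap where "gap = (1/50)\<^sup>2 - hnorm2 h"
  have gap: "0 < gap" using minimizer_interior[OF h min] by (simp add: gap_def)
  define P where "P \<tau> = 2 * \<tau> * (real k)\<^sup>2 * h k + \<tau>\<^sup>2 * (real k)\<^sup>2" for \<tau>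
  have "P \<midarrow>0\<rightarrow> P 0" unfolding P_def by (intro tendsto_intros)
  then obtain \<delta>1 where \<delta>1: "0 < \<delta>1" "\<And>\<tau>. \<tau> \<noteq> 0 \<Longrightarrow> \<bar>\<tau>\<bar> < \<delta>1 \<Longrightarrow> \<bar>P \<tau>\<bar> < gap"
    using LIM_D[of P "P 0" 0 gap] gap by (auto simp: P_def)
  \<comment> \<open>The value 55/1000 is \<open>44/100 / 8\<close>, the range on which
    \<open>inverse_norm_upper\<close> applies.\<close>
  define \<delta> where "\<delta> = min \<delta>1 (55/1000)"
  define L where "L = (real k)\<^sup>2 * (a0 k + h k) - avg F"
  define C where "C = (real k)\<^sup>2 / 2 + 2 * (5 / (44/100)^3)"
  have "0 \<le> \<tau> * L + C * \<tau>\<^sup>2" if \<tau>: "\<bar>\<tau>\<bar> < \<delta>" for \<tau>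
  proof (cases "\<tau> = 0")
    case False
    define g where "g = h(k := h k + \<tau>)"
    have seq: "(\<lambda>j. (real j * g j)\<^sup>2) = (\<lambda>j. (real j * h j)\<^sup>2 + (if j = k then P \<tau> else 0))"
      by (auto simp: g_def P_def power2_eq_square algebra_simps)
    have sums: "(\<lambda>j. (real j * g j)\<^sup>2) sums (hnorm2 h + P \<tau>)"
      unfolding seq hnorm2_def
      by (intro sums_add summable_sums[OF summable_hnorm2[OF h]]) (rule sums_single)
    then have hg: "hnorm2 g = hnorm2 h + P \<tau>" by (simp add: hnorm2_def sums_iff)
    have g: "g \<in> ball0"
    proof (rule hballI)
      show "g j = 0" if "3 dvd j" for j
        using that k hball_zero_mult_3[OF h that] by (auto simp: g_def)
      show "hnorm2 g \<le> (1/50)\<^sup>2"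
        using \<delta>1(2)[OF False] \<tau> unfolding hg \<delta>_def gap_def by (auto simp: abs_less_iff)
    qed (use sums in \<open>auto simp: sums_iff\<close>)
    have serg: "ser g t = ser h t + \<tau> *\<^sub>R emode k t" for t
    proof -
      define u where "u j = (if j = k then \<tau> else 0)" for j
      have "summable (\<lambda>j. \<bar>u j\<bar>)" by (rule summable_abs_finite[of "{k}"]) (auto simp: u_def)
      moreover have "g = (\<lambda>j. h j + u j)" by (auto simp: g_def u_def)
      moreover have "ser u t = \<tau> *\<^sub>R emode k t"
        by (subst ser_finite[of "{k}"]) (auto simp: u_def)
      ultimately show ?thesis using ser_add[OF summable_ball0[OF h]] by metis
    qed
    have "linear_part g = linear_part h + \<tau> * ((real k)\<^sup>2 * a0 k)"
    proof -
      have "linear_part g = (\<Sum>j\<in>amp_modes. (real j)\<^sup>2 * a0 j * h j + (if j = k then \<tau> * ((real k)\<^sup>2 * a0 k) else 0))"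
        unfolding linear_part_def by (rule sum.cong) (auto simp: g_def algebra_simps)
      also have "\<dots> = linear_part h + (\<Sum>j\<in>amp_modes. if j = k then \<tau> * ((real k)\<^sup>2 * a0 k) else 0)"
        by (simp add: linear_part_def sum.distrib)
      also have "(\<Sum>j\<in>amp_modes. if j = k then \<tau> * ((real k)\<^sup>2 * a0 k) else 0) = \<tau> * ((real k)\<^sup>2 * a0 k)"
        using a0_eq_0[of k] by (subst sum.delta) (auto simp: amp_modes_def)
      finally show ?thesis .
    qed
    moreover have "pot g \<le> pot h - \<tau> * avg F + 2 * (5 / (44/100)^3) * \<tau>\<^sup>2"
    proof -
      have "pot g \<le> avg (\<lambda>t. inverse (norm (\<eta> t)) - \<tau> * F t + 5 / (44/100)^3 * \<tau>\<^sup>2)"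
        unfolding pot_def
      proof (rule avg_mono)
        fix t
        have n: "norm (\<tau> *\<^sub>R emode k t) \<le> \<bar>\<tau>\<bar>"
          using norm_emode_le[of k t] by (simp add: mult_left_le)
        then have n8: "norm (\<tau> *\<^sub>R emode k t) \<le> 44/100 / 8" using \<tau> by (simp add: \<delta>_def)
        have "inverse (norm (\<eta> t + \<tau> *\<^sub>R emode k t)) \<le> inverse (norm (\<eta> t))
            - (\<eta> t \<bullet> (\<tau> *\<^sub>R emode k t)) / norm (\<eta> t) ^ 3 + 5 / (44/100)^3 * (norm (\<tau> *\<^sub>R emode k t))\<^sup>2"
          by (rule inverse_norm_upper[OF _ \<eta> n8]) simp
        moreover have "5 / (44/100)^3 * (norm (\<tau> *\<^sub>R emode k t))\<^sup>2 \<le> 5 / (44/100)^3 * \<tau>\<^sup>2"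
          using power_mono[OF n norm_ge_zero, of 2] by (intro mult_left_mono) simp_all
        ultimately have "inverse (norm (\<eta> t + \<tau> *\<^sub>R emode k t)) \<le> inverse (norm (\<eta> t))
            - (\<eta> t \<bullet> (\<tau> *\<^sub>R emode k t)) / norm (\<eta> t) ^ 3 + 5 / (44/100)^3 * \<tau>\<^sup>2"
          by (rule order_trans[OF _ add_left_mono])
        then show "inverse (norm (z0 t + ser g t)) \<le> inverse (norm (\<eta> t)) - \<tau> * F t + 5 / (44/100)^3 * \<tau>\<^sup>2"
          unfolding serg by (simp add: \<eta>_def F_def add.assoc)
      qed (use \<eta>0 in \<open>auto intro!: continuous_intros continuous_inv_norm_eta[OF g] cF c\<eta>\<close>)
      also have "\<dots> = avg (\<lambda>t. inverse (norm (\<eta> t))) - \<tau> * avg F + 2 * (5 / (44/100)^3 * \<tau>\<^sup>2)"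
      proof -
        have ci: "continuous_on UNIV (\<lambda>t. inverse (norm (\<eta> t)))"
          using continuous_inv_norm_eta[OF h] by (simp add: \<eta>_def)
        show ?thesis
          by (simp only: avg_add avg_diff ci cF continuous_intros avg_cmult avg_const)
      qed
      finally show ?thesis by (simp add: pot_def \<eta>_def)
    qed
    moreover have "energy h \<le> energy g" by (rule min[OF g])
    ultimately show ?thesis
      unfolding energy_def hg P_def L_def C_def by (simp add: algebra_simps add_divide_distrib)
  qed simp
  then have "L = 0"
    using \<delta>1(1) by (intro local_min_linear[of \<delta> L C]) (auto simp: \<delta>_def)
  then show ?thesis by (simp add: L_def F_def[abs_def] \<eta>_def)
qed

section \<open>Fourier coefficients determine second derivatives\<close>


text \<open>The integral is oriented, so one formula serves positive and negative times.\<close>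

definition antider :: "(real \<Rightarrow> 'a::euclidean_space) \<Rightarrow> real \<Rightarrow> 'a" where
  "antider f t = (LBINT y=0..t. f y)"

lemma antider_0 [simp]: "antider f 0 = 0"
  unfolding antider_def by (metis interval_integral_endpoints_same zero_ereal_def)

lemma antider_deriv:
  assumes "continuous_on UNIV f"
  shows "(antider f has_vector_derivative f t) (at t)"
proof -
  define a b where "a = min 0 t - 1" and "b = max 0 t + 1"
  have "((\<lambda>u. LBINT y=0..u. f y) has_vector_derivative f t) (at t within {a..b})"
    using interval_integral_FTC2[of a 0 b f t] continuous_on_subset[OF assms]
    by (auto simp: a_def b_def zero_ereal_def)
  moreover have "at t within {a..b} = at t"
    by (rule at_within_interior) (auto simp: a_def b_def)
  ultimately show ?thesis unfolding antider_def[abs_def] by simp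
qed

lemma const_of_zero_vector_derivative:
  fixes f :: "real \<Rightarrow> 'a::euclidean_space"
  assumes "\<And>t. (f has_vector_derivative 0) (at t)"
  shows "f s = f t"
proof -
  have "\<exists>c. \<forall>x\<in>UNIV. f x = c"
    by (rule has_derivative_zero_constant) (use assms in \<open>auto simp: has_vector_derivative_def\<close>)
  then show ?thesis by auto
qed

lemma continuous_antider: "continuous_on UNIV f \<Longrightarrow> continuous_on A (antider f)"
  by (rule continuous_on_vector_derivative) (rule has_vector_derivative_at_within[OF antider_deriv])

lemma integral_antider:
  fixes f :: "real \<Rightarrow> 'a::euclidean_space"
  assumes "continuous_on UNIV f" "a \<le> b"
  shows "integral {a..b} f = antider f b - antider f a"
  by (rule integral_unique, rule fundamental_theorem_of_calculus[OF assms(2)])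
    (rule has_vector_derivative_at_within[OF antider_deriv[OF assms(1)]])

lemma antider_shift_deriv:
  assumes "continuous_on UNIV f"
  shows "((\<lambda>t. antider f (c + t)) has_vector_derivative f (c + t)) (at t)"
    and "((\<lambda>t. antider f (c - t)) has_vector_derivative - f (c - t)) (at t)"
proof -
  have d: "((\<lambda>t. c + t) has_vector_derivative 1) (at t)" "((\<lambda>t. c - t) has_vector_derivative - 1) (at t)"
    by (auto intro!: derivative_eq_intros)
  show "((\<lambda>t. antider f (c + t)) has_vector_derivative f (c + t)) (at t)"
    using vector_diff_chain_at[OF d(1) antider_deriv[OF assms]] by (simp add: o_def)
  show "((\<lambda>t. antider f (c - t)) has_vector_derivative - f (c - t)) (at t)"
    using vector_diff_chain_at[OF d(2) antider_deriv[OF assms]] by (simp add: o_def)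
qed

lemma avg_antider: "continuous_on UNIV G \<Longrightarrow> avg G = antider G (2 * pi) / pi"
  unfolding avg_def by (simp add: integral_antider)

lemma antider_odd_of_even:
  assumes "continuous_on UNIV f" "\<And>t. f (- t) = f t"
  shows "antider f (- t) = - antider f t"
proof -
  have "((\<lambda>t. antider f (0 + t) + antider f (0 - t)) has_vector_derivative 0) (at t)" for t
    using has_vector_derivative_add[OF antider_shift_deriv[OF assms(1), of 0 t]] assms(2)[of t] by simp
  from const_of_zero_vector_derivative[OF this, of t 0] show ?thesis
    by (simp add: add_eq_0_iff)
qed

lemma antider_even_of_odd:
  assumes "continuous_on UNIV f" "\<And>t. f (- t) = - f t"
  shows "antider f (- t) = antider f t"
proof -
  have "((\<lambda>t. antider f (0 + t) - antider f (0 - t)) has_vector_derivative 0) (at t)" for t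
    using has_vector_derivative_diff[OF antider_shift_deriv[OF assms(1), of 0 t]] assms(2)[of t] by simp
  from const_of_zero_vector_derivative[OF this, of t 0] show ?thesis by simp
qed

lemma antider_periodic_diff:
  assumes "continuous_on UNIV f" "\<And>t. f (T + t) = f t"
  shows "antider f (T + t) - antider f t = antider f (T + s) - antider f s"
proof -
  have "((\<lambda>t. antider f (T + t) - antider f (0 + t)) has_vector_derivative 0) (at t)" for t
    using has_vector_derivative_diff[OF antider_shift_deriv(1)[OF assms(1), of T t] antider_shift_deriv(1)[OF assms(1), of 0 t]]
      assms(2)[of t] by simp
  from const_of_zero_vector_derivative[OF this, of t s] show ?thesis by simp
qed

lemma avg_shift:
  assumes "continuous_on UNIV G" "\<And>t. G (t + 2 * pi) = G t"
  shows "avg (\<lambda>t. G (t + c)) = avg G"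
proof -
  have per: "G (2 * pi + t) = G t" for t using assms(2)[of t] by (simp add: add.commute)
  have "((\<lambda>t. antider G (c + t)) has_vector_derivative G (t + c)) (at t within {0..2*pi})" for t
    using has_vector_derivative_at_within[OF antider_shift_deriv(1)[OF assms(1), of c t]] by (simp add: add.commute)
  then have "((\<lambda>t. G (t + c)) has_integral (antider G (c + 2 * pi) - antider G (c + 0))) {0..2*pi}"
    by (intro fundamental_theorem_of_calculus) auto
  moreover have "antider G (c + 2 * pi) - antider G (c + 0) = antider G (2 * pi)"
    using antider_periodic_diff[OF assms(1) per, of c 0] by (simp add: add.commute)
  ultimately show ?thesis
    by (simp add: avg_def integral_unique integral_antider assms(1))
qed

lemma avg_half:
  assumes "continuous_on UNIV G" "\<And>t. G (2 * pi - t) = G t"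
  shows "avg G = 2 / pi * integral {0..pi} G"
proof -
  have "((\<lambda>t. antider G (0 + t) + antider G (2 * pi - t)) has_vector_derivative 0) (at t)" for t
    using has_vector_derivative_add[OF antider_shift_deriv(1)[OF assms(1), of 0 t] antider_shift_deriv(2)[OF assms(1), of "2 * pi" t]]
      assms(2)[of t] by simp
  from const_of_zero_vector_derivative[OF this, of 0 pi] show ?thesis
    by (simp add: avg_antider assms(1) integral_antider)
qed

lemma avg_antiperiodic:
  assumes "continuous_on UNIV G" "\<And>t. G (t + pi) = - G t"
  shows "avg G = 0"
proof -
  have "((\<lambda>t. antider G (0 + t) + antider G (pi + t)) has_vector_derivative 0) (at t)" for t
    using has_vector_derivative_add[OF antider_shift_deriv(1)[OF assms(1), of 0 t] antider_shift_deriv(1)[OF assms(1), of pi t]]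
      assms(2)[of t] by (simp add: add.commute)
  from const_of_zero_vector_derivative[OF this, of 0 pi] show ?thesis
    by (simp add: avg_antider assms(1))
qed

text \<open>The substitution \<open>x = cos t\<close> turns orthogonality to cosines into
  orthogonality to polynomials on \<open>{-1..1}\<close>. By Stone-Weierstrass \<open>u\<close>
  minus its mean is then orthogonal to itself.\<close>

lemma cosine_complete:
  fixes u :: "real \<Rightarrow> real"
  assumes cont: "continuous_on {0..pi} u"
    and orth: "\<And>k. 0 < k \<Longrightarrow> integral {0..pi} (\<lambda>t. u t * cos (real k * t)) = 0"
  obtains c where "\<And>t. t \<in> {0..pi} \<Longrightarrow> u t = c"
proof -
  define c where "c = integral {0..pi} u / pi"
  define v where "v t = u t - c" for t
  have cv: "continuous_on {0..pi} v" unfolding v_def by (intro continuous_intros cont)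
  have int: "(\<lambda>t. v t * w t) integrable_on {0..pi}" if "continuous_on {0..pi} w" for w
    by (intro integrable_continuous_interval continuous_intros cv that)
  have v0: "integral {0..pi} (\<lambda>t. v t * cos (real j * t)) = 0" for j
  proof (cases "j = 0")
    case True
    then show ?thesis
      unfolding v_def by (simp add: integral_diff integrable_continuous_interval cont c_def)
  next
    case False
    have "((\<lambda>t. cos (real j * t)) has_integral (sin (real j * pi) / j - sin (real j * 0) / j)) {0..pi}"
      by (rule fundamental_theorem_of_calculus)
        (use False in \<open>auto intro!: derivative_eq_intros simp: has_real_derivative_iff_has_vector_derivative[symmetric]\<close>)
    then have "integral {0..pi} (\<lambda>t. cos (real j * t)) = 0" by (simp add: integral_unique)
    moreover have "(\<lambda>t. v t * cos (real j * t)) = (\<lambda>t. u t * cos (real j * t) - c * cos (real j * t))"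
      by (auto simp: v_def algebra_simps)
    ultimately show ?thesis
      using orth[of j] False
      by (simp add: integral_diff integrable_continuous_interval continuous_intros cont)
  qed
  have pow: "integral {0..pi} (\<lambda>t. v t * (cos (real j * t) * cos t ^ n)) = 0" for n j
  proof (induction n arbitrary: j)
    case 0 then show ?case using v0 by simp
  next
    case (Suc n)
    \<comment> \<open>The lower neighbour of \<open>j = 0\<close> would be -1; as cosine is even, 1
      takes its place.\<close>
    define i where "i = (if j = 0 then 1 else j - 1)"
    have i: "cos (real i * t) = cos (real j * t - t)" for t
    proof (cases "j = 0")
      case False
      then have "real i * t = real j * t - t" by (simp add: i_def of_nat_diff left_diff_distrib)
      then show ?thesis by simp
    qed (simp add: i_def)
    have "(\<lambda>t. v t * (cos (real j * t) * cos t ^ Suc n)) =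
        (\<lambda>t. 1/2 * (v t * (cos (real (Suc j) * t) * cos t ^ n)) + 1/2 * (v t * (cos (real i * t) * cos t ^ n)))"
    proof
      fix t
      have "cos (real j * t) * cos t = 1/2 * cos (real (Suc j) * t) + 1/2 * cos (real i * t)"
        unfolding i cos_times_cos by (simp add: algebra_simps)
      then have "v t * (cos t ^ n * (cos (real j * t) * cos t)) =
          v t * (cos t ^ n * (1/2 * cos (real (Suc j) * t) + 1/2 * cos (real i * t)))" by simp
      then show "v t * (cos (real j * t) * cos t ^ Suc n) =
          1/2 * (v t * (cos (real (Suc j) * t) * cos t ^ n)) + 1/2 * (v t * (cos (real i * t) * cos t ^ n))"
        by (simp add: algebra_simps)
    qed
    then show ?case
      using Suc.IH[of "Suc j"] Suc.IH[of i]
      by (simp only: integral_add integral_mult_right int continuous_intros integrable_on_mult_right, simp?)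
  qed
  have poly: "integral {0..pi} (\<lambda>t. v t * q (cos t)) = 0" if q: "real_polynomial_function q" for q
  proof -
    obtain a n where qa: "q = (\<lambda>x. \<Sum>i\<le>n. a i * x ^ i)"
      using q real_polynomial_function_iff_sum by blast
    have "(\<lambda>t. v t * q (cos t)) = (\<lambda>t. \<Sum>i\<le>n. a i * (v t * (cos (real 0 * t) * cos t ^ i)))"
      by (auto simp: qa sum_distrib_left mult_ac)
    then show ?thesis
      by (simp only: integral_sum[OF finite_atMost] integral_mult_right pow int continuous_intros integrable_on_mult_right) simp
  qed
  have sq: "integral {0..pi} (\<lambda>t. v t * v t) = 0"
  proof -
    have "bounded (v ` {0..pi})"
      by (rule compact_imp_bounded[OF compact_continuous_image[OF cv compact_Icc]])
    then obtain B where "0 < B" "\<forall>y\<in>v ` {0..pi}. norm y \<le> B"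
      unfolding bounded_pos by blast
    then have B: "\<bar>v t\<bar> \<le> B" if "t \<in> {0..pi}" for t
      using that by simp
    have "\<bar>integral {0..pi} (\<lambda>t. v t * v t)\<bar> \<le> 0 + e" if e: "0 < e" for e
    proof -
      define d where "d = e / (pi * B)"
      have d: "0 < d" using e \<open>0 < B\<close> by (simp add: d_def)
      have "continuous_on {-1..1} (\<lambda>x. v (arccos x))"
        by (rule continuous_on_compose2[OF cv continuous_on_arccos'])
          (auto simp: arccos_lbound arccos_ubound)
      then obtain q where q: "real_polynomial_function q" "\<And>x. x \<in> {-1..1} \<Longrightarrow> \<bar>v (arccos x) - q x\<bar> < d"
        using Stone_Weierstrass_real_polynomial_function[of "{-1..1}" "\<lambda>x. v (arccos x)" d] d by auto
      have cq: "continuous_on {0..pi} (\<lambda>t. q (cos t))"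
        using q(1) unfolding real_polynomial_function_iff_sum by (auto intro!: continuous_intros)
      have "integral {0..pi} (\<lambda>t. v t * v t) = integral {0..pi} (\<lambda>t. v t * (v t - q (cos t)))"
        using poly[OF q(1)] by (simp add: right_diff_distrib integral_diff int cv cq)
      also have "norm \<dots> \<le> (B * d) * (pi - 0)"
      proof (rule integral_bound)
        show "continuous_on {0..pi} (\<lambda>t. v t * (v t - q (cos t)))"
          by (intro continuous_intros cv cq)
        show "norm (v t * (v t - q (cos t))) \<le> B * d" if "t \<in> {0..pi}" for t
          unfolding norm_mult using B[OF that] q(2)[of "cos t"] that \<open>0 < B\<close>
          by (intro mult_mono) (auto simp: arccos_cos)
      qed simp
      also have "\<dots> = e" using \<open>0 < B\<close> by (simp add: d_def)
      finally show ?thesis by simp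
    qed
    then have "\<bar>integral {0..pi} (\<lambda>t. v t * v t)\<bar> \<le> 0" by (rule field_le_epsilon)
    then show ?thesis by simp
  qed
  have "\<forall>t\<in>{0..pi}. v t * v t = 0"
    using integral_eq_0_iff[of 0 pi "\<lambda>t. v t * v t"] sq
    by (simp add: continuous_intros cv)
  then show thesis by (intro that[of c]) (simp add: v_def)
qed

text \<open>The symmetries shared by all functions \<open>\<Sum> h k *\<^sub>R emode k t\<close>.\<close>

definition mode_symmetric :: "(real \<Rightarrow> complex) \<Rightarrow> bool" where
  "mode_symmetric F \<longleftrightarrow> continuous_on UNIV F \<and> (\<forall>t. F (- t) = F t) \<and> (\<forall>t. F (t + pi) = cnj (F t))"

definition fcoef :: "(real \<Rightarrow> complex) \<Rightarrow> nat \<Rightarrow> real" where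
  "fcoef F k = avg (\<lambda>t. F t \<bullet> emode k t)"

lemma mode_symmetricD:
  assumes "mode_symmetric F"
  shows "continuous_on A F" "F (- t) = F t" "F (t + pi) = cnj (F t)" "F (t + 2 * pi) = F t"
    "F (2 * pi + t) = F t" "F (2 * pi - t) = F t"
proof -
  show "continuous_on A F"
    using assms continuous_on_subset[of UNIV F A] by (simp add: mode_symmetric_def)
  have *: "F (- t) = F t" "F (t + pi) = cnj (F t)" for t
    using assms by (simp_all add: mode_symmetric_def)
  then show "F (- t) = F t" "F (t + pi) = cnj (F t)" by blast+
  have **: "F (t + 2 * pi) = F t" for t
    using *(2)[of "t + pi"] *(2)[of t] by (simp add: add.assoc)
  then show "F (t + 2 * pi) = F t" by blast
  show "F (2 * pi + t) = F t" using **[of t] by (simp add: add.commute)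
  show "F (2 * pi - t) = F t" using **[of "- t"] *(1)[of t] by simp
qed

lemma cos_shift_pi: "cos (real k * (t + pi)) = (if even k then cos (real k * t) else - cos (real k * t))"
proof -
  have "cos (real k * (t + pi)) = cos (real k * t + real k * pi)" by (simp add: distrib_left)
  then show ?thesis by (auto simp: cos_add)
qed

lemma emode_minus: "emode k (- t) = emode k t"
  by (simp add: emode_def)

lemma emode_shift_pi: "emode k (t + pi) = cnj (emode k t)"
  unfolding emode_def cos_shift_pi by simp

lemma emode_symmetric: "mode_symmetric (emode k)"
  by (simp add: mode_symmetric_def continuous_emode emode_minus emode_shift_pi)

text \<open>Reflection at \<open>pi\<close> folds the period onto \<open>{0..pi}\<close>. When the
  parity of \<open>k\<close> does not match the coordinate, the integrand changes sign under the
  shift by \<open>pi\<close> and averages to 0.\<close>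

lemma half_integral_Re_Im:
  assumes F: "mode_symmetric F"
  shows "integral {0..pi} (\<lambda>t. Re (F t) * cos (real k * t)) = (if even k then pi / 2 * fcoef F k else 0)"
    and "integral {0..pi} (\<lambda>t. Im (F t) * cos (real k * t)) = (if even k then 0 else pi / 2 * fcoef F k)"
proof -
  have c: "cos (real k * (2 * pi - t)) = cos (real k * t)" for t
    using cos_shift_pi[of k "pi - t"] cos_shift_pi[of k "- t"] by (simp add: algebra_simps split: if_splits)
  have cont: "continuous_on UNIV (\<lambda>t. Re (F t) * cos (real k * t))" "continuous_on UNIV (\<lambda>t. Im (F t) * cos (real k * t))"
    by (intro continuous_intros mode_symmetricD(1)[OF F])+
  have 1: "integral {0..pi} (\<lambda>t. Re (F t) * cos (real k * t)) = pi / 2 * avg (\<lambda>t. Re (F t) * cos (real k * t))"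
    by (subst avg_half[OF cont(1)]) (simp_all add: c mode_symmetricD[OF F])
  have 2: "integral {0..pi} (\<lambda>t. Im (F t) * cos (real k * t)) = pi / 2 * avg (\<lambda>t. Im (F t) * cos (real k * t))"
    by (subst avg_half[OF cont(2)]) (simp_all add: c mode_symmetricD[OF F])
  have 3: "avg (\<lambda>t. Re (F t) * cos (real k * t)) = (if even k then fcoef F k else 0)"
  proof (cases "even k")
    case False
    have "avg (\<lambda>t. Re (F t) * cos (real k * t)) = 0"
      by (rule avg_antiperiodic[OF cont(1)]) (simp only: mode_symmetricD(3)[OF F] cos_shift_pi if_False False, simp)
    with False show ?thesis by simp
  qed (simp add: fcoef_def emode_def inner_complex_def)
  have 4: "avg (\<lambda>t. Im (F t) * cos (real k * t)) = (if even k then 0 else fcoef F k)"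
  proof (cases "even k")
    case True
    have "avg (\<lambda>t. Im (F t) * cos (real k * t)) = 0"
      by (rule avg_antiperiodic[OF cont(2)]) (simp only: mode_symmetricD(3)[OF F] cos_shift_pi if_True True, simp)
    with True show ?thesis by simp
  qed (simp add: fcoef_def emode_def inner_complex_def)
  show "integral {0..pi} (\<lambda>t. Re (F t) * cos (real k * t)) = (if even k then pi / 2 * fcoef F k else 0)"
    "integral {0..pi} (\<lambda>t. Im (F t) * cos (real k * t)) = (if even k then 0 else pi / 2 * fcoef F k)"
    unfolding 1 2 3 4 by simp_all
qed

text \<open>Two integrations by parts: at both ends one boundary term contains a vanishing sine, the
  other a vanishing \<open>F1\<close>.\<close>

lemma integral_second_antider_cos:
  fixes F F1 F2 :: "real \<Rightarrow> real"
  assumes k: "0 < k" and F: "continuous_on UNIV F"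
    and d1: "\<And>t. (F1 has_vector_derivative F t) (at t)" and d2: "\<And>t. (F2 has_vector_derivative F1 t) (at t)"
    and zero: "F1 0 = 0" "F1 pi = 0"
  shows "integral {0..pi} (\<lambda>t. F2 t * cos (real k * t)) = - integral {0..pi} (\<lambda>t. F t * cos (real k * t)) / (real k)\<^sup>2"
proof -
  have c2: "continuous_on {0..pi} F2"
    by (rule continuous_on_vector_derivative) (rule has_vector_derivative_at_within[OF d2])
  have d: "((\<lambda>t. F2 t * sin (real k * t) / k + F1 t * cos (real k * t) / (real k)\<^sup>2) has_vector_derivative
      (F2 t * cos (real k * t) + F t * cos (real k * t) / (real k)\<^sup>2)) (at t within {0..pi})" for t
  proof -
    have D1: "(F1 has_real_derivative F t) (at t within {0..pi})" "(F2 has_real_derivative F1 t) (at t within {0..pi})"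
      by (simp_all add: has_real_derivative_iff_has_vector_derivative has_vector_derivative_at_within d1 d2)
    show ?thesis
      unfolding has_real_derivative_iff_has_vector_derivative[symmetric]
      by (rule derivative_eq_intros D1 refl | use k in \<open>simp add: field_simps power2_eq_square\<close>)+
  qed
  have "((\<lambda>t. F2 t * cos (real k * t) + F t * cos (real k * t) / (real k)\<^sup>2) has_integral 0) {0..pi}"
    using fundamental_theorem_of_calculus[of 0 pi, OF _ d] zero by simp
  then have "integral {0..pi} (\<lambda>t. F2 t * cos (real k * t) + F t * cos (real k * t) / (real k)\<^sup>2) = 0"
    by (rule integral_unique)
  moreover have "integral {0..pi} (\<lambda>t. F2 t * cos (real k * t) + F t * cos (real k * t) / (real k)\<^sup>2) =
      integral {0..pi} (\<lambda>t. F2 t * cos (real k * t)) + integral {0..pi} (\<lambda>t. F t * cos (real k * t)) / (real k)\<^sup>2"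
    by (subst integral_add) (use k in \<open>auto intro!: integrable_continuous_interval continuous_intros c2 continuous_on_subset[OF F]\<close>)
  ultimately show ?thesis by simp
qed

text \<open>Regularity without differentiating a series: \<eta> and minus the second antiderivative
  of \<open>p\<close> share all cosine coefficients with \<open>k > 0\<close>, so they differ by a
  constant.\<close>

theorem fourier_second_order:
  assumes \<eta>: "mode_symmetric \<eta>" and p: "mode_symmetric p"
    and coef: "\<And>k. (real k)\<^sup>2 * fcoef \<eta> k = fcoef p k"
  obtains v where "\<And>t. (\<eta> has_vector_derivative v t) (at t)" "\<And>t. (v has_vector_derivative - p t) (at t)"
proof -
  define P1 where "P1 = antider p"
  define P2 where "P2 = antider P1"
  have cp: "continuous_on UNIV p" by (rule mode_symmetricD(1)[OF p])
  have cP1: "continuous_on UNIV P1" unfolding P1_def by (rule continuous_antider[OF cp])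
  have cP2: "continuous_on UNIV P2" unfolding P2_def by (rule continuous_antider[OF cP1])
  have dP1: "(P1 has_vector_derivative p t) (at t)" for t unfolding P1_def by (rule antider_deriv[OF cp])
  have dP2: "(P2 has_vector_derivative P1 t) (at t)" for t unfolding P2_def by (rule antider_deriv[OF cP1])
  \<comment> \<open>The hypothesis at \<open>k = 0\<close> says that the real part has mean zero;
    for the imaginary part the symmetry does. Hence \<open>P1\<close> vanishes at \<open>pi\<close>
    and is periodic.\<close>
  have int_p: "integral {0..pi} (\<lambda>t. Re (p t)) = 0" "integral {0..pi} (\<lambda>t. Im (p t)) = 0"
    using half_integral_Re_Im[OF p, of 0] coef[of 0] by simp_all
  have P1pi: "P1 pi = 0"
  proof -
    have "P1 pi = integral {0..pi} p" by (simp add: P1_def integral_antider[OF cp])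
    moreover have "p integrable_on {0..pi}"
      by (intro integrable_continuous_interval continuous_on_subset[OF cp]) auto
    ultimately show ?thesis
      using int_p integral_linear[OF _ bounded_linear_Re, of p "{0..pi}"] integral_linear[OF _ bounded_linear_Im, of p "{0..pi}"]
      by (simp add: complex_eq_iff o_def)
  qed
  have P1odd: "P1 (- t) = - P1 t" for t
    unfolding P1_def by (rule antider_odd_of_even[OF cp mode_symmetricD(2)[OF p]])
  have P2even: "P2 (- t) = P2 t" for t
    unfolding P2_def by (rule antider_even_of_odd[OF cP1 P1odd])
  have P1per: "P1 (2 * pi + t) = P1 t" for t
    using antider_periodic_diff[OF cp mode_symmetricD(5)[OF p], of t "- pi"] P1pi P1odd[of pi]
    by (simp flip: P1_def)
  have P2per: "P2 (2 * pi + t) = P2 t" for t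
    using antider_periodic_diff[OF cP1 P1per, of t "- pi"] P2even[of pi]
    by (simp flip: P2_def)
  define D where "D t = \<eta> t + P2 t" for t
  have cD: "continuous_on A D" for A
    unfolding D_def by (intro continuous_intros mode_symmetricD(1)[OF \<eta>] continuous_on_subset[OF cP2]) auto
  have orth: "integral {0..pi} (\<lambda>t. Re (D t) * cos (real k * t)) = 0"
    "integral {0..pi} (\<lambda>t. Im (D t) * cos (real k * t)) = 0" if k: "0 < k" for k
  proof -
    have R: "integral {0..pi} (\<lambda>t. Re (P2 t) * cos (real k * t)) =
        - integral {0..pi} (\<lambda>t. Re (p t) * cos (real k * t)) / (real k)\<^sup>2"
    proof (rule integral_second_antider_cos[OF k, where ?F1.0 = "\<lambda>t. Re (P1 t)"])
      show "continuous_on UNIV (\<lambda>t. Re (p t))" by (intro continuous_intros cp)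
      show "((\<lambda>t. Re (P1 t)) has_vector_derivative Re (p t)) (at t)" for t
        using bounded_linear.has_vector_derivative[OF bounded_linear_Re dP1] .
      show "((\<lambda>t. Re (P2 t)) has_vector_derivative Re (P1 t)) (at t)" for t
        using bounded_linear.has_vector_derivative[OF bounded_linear_Re dP2] .
    qed (simp_all add: P1pi, simp add: P1_def)
    have I: "integral {0..pi} (\<lambda>t. Im (P2 t) * cos (real k * t)) =
        - integral {0..pi} (\<lambda>t. Im (p t) * cos (real k * t)) / (real k)\<^sup>2"
    proof (rule integral_second_antider_cos[OF k, where ?F1.0 = "\<lambda>t. Im (P1 t)"])
      show "continuous_on UNIV (\<lambda>t. Im (p t))" by (intro continuous_intros cp)
      show "((\<lambda>t. Im (P1 t)) has_vector_derivative Im (p t)) (at t)" for t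
        using bounded_linear.has_vector_derivative[OF bounded_linear_Im dP1] .
      show "((\<lambda>t. Im (P2 t)) has_vector_derivative Im (P1 t)) (at t)" for t
        using bounded_linear.has_vector_derivative[OF bounded_linear_Im dP2] .
    qed (simp_all add: P1pi, simp add: P1_def)
    have cs: "continuous_on {0..pi} (\<lambda>t. Re (\<eta> t) * cos (real k * t))" "continuous_on {0..pi} (\<lambda>t. Im (\<eta> t) * cos (real k * t))"
      "continuous_on {0..pi} (\<lambda>t. Re (P2 t) * cos (real k * t))" "continuous_on {0..pi} (\<lambda>t. Im (P2 t) * cos (real k * t))"
      by (intro continuous_intros mode_symmetricD(1)[OF \<eta>] continuous_on_subset[OF cP2]; simp)+
    show "integral {0..pi} (\<lambda>t. Re (D t) * cos (real k * t)) = 0"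
    proof -
      have "integral {0..pi} (\<lambda>t. Re (D t) * cos (real k * t)) =
          integral {0..pi} (\<lambda>t. Re (\<eta> t) * cos (real k * t)) + integral {0..pi} (\<lambda>t. Re (P2 t) * cos (real k * t))"
        unfolding D_def by (simp add: distrib_right integral_add integrable_continuous_interval cs)
      then show ?thesis
        unfolding R half_integral_Re_Im(1)[OF \<eta>] half_integral_Re_Im(1)[OF p] coef[of k, symmetric]
        using k by auto
    qed
    show "integral {0..pi} (\<lambda>t. Im (D t) * cos (real k * t)) = 0"
    proof -
      have "integral {0..pi} (\<lambda>t. Im (D t) * cos (real k * t)) =
          integral {0..pi} (\<lambda>t. Im (\<eta> t) * cos (real k * t)) + integral {0..pi} (\<lambda>t. Im (P2 t) * cos (real k * t))"
        unfolding D_def by (simp add: distrib_right integral_add integrable_continuous_interval cs)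
      then show ?thesis
        unfolding I half_integral_Re_Im(2)[OF \<eta>] half_integral_Re_Im(2)[OF p] coef[of k, symmetric]
        using k by auto
    qed
  qed
  obtain a where a: "\<And>t. t \<in> {0..pi} \<Longrightarrow> Re (D t) = a"
    using cosine_complete[of "\<lambda>t. Re (D t)"] orth(1) cD continuous_on_Re by metis
  obtain b where b: "\<And>t. t \<in> {0..pi} \<Longrightarrow> Im (D t) = b"
    using cosine_complete[of "\<lambda>t. Im (D t)"] orth(2) cD continuous_on_Im by metis
  have D0: "D t = Complex a b" if "t \<in> {0..pi}" for t
    using a[OF that] b[OF that] by (simp add: complex_eq_iff)
  have Deven: "D (- t) = D t" for t
    by (simp add: D_def P2even mode_symmetricD(2)[OF \<eta>])
  have D1: "D t = Complex a b" if "t \<in> {-pi..pi}" for t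
    using D0[of t] D0[of "- t"] Deven[of t] that by (cases "t \<ge> 0") auto
  have Dper: "D (2 * pi + t) = D t" for t
    by (simp add: D_def P2per mode_symmetricD(5)[OF \<eta>])
  have Dn: "D (t + 2 * pi * real n) = D t" for t and n :: nat
  proof (induction n)
    case (Suc n)
    then show ?case using Dper[of "t + 2 * pi * real n"] by (simp add: algebra_simps)
  qed simp
  have Dz: "D (t + 2 * pi * real_of_int n) = D t" for t and n :: int
  proof (cases "n \<ge> 0")
    case True
    then show ?thesis using Dn[of t "nat n"] by simp
  next
    case False
    then show ?thesis using Dn[of "t + 2 * pi * real_of_int n" "nat (- n)"] by (simp add: algebra_simps)
  qed
  have D: "D t = Complex a b" for t
  proof -
    define n where "n = \<lfloor>(t + pi) / (2 * pi)\<rfloor>"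
    have "real_of_int n \<le> (t + pi) / (2 * pi)" "(t + pi) / (2 * pi) < real_of_int n + 1"
      unfolding n_def by linarith+
    then have "t + 2 * pi * real_of_int (- n) \<in> {-pi..pi}"
      by (simp add: field_simps)
    from D1[OF this] Dz[of t "- n"] show ?thesis by simp
  qed
  have "\<eta> = (\<lambda>t. Complex a b - P2 t)"
    using D by (auto simp: D_def fun_eq_iff eq_diff_eq)
  then have "(\<eta> has_vector_derivative - P1 t) (at t)" for t
    using has_vector_derivative_diff[OF has_vector_derivative_const dP2, of "Complex a b" t] by simp
  moreover have "((\<lambda>t. - P1 t) has_vector_derivative - p t) (at t)" for t
    by (rule has_vector_derivative_minus[OF dP1])
  ultimately show thesis by (rule that)
qed

section \<open>The equation of motion\<close>


definition kf :: "complex \<Rightarrow> complex" where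
  "kf z = (1 / norm z ^ 3) *\<^sub>R z"

lemma kf_cnj: "kf (cnj z) = cnj (kf z)"
  by (simp add: kf_def)

lemma kf_minus: "kf (- z) = - kf z"
  by (simp add: kf_def)

lemma norm_kf: "norm (kf z) = 1 / (norm z)\<^sup>2"
  by (simp add: kf_def power2_eq_square power3_eq_cube)

lemma cos_third:
  fixes k :: nat
  shows "2 * cos (real k * (2 * pi / 3)) = (if 3 dvd k then 2 else - 1)"
proof -
  define j r where "j = k div 3" and "r = k mod 3"
  have k: "k = 3 * j + r" by (simp add: j_def r_def)
  have "cos (real k * (2 * pi / 3)) = cos (2 * real r * pi / 3 + 2 * real j * pi)"
    by (rule arg_cong[where f = cos]) (simp add: k field_simps)
  also have "\<dots> = cos (2 * real r * pi / 3)"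
    by (simp only: cos_add cos_2npi sin_2npi mult_1_right mult_zero_right diff_zero)
  finally have c: "cos (real k * (2 * pi / 3)) = cos (2 * real r * pi / 3)" .
  have "r = 0 \<or> r = 1 \<or> r = 2" unfolding r_def by linarith
  moreover have "3 dvd k \<longleftrightarrow> r = 0" by (simp add: r_def dvd_eq_mod_eq_0)
  moreover have "cos (2 * pi / 3) = - 1 / 2" using cos_120 by simp
  moreover have "cos (4 * pi / 3) = - 1 / 2"
  proof -
    have "cos (4 * pi / 3) = cos (pi + pi / 3)" by (rule arg_cong[where f = cos]) simp
    then show ?thesis unfolding cos_add by (simp add: cos_60)
  qed
  ultimately show ?thesis unfolding c by auto
qed

lemma emode_shifts:
  "emode k (t + 2 * pi / 3) + emode k (t - 2 * pi / 3) = (if 3 dvd k then 2 else - 1) *\<^sub>R emode k t"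
proof -
  have "cos (real k * (t + 2 * pi / 3)) + cos (real k * (t - 2 * pi / 3)) =
      2 * cos (real k * (2 * pi / 3)) * cos (real k * t)"
    by (simp add: distrib_left right_diff_distrib cos_add cos_diff)
  then have "cos (real k * (t + 2 * pi / 3)) + cos (real k * (t - 2 * pi / 3)) =
      (if 3 dvd k then 2 else - 1) * cos (real k * t)"
    unfolding cos_third .
  then show ?thesis
    by (simp add: emode_def complex_eq_iff split del: if_split) (auto simp: complex_eq_iff)
qed

text \<open>Averaging over the three shifts projects onto the harmonics divisible by 3, by summation
  of third roots of unity; \<open>g - mean3 g\<close> is P applied to \<open>g\<close>.\<close>

definition mean3 :: "(real \<Rightarrow> complex) \<Rightarrow> real \<Rightarrow> complex" where
  "mean3 g t = (1/3) *\<^sub>R (g t + g (t + 2 * pi / 3) + g (t - 2 * pi / 3))"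

lemma mode_symmetric_sub_mean3:
  assumes g: "mode_symmetric g"
  shows "mode_symmetric (\<lambda>t. g t - mean3 g t)"
    and "fcoef (\<lambda>t. g t - mean3 g t) k = (if 3 dvd k then 0 else fcoef g k)"
proof -
  have cs: "continuous_on A (\<lambda>t. g (t + c))" for A c
    by (rule continuous_on_compose2[OF mode_symmetricD(1)[OF g, of UNIV]]) (auto intro!: continuous_intros)
  have cs': "continuous_on A (\<lambda>t. g (t - c))" for A c using cs[of A "- c"] by simp
  note c = mode_symmetricD(1)[OF g] cs cs'
  show "mode_symmetric (\<lambda>t. g t - mean3 g t)"
    unfolding mode_symmetric_def
  proof (intro conjI allI)
    show "continuous_on UNIV (\<lambda>t. g t - mean3 g t)"
      unfolding mean3_def by (intro continuous_intros c)
    fix t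
    have "g (- t + 2 * pi / 3) = g (t - 2 * pi / 3)" "g (- t - 2 * pi / 3) = g (t + 2 * pi / 3)"
      using mode_symmetricD(2)[OF g, of "t - 2 * pi / 3"] mode_symmetricD(2)[OF g, of "t + 2 * pi / 3"] by simp_all
    then show "g (- t) - mean3 g (- t) = g t - mean3 g t"
      by (simp add: mean3_def mode_symmetricD(2)[OF g] add_ac)
    have "g (t + pi + 2 * pi / 3) = cnj (g (t + 2 * pi / 3))" "g (t + pi - 2 * pi / 3) = cnj (g (t - 2 * pi / 3))"
      using mode_symmetricD(3)[OF g, of "t + 2 * pi / 3"] mode_symmetricD(3)[OF g, of "t - 2 * pi / 3"]
      by (simp_all add: algebra_simps)
    then show "g (t + pi) - mean3 g (t + pi) = cnj (g t - mean3 g t)"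
      by (simp add: mean3_def mode_symmetricD(3)[OF g])
  qed
  have shift: "avg (\<lambda>t. g (t + c) \<bullet> emode k t) = avg (\<lambda>t. g t \<bullet> emode k (t - c))" for c
  proof -
    have "avg (\<lambda>t. g (t + c) \<bullet> emode k (t + c - c)) = avg (\<lambda>t. g t \<bullet> emode k (t - c))"
    proof (rule avg_shift)
      show "continuous_on UNIV (\<lambda>t. g t \<bullet> emode k (t - c))"
        by (intro continuous_intros c continuous_on_compose2[OF continuous_emode[of UNIV]]) auto
      show "g (t + 2 * pi) \<bullet> emode k (t + 2 * pi - c) = g t \<bullet> emode k (t - c)" for t
        using mode_symmetricD(4)[OF emode_symmetric, of k "t - c"] mode_symmetricD(4)[OF g]
        by (simp add: algebra_simps)
    qed
    then show ?thesis by simp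
  qed
  have ce: "continuous_on UNIV (\<lambda>t. g t \<bullet> emode k t)" "continuous_on UNIV (\<lambda>t. g (t + c) \<bullet> emode k t)"
    "continuous_on UNIV (\<lambda>t. g t \<bullet> emode k (t + c))" "continuous_on UNIV (\<lambda>t. g t \<bullet> emode k (t - c))" for c
    by (intro continuous_intros c continuous_on_compose2[OF continuous_emode[of UNIV]]; simp)+
  define c where "c = (if 3 dvd k then 2 else - 1 :: real)"
  have "avg (\<lambda>t. g (t + 2 * pi / 3) \<bullet> emode k t) + avg (\<lambda>t. g (t - 2 * pi / 3) \<bullet> emode k t) =
      avg (\<lambda>t. g t \<bullet> emode k (t - 2 * pi / 3)) + avg (\<lambda>t. g t \<bullet> emode k (t + 2 * pi / 3))"
    using shift[of "2 * pi / 3"] shift[of "- (2 * pi / 3)"] by simp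
  also have "\<dots> = avg (\<lambda>t. g t \<bullet> emode k (t - 2 * pi / 3) + g t \<bullet> emode k (t + 2 * pi / 3))"
    by (subst avg_add) (simp_all add: ce)
  also have "\<dots> = avg (\<lambda>t. c * (g t \<bullet> emode k t))"
    unfolding inner_add_right[symmetric] add.commute[of "emode k (_ - _)"] emode_shifts by (simp add: c_def)
  also have "\<dots> = c * fcoef g k" by (simp add: avg_cmult fcoef_def)
  finally have s: "avg (\<lambda>t. g (t + 2 * pi / 3) \<bullet> emode k t) + avg (\<lambda>t. g (t - 2 * pi / 3) \<bullet> emode k t) = c * fcoef g k" .
  have "fcoef (\<lambda>t. g t - mean3 g t) k = avg (\<lambda>t. 2/3 * (g t \<bullet> emode k t)
      - 1/3 * (g (t + 2 * pi / 3) \<bullet> emode k t + g (t - 2 * pi / 3) \<bullet> emode k t))"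
    unfolding fcoef_def mean3_def by (simp add: inner_diff_left inner_add_left algebra_simps)
  also have "\<dots> = 2/3 * fcoef g k - 1/3 * (c * fcoef g k)"
  proof -
    have cs: "continuous_on UNIV (\<lambda>t. g (t + 2 * pi / 3) \<bullet> emode k t)"
      "continuous_on UNIV (\<lambda>t. g (t - 2 * pi / 3) \<bullet> emode k t)"
      using ce(2)[of "2 * pi / 3"] ce(2)[of "- (2 * pi / 3)"] by simp_all
    show ?thesis
      by (simp only: avg_diff avg_cmult avg_add cs ce(1) continuous_intros fcoef_def s[unfolded fcoef_def])
  qed
  finally show "fcoef (\<lambda>t. g t - mean3 g t) k = (if 3 dvd k then 0 else fcoef g k)"
    by (auto simp: c_def)
qed

lemma ser_symmetric:
  assumes h: "summable (\<lambda>k. \<bar>h k\<bar>)"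
  shows "mode_symmetric (ser h)"
  unfolding mode_symmetric_def
proof (intro conjI allI)
  show "continuous_on UNIV (ser h)" by (rule continuous_ser[OF h])
  fix t
  show "ser h (- t) = ser h t" by (simp add: ser_def emode_minus)
  have "cnj (ser h t) = (\<Sum>k. cnj (h k *\<^sub>R emode k t))"
    unfolding ser_def by (rule bounded_linear.suminf[OF bounded_linear_cnj summable_ser[OF h]])
  then show "ser h (t + pi) = cnj (ser h t)" by (simp add: ser_def emode_shift_pi)
qed

text \<open>The three shifts will be the sides of the triangle of bodies, which has to close up; the
  absent harmonics guarantee this.\<close>

lemma ser_shift_sum:
  assumes h: "summable (\<lambda>k. \<bar>h k\<bar>)" "\<And>k. 3 dvd k \<Longrightarrow> h k = 0"
  shows "ser h t + ser h (t + 2 * pi / 3) + ser h (t - 2 * pi / 3) = 0"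
proof -
  have "ser h t + ser h (t + 2 * pi / 3) + ser h (t - 2 * pi / 3) =
      (\<Sum>k. h k *\<^sub>R emode k t + h k *\<^sub>R emode k (t + 2 * pi / 3) + h k *\<^sub>R emode k (t - 2 * pi / 3))"
    unfolding ser_def by (simp add: suminf_add summable_ser[OF h(1)] summable_add)
  also have "(\<lambda>k. h k *\<^sub>R emode k t + h k *\<^sub>R emode k (t + 2 * pi / 3) + h k *\<^sub>R emode k (t - 2 * pi / 3)) = (\<lambda>k. 0)"
  proof
    fix k
    have "h k *\<^sub>R emode k t + h k *\<^sub>R emode k (t + 2 * pi / 3) + h k *\<^sub>R emode k (t - 2 * pi / 3) =
        h k *\<^sub>R (emode k t + (emode k (t + 2 * pi / 3) + emode k (t - 2 * pi / 3)))"
      by (simp add: scaleR_add_right)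
    then show "h k *\<^sub>R emode k t + h k *\<^sub>R emode k (t + 2 * pi / 3) + h k *\<^sub>R emode k (t - 2 * pi / 3) = 0"
      unfolding emode_shifts using h(2)[of k] by auto
  qed
  finally show ?thesis by simp
qed

lemma eta_exists:
  obtains \<eta> v where "mode_symmetric \<eta>" "\<And>t. norm (\<eta> t - z0 t) \<le> 26/1000" "\<And>t. 44/100 \<le> norm (\<eta> t)"
    "\<And>t. \<eta> t + \<eta> (t + 2 * pi / 3) + \<eta> (t - 2 * pi / 3) = 0"
    "\<And>t. (\<eta> has_vector_derivative v t) (at t)"
    "\<And>t. (v has_vector_derivative - (kf (\<eta> t) - mean3 (\<lambda>t. kf (\<eta> t)) t)) (at t)"
proof -
  obtain h where h: "h \<in> ball0" and min: "\<And>g. g \<in> ball0 \<Longrightarrow> energy h \<le> energy g"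
    using energy_minimizer by blast
  define b where "b k = a0 k + h k" for k
  define \<eta> where "\<eta> = ser b"
  have sh: "summable (\<lambda>k. \<bar>h k\<bar>)" by (rule summable_ball0[OF h])
  have sb: "summable (\<lambda>k. \<bar>b k\<bar>)"
    by (rule summable_comparison_test'[OF summable_add[OF summable_a0 sh]]) (simp add: b_def)
  have b0: "b k = 0" if "3 dvd k" for k
  proof -
    have "k \<notin> amp_modes" using that by (auto simp: amp_modes_def)
    then show ?thesis using hball_zero_mult_3[OF h that] by (simp add: b_def a0_eq_0)
  qed
  have \<eta>: "\<eta> t = z0 t + ser h t" for t
    unfolding \<eta>_def z0_def b_def by (rule ser_add[OF summable_a0 sh])
  have sym: "mode_symmetric \<eta>" unfolding \<eta>_def by (rule ser_symmetric[OF sb])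
  have ge: "44/100 \<le> norm (\<eta> t)" for t unfolding \<eta> by (rule norm_eta_ge[OF h])
  have ne: "norm (\<eta> t) \<noteq> 0" for t using ge[of t] by linarith
  define g where "g t = kf (\<eta> t)" for t
  have g: "mode_symmetric g"
    unfolding mode_symmetric_def g_def
    by (auto simp: mode_symmetricD(2,3)[OF sym] kf_cnj)
      (use ne in \<open>auto simp: kf_def intro!: continuous_intros mode_symmetricD(1)[OF sym]\<close>)
  have coef: "(real k)\<^sup>2 * fcoef \<eta> k = fcoef (\<lambda>t. g t - mean3 g t) k" for k
  proof -
    have "fcoef \<eta> k = b k"
      using avg_ser_emode[OF sb b0[of 0], of k] by (simp add: fcoef_def \<eta>_def inner_commute)
    moreover have "(real k)\<^sup>2 * b k = fcoef g k" if "\<not> 3 dvd k"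
      using euler_lagrange[OF h min that]
      by (simp add: fcoef_def g_def kf_def b_def flip: \<eta>)
    ultimately show ?thesis
      unfolding mode_symmetric_sub_mean3(2)[OF g] using b0[of k] by auto
  qed
  obtain v where v: "\<And>t. (\<eta> has_vector_derivative v t) (at t)"
    "\<And>t. (v has_vector_derivative - (g t - mean3 g t)) (at t)"
    using fourier_second_order[OF sym mode_symmetric_sub_mean3(1)[OF g] coef] by metis
  show thesis
  proof (rule that[of \<eta> v])
    show "norm (\<eta> t - z0 t) \<le> 26/1000" for t
      unfolding \<eta> using norm_ser_ball0[OF h] by simp
    show "\<eta> t + \<eta> (t + 2 * pi / 3) + \<eta> (t - 2 * pi / 3) = 0" for t
      unfolding \<eta>_def by (rule ser_shift_sum[OF sb b0])
    show "(v has_vector_derivative - (kf (\<eta> t) - mean3 (\<lambda>t. kf (\<eta> t)) t)) (at t)" for t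
      using v(2)[of t] by (simp add: g_def[abs_def])
  qed (rule sym ge v)+
qed

section \<open>From the differences back to a single body\<close>

lemma has_vector_derivative_shifted:
  assumes "\<And>t. (f has_vector_derivative f' t) (at t)"
  shows "((\<lambda>t. f (t + c)) has_vector_derivative f' (t + c)) (at t)"
    and "((\<lambda>t. f (t - c)) has_vector_derivative f' (t - c)) (at t)"
proof -
  have d: "((\<lambda>t. t + c) has_vector_derivative 1) (at t)" "((\<lambda>t. t - c) has_vector_derivative 1) (at t)"
    by (auto intro!: derivative_eq_intros)
  show "((\<lambda>t. f (t + c)) has_vector_derivative f' (t + c)) (at t)"
    "((\<lambda>t. f (t - c)) has_vector_derivative f' (t - c)) (at t)"
    using vector_diff_chain_at[OF d(1) assms] vector_diff_chain_at[OF d(2) assms] by (simp_all add: o_def)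
qed

definition gamma0 :: "real \<Rightarrow> complex" where
  "gamma0 t = (1/3) *\<^sub>R (z0 (t - pi / 3) - z0 (t + pi / 3))"

text \<open>Collects what the shape and the equation of motion require, detached from the
  construction. The estimates that follow compare with the explicit \<open>gamma0\<close> and
  \<open>z0\<close>.\<close>

locale eight_solution =
  fixes \<gamma> w \<eta> :: "real \<Rightarrow> complex"
  assumes d1: "\<And>t. (\<gamma> has_vector_derivative w t) (at t)"
    and d2: "\<And>t. (w has_vector_derivative (1/3) *\<^sub>R (kf (\<eta> (t + pi / 3)) - kf (\<eta> (t - pi / 3)))) (at t)"
    and next_body: "\<And>t. \<gamma> (t + 2 * pi / 3) - \<gamma> t = \<eta> (t + pi / 3)"
    and prev_body: "\<And>t. \<gamma> (t - 2 * pi / 3) - \<gamma> t = - \<eta> (t - pi / 3)"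
    and shift_pi: "\<And>t. \<gamma> (t + pi) = cnj (\<gamma> t)"
    and odd: "\<And>t. \<gamma> (- t) = - \<gamma> t"
    and periodic: "\<And>t. \<gamma> (t + 2 * pi) = \<gamma> t"
    and close: "\<And>t. norm (\<gamma> t - gamma0 t) \<le> 52/3000"
    and ge: "\<And>t. 44/100 \<le> norm (\<eta> t)"
    and eta_close: "\<And>t. norm (\<eta> t - z0 t) \<le> 26/1000"
    and eta_sym: "mode_symmetric \<eta>"

text \<open>With the centre of mass at the origin, three times a position is the sum of its
  differences to the two other bodies; this dictates \<gamma>.\<close>

theorem gamma_exists:
  obtains \<gamma> w \<eta> where "eight_solution \<gamma> w \<eta>"
proof -
  obtain \<eta> v where sym: "mode_symmetric \<eta>" and close: "\<And>t. norm (\<eta> t - z0 t) \<le> 26/1000"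
    and ge: "\<And>t. 44/100 \<le> norm (\<eta> t)"
    and sum0: "\<And>t. \<eta> t + \<eta> (t + 2 * pi / 3) + \<eta> (t - 2 * pi / 3) = 0"
    and d1: "\<And>t. (\<eta> has_vector_derivative v t) (at t)"
    and d2: "\<And>t. (v has_vector_derivative - (kf (\<eta> t) - mean3 (\<lambda>t. kf (\<eta> t)) t)) (at t)"
    using eta_exists by blast
  define \<gamma> where "\<gamma> t = (1/3) *\<^sub>R (\<eta> (t - pi / 3) - \<eta> (t + pi / 3))" for t
  define w where "w t = (1/3) *\<^sub>R (v (t - pi / 3) - v (t + pi / 3))" for t
  note D = mode_symmetricD[OF sym]
  have s3: "\<eta> (t + pi / 3) + \<eta> (t + pi) + \<eta> (t - pi / 3) = 0" for t
  proof -
    have "t + pi / 3 + 2 * pi / 3 = t + pi" "t + pi / 3 - 2 * pi / 3 = t - pi / 3" by simp_all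
    then show ?thesis using sum0[of "t + pi / 3"] by metis
  qed
  have diff: "\<gamma> (t + 2 * pi / 3) - \<gamma> t = \<eta> (t + pi / 3)" for t
  proof -
    have a: "t + 2 * pi / 3 - pi / 3 = t + pi / 3" "t + 2 * pi / 3 + pi / 3 = t + pi" by simp_all
    have "\<gamma> (t + 2 * pi / 3) - \<gamma> t =
        (1/3) *\<^sub>R (\<eta> (t + pi / 3) + \<eta> (t + pi / 3) - (\<eta> (t + pi) + \<eta> (t - pi / 3)))"
      unfolding \<gamma>_def a by (simp add: scaleR_diff_right[symmetric] del: scaleR_diff_right)
    also have "\<eta> (t + pi) + \<eta> (t - pi / 3) = - \<eta> (t + pi / 3)"
      using s3[of t] by (simp add: add_eq_0_iff2 add.assoc eq_neg_iff_add_eq_0 add.commute)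
    finally show ?thesis by (simp add: scaleR_conv_of_real)
  qed
  have diff': "\<gamma> (t - 2 * pi / 3) - \<gamma> t = - \<eta> (t - pi / 3)" for t
    using diff[of "t - 2 * pi / 3"] by (simp add: field_simps)
  \<comment> \<open>The two arguments differ by \<open>2 * pi / 3\<close>, a period of
    \<open>mean3\<close>, so the projection term drops out of the acceleration of \<gamma>.\<close>
  have mean: "mean3 (\<lambda>t. kf (\<eta> t)) (t - pi / 3) = mean3 (\<lambda>t. kf (\<eta> t)) (t + pi / 3)" for t
  proof -
    have a: "t - pi / 3 + 2 * pi / 3 = t + pi / 3" "t - pi / 3 - 2 * pi / 3 = t - pi"
      "t + pi / 3 + 2 * pi / 3 = t + pi" "t + pi / 3 - 2 * pi / 3 = t - pi / 3" by simp_all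
    have "\<eta> (t + pi) = \<eta> (t - pi)" using D(4)[of "t - pi"] by (simp add: add.commute)
    then show ?thesis unfolding mean3_def a by (simp add: add_ac)
  qed
  have "eight_solution \<gamma> w \<eta>"
  proof
    show "(\<gamma> has_vector_derivative w t) (at t)" for t
      unfolding \<gamma>_def[abs_def] w_def
      by (intro bounded_linear.has_vector_derivative[OF bounded_linear_scaleR_right]
          has_vector_derivative_diff has_vector_derivative_shifted d1)
    show "(w has_vector_derivative (1/3) *\<^sub>R (kf (\<eta> (t + pi / 3)) - kf (\<eta> (t - pi / 3)))) (at t)" for t
    proof -
      have "(w has_vector_derivative (1/3) *\<^sub>R (- (kf (\<eta> (t - pi / 3)) - mean3 (\<lambda>t. kf (\<eta> t)) (t - pi / 3))
          - - (kf (\<eta> (t + pi / 3)) - mean3 (\<lambda>t. kf (\<eta> t)) (t + pi / 3)))) (at t)"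
        unfolding w_def[abs_def]
        by (intro bounded_linear.has_vector_derivative[OF bounded_linear_scaleR_right]
            has_vector_derivative_diff has_vector_derivative_shifted[OF d2])
      then show ?thesis unfolding mean by simp
    qed
    show "\<gamma> (t + pi) = cnj (\<gamma> t)" for t
      using D(3)[of "t - pi / 3"] D(3)[of "t + pi / 3"] by (simp add: \<gamma>_def algebra_simps)
    show "\<gamma> (- t) = - \<gamma> t" for t
      using D(2)[of "t - pi / 3"] D(2)[of "t + pi / 3"] by (simp add: \<gamma>_def algebra_simps)
    show "\<gamma> (t + 2 * pi) = \<gamma> t" for t
      using D(4)[of "t - pi / 3"] D(4)[of "t + pi / 3"] by (simp add: \<gamma>_def algebra_simps)
    show "norm (\<gamma> t - gamma0 t) \<le> 52/3000" for t
    proof -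
      have "\<gamma> t - gamma0 t = (1/3) *\<^sub>R ((\<eta> (t - pi / 3) - z0 (t - pi / 3)) - (\<eta> (t + pi / 3) - z0 (t + pi / 3)))"
        by (simp add: \<gamma>_def gamma0_def algebra_simps)
      then show ?thesis
        using norm_triangle_ineq4[of "\<eta> (t - pi / 3) - z0 (t - pi / 3)" "\<eta> (t + pi / 3) - z0 (t + pi / 3)"]
          close[of "t - pi / 3"] close[of "t + pi / 3"] by simp
    qed
  qed (rule diff diff' ge close sym)+
  then show thesis by (rule that)
qed

section \<open>Shape of the lobes\<close>


lemma has_real_derivative_reflect:
  fixes f f' :: "real \<Rightarrow> real"
  assumes "\<And>t. (f has_real_derivative f' t) (at t)"
  shows "((\<lambda>s. f (c - s)) has_real_derivative - f' (c - s)) (at s)"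
proof -
  have "((\<lambda>s. c - s) has_real_derivative - 1) (at s)"
    by (auto intro!: derivative_eq_intros)
  from DERIV_chain2[where f = f and g = "\<lambda>s. c - s", OF assms this] show ?thesis by simp
qed

text \<open>If \<open>f t \<le> 0\<close>, some slope before \<open>t\<close> is nonpositive, while
  a slope after \<open>t\<close> must carry \<open>f\<close> up to \<open>f T\<close>. With
  \<open>f2\<close> at most \<open>C\<close> the slope gains at most \<open>C * T\<close>, so
  \<open>f T\<close> is at most \<open>C * T\<^sup>2\<close>.\<close>

lemma positive_if_small_second_derivative:
  fixes f f1 f2 :: "real \<Rightarrow> real"
  assumes d1: "\<And>t. (f has_real_derivative f1 t) (at t)" and d2: "\<And>t. (f1 has_real_derivative f2 t) (at t)"
    and f0: "f 0 = 0" and bound: "\<And>t. 0 \<le> t \<Longrightarrow> t \<le> T \<Longrightarrow> f2 t \<le> C" and fT: "C * T\<^sup>2 < f T" and T: "0 < T" and C: "0 \<le> C"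
    and t: "0 < t" "t \<le> T"
  shows "0 < f t"
proof (rule ccontr)
  assume neg: "\<not> 0 < f t"
  have "f T > 0" using fT C by (smt (verit) mult_nonneg_nonneg zero_le_power2)
  then have tT: "t < T" using neg t by (cases "t = T") auto
  obtain a where a: "0 < a" "a < t" "f t - f 0 = (t - 0) * f1 a"
    using MVT2[of 0 t f f1] t d1 by auto
  obtain b where b: "t < b" "b < T" "f T - f t = (T - t) * f1 b"
    using MVT2[of t T f f1] tT d1 by auto
  obtain c where c: "a < c" "c < b" "f1 b - f1 a = (b - a) * f2 c"
    using MVT2[of a b f1 f2] a b d2 by auto
  have "f1 a \<le> 0" using a neg f0 t by (simp add: not_less mult_le_0_iff)
  have "f T \<le> (T - t) * f1 b" using b neg by simp
  have fb: "0 \<le> f1 b" using \<open>f T \<le> (T - t) * f1 b\<close> \<open>f T > 0\<close> tT by (smt (verit) mult_less_0_iff)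
  have "f T \<le> T * f1 b"
    using \<open>f T \<le> (T - t) * f1 b\<close> mult_right_mono[of "T - t" T "f1 b"] t fb by simp
  moreover have f1b: "f1 b \<le> T * C"
  proof -
    have "f1 b \<le> (b - a) * f2 c" using c \<open>f1 a \<le> 0\<close> by simp
    also have "\<dots> \<le> (b - a) * C" using a b c by (intro mult_left_mono bound) auto
    also have "\<dots> \<le> T * C" using a b C by (intro mult_right_mono) auto
    finally show ?thesis .
  qed
  moreover have "T * f1 b \<le> T * (T * C)"
    by (rule mult_left_mono[OF f1b]) (use T in simp)
  ultimately have "f T \<le> T * (T * C)" by linarith
  then show False using fT by (simp add: power2_eq_square mult_ac)
qed

text \<open>Yields a lower bound for a slope from values alone, which is what uniform closeness to
  an explicit curve provides.\<close>

lemma derivative_ge_secant: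
  fixes f f1 f2 :: "real \<Rightarrow> real"
  assumes d1: "\<And>t. (f has_real_derivative f1 t) (at t)" and d2: "\<And>t. (f1 has_real_derivative f2 t) (at t)"
    and bound: "\<And>t. \<bar>f2 t\<bar> \<le> C" and \<delta>: "0 \<le> \<delta>"
  shows "f (t + \<delta>) - f (t - \<delta>) \<le> 2 * \<delta> * f1 t + C * \<delta>\<^sup>2"
proof -
  define G where "G s = f (t + s) - f (t - s) - 2 * s * f1 t - C * s\<^sup>2" for s
  have inc: "f1 (t + s) - f1 t \<le> C * s" "f1 (t - s) - f1 t \<le> C * s" if "0 \<le> s" for s
  proof -
    show "f1 (t + s) - f1 t \<le> C * s"
    proof (cases "s = 0")
      case False
      then have "\<exists>z>t. z < t + s \<and> f1 (t + s) - f1 t = (t + s - t) * f2 z"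
        using that by (intro MVT2 d2) simp
      then obtain c where "f1 (t + s) - f1 t = s * f2 c" by auto
      moreover have "s * f2 c \<le> s * C" using bound[of c] that by (intro mult_left_mono) auto
      ultimately show ?thesis by (simp add: mult.commute)
    qed simp
    show "f1 (t - s) - f1 t \<le> C * s"
    proof (cases "s = 0")
      case False
      then have "\<exists>z>t - s. z < t \<and> f1 t - f1 (t - s) = (t - (t - s)) * f2 z"
        using that by (intro MVT2 d2) simp
      then obtain c where "f1 t - f1 (t - s) = s * f2 c" by auto
      moreover have "s * (- f2 c) \<le> s * C" using bound[of c] that by (intro mult_left_mono) auto
      ultimately show ?thesis by (simp add: mult.commute)
    qed simp
  qed
  have dp: "((\<lambda>s. f (t + s)) has_real_derivative f1 (t + s)) (at s)" for s
    using DERIV_shift[of f "f1 (t + s)" s t] d1[of "t + s"] by (simp add: add.commute)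
  have dm: "((\<lambda>s. f (t - s)) has_real_derivative - f1 (t - s)) (at s)" for s
    by (rule has_real_derivative_reflect[OF d1])
  have "G \<delta> \<le> G 0"
  proof (rule DERIV_nonpos_imp_nonincreasing[OF \<delta>])
    fix s assume s: "0 \<le> s" "s \<le> \<delta>"
    have "(G has_real_derivative f1 (t + s) - - f1 (t - s) - 2 * f1 t - C * (2 * s)) (at s)"
      unfolding G_def[abs_def] by (rule derivative_eq_intros dp dm refl | simp)+
    moreover have "f1 (t + s) - - f1 (t - s) - 2 * f1 t - C * (2 * s) \<le> 0"
      using inc[OF s(1)] by simp
    ultimately show "\<exists>y. (G has_real_derivative y) (at s) \<and> y \<le> 0" by blast
  qed
  then show ?thesis by (simp add: G_def)
qed

text \<open>Higher harmonics keep the factor \<open>sin x\<close>, so the leading one dominates them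
  right up to its zero. For cosines this works with odd multiples, see
  \<open>abs_cos_odd_mult_le\<close>.\<close>

lemma abs_sin_mult_le: "\<bar>sin (real n * x)\<bar> \<le> real n * \<bar>sin x\<bar>"
proof (induction n)
  case (Suc n)
  have "real (Suc n) * x = real n * x + x" by (simp add: algebra_simps)
  then have "\<bar>sin (real (Suc n) * x)\<bar> = \<bar>sin (real n * x) * cos x + cos (real n * x) * sin x\<bar>"
    by (simp only: sin_add)
  also have "\<dots> \<le> \<bar>sin (real n * x)\<bar> * \<bar>cos x\<bar> + \<bar>cos (real n * x)\<bar> * \<bar>sin x\<bar>"
    using abs_triangle_ineq by (simp flip: abs_mult)
  also have "\<dots> \<le> \<bar>sin (real n * x)\<bar> * 1 + 1 * \<bar>sin x\<bar>"
    by (intro add_mono mult_left_mono mult_right_mono) auto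
  finally show ?case using Suc by (simp add: algebra_simps)
qed simp

lemma cos_ge_quadratic: "1 - x\<^sup>2 / 2 \<le> cos x" for x :: real
proof -
  have "(sin (x / 2))\<^sup>2 \<le> (x / 2)\<^sup>2"
    using abs_sin_x_le_abs_x[of "x / 2"] abs_le_square_iff by blast
  then show ?thesis using cos_double_sin[of "x / 2"] by (simp add: power_divide)
qed

lemma sin_ge_cubic: "0 \<le> x \<Longrightarrow> x - x^3 / 6 \<le> sin x" for x :: real
proof -
  assume x: "0 \<le> x"
  define f where "f y = sin y - y + y^3 / 6" for y :: real
  have "f 0 \<le> f x"
  proof (rule DERIV_nonneg_imp_nondecreasing[OF x])
    fix y
    have "(f has_real_derivative cos y - 1 + y\<^sup>2 / 2) (at y)"
      unfolding f_def[abs_def] by (auto intro!: derivative_eq_intros simp: power2_eq_square)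
    moreover have "0 \<le> cos y - 1 + y\<^sup>2 / 2" using cos_ge_quadratic[of y] by simp
    ultimately show "\<exists>z. (f has_real_derivative z) (at y) \<and> 0 \<le> z" by blast
  qed
  then show ?thesis by (simp add: f_def)
qed

lemma abs_cos_odd_mult_le: "\<bar>cos (real (2 * n + 1) * x)\<bar> \<le> real (2 * n + 1) * \<bar>cos x\<bar>"
proof (induction n)
  case (Suc n)
  have eq: "real (2 * Suc n + 1) * x = real (2 * n + 1) * x + 2 * x" by (simp add: algebra_simps)
  have "\<bar>cos (real (2 * Suc n + 1) * x)\<bar> =
      \<bar>cos (real (2 * n + 1) * x) * cos (2 * x) - sin (real (2 * n + 1) * x) * (2 * sin x * cos x)\<bar>"
    unfolding eq cos_add sin_double ..
  also have "\<dots> \<le> \<bar>cos (real (2 * n + 1) * x)\<bar> * \<bar>cos (2 * x)\<bar> + \<bar>sin (real (2 * n + 1) * x)\<bar> * (2 * \<bar>sin x\<bar> * \<bar>cos x\<bar>)"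
    using abs_triangle_ineq4[of "cos (real (2 * n + 1) * x) * cos (2 * x)" "sin (real (2 * n + 1) * x) * (2 * sin x * cos x)"]
    by (simp add: abs_mult)
  also have "\<dots> \<le> \<bar>cos (real (2 * n + 1) * x)\<bar> * 1 + 1 * (2 * 1 * \<bar>cos x\<bar>)"
    by (intro add_mono mult_mono) auto
  finally show ?case using Suc by (simp add: algebra_simps)
qed simp

lemma sqrt3_bounds: "577/1000 \<le> sqrt 3 / 3" "sqrt 3 / 3 \<le> 578/1000"
proof -
  have "1731/1000 \<le> sqrt 3" by (rule real_le_rsqrt) (simp add: power2_eq_square)
  moreover have "sqrt 3 \<le> 1734/1000" by (rule real_le_lsqrt) (simp_all add: power2_eq_square)
  ultimately show "577/1000 \<le> sqrt 3 / 3" "sqrt 3 / 3 \<le> 578/1000" by simp_all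
qed

lemma sin_multiples:
  "sin (2 * (pi / 3)) = sqrt 3 / 2" "sin (4 * (pi / 3)) = - (sqrt 3 / 2)" "sin (8 * (pi / 3)) = sqrt 3 / 2"
  "sin (10 * (pi / 3)) = - (sqrt 3 / 2)" "sin (5 * (pi / 3)) = - (sqrt 3 / 2)" "sin (7 * (pi / 3)) = sqrt 3 / 2"
  "sin (11 * (pi / 3)) = - (sqrt 3 / 2)"
proof -
  have 1: "sin (pi + pi / 3) = - (sqrt 3 / 2)" "sin (pi - pi / 3) = sqrt 3 / 2"
    "sin (2 * pi - pi / 3) = - (sqrt 3 / 2)" "sin (2 * pi + pi / 3) = sqrt 3 / 2"
    unfolding sin_add sin_diff by (simp_all add: sin_60)
  have per: "sin (x + 2 * pi) = sin x" for x by simp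
  have e: "2 * (pi / 3) = pi - pi / 3" "4 * (pi / 3) = pi + pi / 3" "8 * (pi / 3) = (pi - pi / 3) + 2 * pi"
    "10 * (pi / 3) = (pi + pi / 3) + 2 * pi" "5 * (pi / 3) = 2 * pi - pi / 3" "7 * (pi / 3) = 2 * pi + pi / 3"
    "11 * (pi / 3) = (2 * pi - pi / 3) + 2 * pi" by simp_all
  show "sin (2 * (pi / 3)) = sqrt 3 / 2" "sin (4 * (pi / 3)) = - (sqrt 3 / 2)" "sin (8 * (pi / 3)) = sqrt 3 / 2"
    "sin (10 * (pi / 3)) = - (sqrt 3 / 2)" "sin (5 * (pi / 3)) = - (sqrt 3 / 2)" "sin (7 * (pi / 3)) = sqrt 3 / 2"
    "sin (11 * (pi / 3)) = - (sqrt 3 / 2)"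
    unfolding e per 1 by simp_all
qed

lemma cos_diff_shift: "cos (k * (t - pi / 3)) - cos (k * (t + pi / 3)) = 2 * (sin (k * t) * sin (k * (pi / 3)))"
  by (simp add: distrib_left right_diff_distrib cos_add cos_diff)

section \<open>The explicit approximate curve and its bounds\<close>

lemma Re_gamma0:
  "Re (gamma0 t) = sqrt 3 / 3 * ((40508 * sin (2 * t) + 6691 * sin (4 * t) - 360 * sin (8 * t) - 97 * sin (10 * t)) / 100000)"
proof -
  have "Re (gamma0 t) = (40508 * (cos (2 * (t - pi / 3)) - cos (2 * (t + pi / 3)))
      - 6691 * (cos (4 * (t - pi / 3)) - cos (4 * (t + pi / 3)))
      - 360 * (cos (8 * (t - pi / 3)) - cos (8 * (t + pi / 3)))
      + 97 * (cos (10 * (t - pi / 3)) - cos (10 * (t + pi / 3)))) / 300000"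
    unfolding gamma0_def by (simp add: Re_z0 diff_divide_distrib add_divide_distrib)
  then show ?thesis unfolding cos_diff_shift sin_multiples by (simp add: algebra_simps)
qed

lemma Im_gamma0:
  "Im (gamma0 t) = sqrt 3 / 3 * ((131606 * sin t - 3035 * sin (5 * t) - 702 * sin (7 * t) + 50 * sin (11 * t)) / 100000)"
proof -
  have "Im (gamma0 t) = (131606 * (cos (1 * (t - pi / 3)) - cos (1 * (t + pi / 3)))
      + 3035 * (cos (5 * (t - pi / 3)) - cos (5 * (t + pi / 3)))
      - 702 * (cos (7 * (t - pi / 3)) - cos (7 * (t + pi / 3)))
      - 50 * (cos (11 * (t - pi / 3)) - cos (11 * (t + pi / 3)))) / 300000"
    unfolding gamma0_def by (simp add: Im_z0 diff_divide_distrib add_divide_distrib)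
  then show ?thesis unfolding cos_diff_shift sin_multiples by (simp add: sin_60 algebra_simps)
qed

text \<open>Here \<open>38583 = 40508 - 4 * 360 - 5 * 97\<close> and
  \<open>13382 = 2 * 6691\<close>. The parameter \<open>b\<close> allows a sharper bound near
  \<open>t = 0\<close>, where \<open>cos (2 * t)\<close> is close to 1.\<close>

lemma Re_gamma0_ge:
  assumes "0 \<le> sin (2 * t)" "b \<le> cos (2 * t)" "- 1 \<le> b"
  shows "577/1000 * ((38583 + 13382 * b) / 100000) * sin (2 * t) \<le> Re (gamma0 t)"
proof -
  have s4: "sin (4 * t) = 2 * sin (2 * t) * cos (2 * t)"
    using sin_double[of "2 * t"] by simp
  have "sin (8 * t) \<le> 4 * sin (2 * t)" "sin (10 * t) \<le> 5 * sin (2 * t)"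
    using abs_sin_mult_le[of 4 "2 * t"] abs_sin_mult_le[of 5 "2 * t"] assms(1) by auto
  moreover have "2 * sin (2 * t) * b \<le> sin (4 * t)"
    unfolding s4 using assms by (intro mult_left_mono) auto
  moreover have "(38583 + 13382 * b) * sin (2 * t) = 38583 * sin (2 * t) + 6691 * (2 * sin (2 * t) * b)"
    by (simp add: algebra_simps)
  ultimately have "(38583 + 13382 * b) * sin (2 * t) \<le>
      40508 * sin (2 * t) + 6691 * sin (4 * t) - 360 * sin (8 * t) - 97 * sin (10 * t)"
    by linarith
  then have le: "(38583 + 13382 * b) * sin (2 * t) / 100000 \<le>
      (40508 * sin (2 * t) + 6691 * sin (4 * t) - 360 * sin (8 * t) - 97 * sin (10 * t)) / 100000"
    by (rule divide_right_mono) simp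
  have nn: "0 \<le> (38583 + 13382 * b) * sin (2 * t) / 100000"
    using assms by simp
  show ?thesis
    unfolding Re_gamma0 using mult_mono[OF sqrt3_bounds(1) le _ nn] by (simp add: mult_ac)
qed

text \<open>The margin is \<open>131606 - 5 * 3035 - 7 * 702 - 11 * 50 = 110967\<close>.\<close>

lemma Im_z0_ge:
  assumes "0 \<le> cos t"
  shows "110/100 * cos t \<le> Im (z0 t)"
  using abs_cos_odd_mult_le[of 2 t] abs_cos_odd_mult_le[of 3 t] abs_cos_odd_mult_le[of 5 t] assms
  unfolding Im_z0 by (simp add: abs_le_iff)

lemma Im_gamma0_diff:
  "Im (gamma0 (t + d)) - Im (gamma0 (t - d)) = sqrt 3 / 3 * ((131606 * (cos t * sin d) - 3035 * (cos (5 * t) * sin (5 * d))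
     - 702 * (cos (7 * t) * sin (7 * d)) + 50 * (cos (11 * t) * sin (11 * d))) / 50000)"
proof -
  have "sin (k * (t + d)) - sin (k * (t - d)) = 2 * (cos (k * t) * sin (k * d))" for k
    by (simp add: distrib_left right_diff_distrib sin_add sin_diff)
  from this[of 1] this[of 5] this[of 7] this[of 11]
  show ?thesis
    unfolding Im_gamma0 right_diff_distrib[symmetric] diff_divide_distrib[symmetric]
    by (intro arg_cong[where f = "\<lambda>x. sqrt 3 / 3 * x"]) simp
qed

context eight_solution
begin

section \<open>Signs and monotonicity of the coordinates of the solution\<close>

definition acc :: "real \<Rightarrow> complex" where
  "acc t = (1/3) *\<^sub>R (kf (\<eta> (t + pi / 3)) - kf (\<eta> (t - pi / 3)))"

lemma norm_acc_le:
  assumes "m > 0" "m \<le> norm (\<eta> (t + pi / 3))" "m \<le> norm (\<eta> (t - pi / 3))"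
  shows "norm (acc t) \<le> 2 / 3 / m\<^sup>2"
proof -
  have "1 / (norm z)\<^sup>2 \<le> 1 / m\<^sup>2" if "m \<le> norm z" for z :: complex
    using that assms(1) by (intro divide_left_mono power_mono mult_pos_pos zero_less_power) auto
  then have "norm (kf (\<eta> (t + pi / 3))) \<le> 1 / m\<^sup>2" "norm (kf (\<eta> (t - pi / 3))) \<le> 1 / m\<^sup>2"
    unfolding norm_kf using assms(2,3) by auto
  then show ?thesis
    unfolding acc_def using norm_triangle_ineq4[of "kf (\<eta> (t + pi / 3))" "kf (\<eta> (t - pi / 3))"] by simp
qed

lemma norm_acc_global: "norm (acc t) \<le> 35/10"
  using norm_acc_le[of "44/100" t] ge by (simp add: power_divide)

lemma Re_Im_deriv:
  "((\<lambda>t. Re (\<gamma> t)) has_real_derivative Re (w t)) (at t)" "((\<lambda>t. Im (\<gamma> t)) has_real_derivative Im (w t)) (at t)"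
  "((\<lambda>t. Re (w t)) has_real_derivative Re (acc t)) (at t)" "((\<lambda>t. Im (w t)) has_real_derivative Im (acc t)) (at t)"
  unfolding has_real_derivative_iff_has_vector_derivative acc_def
  by (intro bounded_linear.has_vector_derivative[OF bounded_linear_Re] bounded_linear.has_vector_derivative[OF bounded_linear_Im] d1 d2)+

lemma reflect: "\<gamma> (pi - t) = - cnj (\<gamma> t)"
  using shift_pi[of "- t"] odd[of t] by simp

lemma gamma_0: "\<gamma> 0 = 0"
  using odd[of 0] by simp

lemma gamma_pi: "\<gamma> pi = 0"
  using shift_pi[of 0] gamma_0 by simp

lemma Re_close: "\<bar>Re (\<gamma> t) - Re (gamma0 t)\<bar> \<le> 52/3000"
  using abs_Re_le_cmod[of "\<gamma> t - gamma0 t"] close[of t] by simp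

lemma Im_close: "\<bar>Im (\<gamma> t) - Im (gamma0 t)\<bar> \<le> 52/3000"
  using abs_Im_le_cmod[of "\<gamma> t - gamma0 t"] close[of t] by simp

lemma Im_eta_ge: "0 \<le> cos s \<Longrightarrow> 110/100 * cos s - 26/1000 \<le> Im (\<eta> s)"
  using abs_Im_le_cmod[of "\<eta> s - z0 s"] eta_close[of s] Im_z0_ge[of s] by simp

lemma norm_eta_large:
  assumes "\<bar>s\<bar> \<le> 2/3"
  shows "8/10 \<le> Im (\<eta> s)" "8/10 \<le> norm (\<eta> s)"
proof -
  have "s\<^sup>2 \<le> (2/3)\<^sup>2" using assms by (metis abs_le_square_iff abs_numeral abs_divide)
  then have "7/9 \<le> cos s" using cos_ge_quadratic[of s] by (simp add: power_divide)
  then show "8/10 \<le> Im (\<eta> s)" using Im_eta_ge[of s] by linarith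
  then show "8/10 \<le> norm (\<eta> s)" using abs_Im_le_cmod[of "\<eta> s"] by linarith
qed

lemma eta_reflect: "\<eta> (pi - s) = cnj (\<eta> s)"
  using mode_symmetricD(3)[OF eta_sym, of "- s"] mode_symmetricD(2)[OF eta_sym, of s] by simp

lemma sin_mid: "1/10 \<le> t \<Longrightarrow> t \<le> pi / 2 - 1/10 \<Longrightarrow> 198/1000 \<le> sin (2 * t)"
proof -
  assume t: "1/10 \<le> t" "t \<le> pi / 2 - 1/10"
  have 0: "198/1000 \<le> sin (2/10 :: real)"
    using sin_ge_cubic[of "2/10"] by (simp add: power3_eq_cube)
  have pi: "3 < pi" by (rule pi_gt3)
  have mono: "sin (2/10) \<le> sin x" if "2/10 \<le> x" "x \<le> pi / 2" for x :: real
    using that by (intro sin_monotone_2pi_le) auto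
  show ?thesis
  proof (cases "2 * t \<le> pi / 2")
    case True
    then show ?thesis using mono[of "2 * t"] t 0 by simp
  next
    case False
    then have "sin (2/10) \<le> sin (pi - 2 * t)" using t by (intro mono) auto
    then show ?thesis using 0 by simp
  qed
qed

lemma Re_gamma_mid:
  assumes "1/10 \<le> t" "t \<le> pi / 2 - 1/10"
  shows "11/1000 < Re (\<gamma> t)"
proof -
  have s: "198/1000 \<le> sin (2 * t)" by (rule sin_mid[OF assms])
  have "577/1000 * ((38583 + 13382 * (- 1)) / 100000) * sin (2 * t) \<le> Re (gamma0 t)"
    by (rule Re_gamma0_ge) (use s in auto)
  then have "14540977/100000000 * sin (2 * t) \<le> Re (gamma0 t)" by simp
  then show ?thesis using s Re_close[of t] by linarith
qed

text \<open>Closeness to \<open>gamma0\<close> settles the middle range. Near the zeros at 0 and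
  \<open>pi / 2\<close> the value at distance 1/10 is played off against the acceleration.\<close>

lemma Re_gamma_pos:
  assumes "0 < t" "t < pi / 2"
  shows "0 < Re (\<gamma> t)"
proof -
  consider "t \<le> 1/10" | "1/10 \<le> t" "t \<le> pi / 2 - 1/10" | "pi / 2 - 1/10 \<le> t" by linarith
  then show ?thesis
  proof cases
    case 1
    show ?thesis
    proof (rule positive_if_small_second_derivative[where f = "\<lambda>t. Re (\<gamma> t)" and T = "1/10" and C = "35/10", OF Re_Im_deriv(1,3)])
      show "Re (acc t) \<le> 35/10" for t
        using abs_Re_le_cmod[of "acc t"] norm_acc_global[of t] by simp
      have c: "98/100 \<le> cos (2 * (1/10 :: real))" using cos_ge_quadratic[of "2/10"] by (simp add: power_divide)
      have s: "198/1000 \<le> sin (2 * (1/10 :: real))"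
        using sin_ge_cubic[of "2/10"] by (simp add: power3_eq_cube)
      have "577/1000 * ((38583 + 13382 * (98/100)) / 100000) * sin (2 * (1/10)) \<le> Re (gamma0 (1/10))"
        by (rule Re_gamma0_ge) (use s c in auto)
      then have "372867209/1250000000 * sin (2 * (1/10)) \<le> Re (gamma0 (1/10))" by simp
      then have "35/1000 < Re (\<gamma> (1/10))"
        using s Re_close[of "1/10"] by linarith
      then show "35/10 * (1/10)\<^sup>2 < Re (\<gamma> (1/10))" by (simp add: power_divide)
    qed (use 1 assms gamma_0 in auto)
  next
    case 2
    then show ?thesis using Re_gamma_mid by fastforce
  next
    case 3
    \<comment> \<open>Time runs backwards from \<open>pi / 2\<close>. The value at distance 1/10 is
      only known to exceed 11/1000, so the global bound 35/10 is too weak; here both other bodies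
      are at distance at least 8/10, which improves it to 11/10.\<close>
    have d: "((\<lambda>s. Re (\<gamma> (pi / 2 - s))) has_real_derivative - Re (w (pi / 2 - s))) (at s)"
      "((\<lambda>s. - Re (w (pi / 2 - s))) has_real_derivative Re (acc (pi / 2 - s))) (at s)" for s
      using has_real_derivative_reflect[OF Re_Im_deriv(1)]
        DERIV_minus[OF has_real_derivative_reflect[OF Re_Im_deriv(3)]] by simp_all
    have "0 < Re (\<gamma> (pi / 2 - (pi / 2 - t)))"
    proof (rule positive_if_small_second_derivative[where T = "1/10" and C = "11/10", OF d])
      show "Re (\<gamma> (pi / 2 - 0)) = 0" using reflect[of "pi / 2"] by (simp add: complex_eq_iff)
      show "Re (acc (pi / 2 - s)) \<le> 11/10" if "0 \<le> s" "s \<le> 1/10" for s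
      proof -
        have pi: "pi < 32/10" "3 < pi" using pi_approx by simp_all
        have 1: "8/10 \<le> norm (\<eta> (pi / 2 - s - pi / 3))"
          by (rule norm_eta_large) (use that pi in linarith)
        have "8/10 \<le> norm (\<eta> (pi / 6 + s))"
          by (rule norm_eta_large) (use that pi in linarith)
        moreover have "\<eta> (pi / 2 - s + pi / 3) = cnj (\<eta> (pi / 6 + s))"
          using eta_reflect[of "pi / 6 + s"] by (simp add: algebra_simps)
        ultimately have "norm (acc (pi / 2 - s)) \<le> 2 / 3 / (8/10)\<^sup>2"
          using 1 by (intro norm_acc_le) auto
        then show ?thesis using abs_Re_le_cmod[of "acc (pi / 2 - s)"] by (simp add: power_divide)
      qed
      show "11/10 * (1/10)\<^sup>2 < Re (\<gamma> (pi / 2 - 1/10))"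
        using Re_gamma_mid[of "pi / 2 - 1/10"] pi_gt3 by (simp add: power_divide)
    qed (use 3 assms in auto)
    then show ?thesis by simp
  qed
qed

lemma Im_w_half_pi: "Im (w (pi / 2)) = 0"
proof -
  have "((\<lambda>t. Im (\<gamma> (pi - t))) has_real_derivative - Im (w (pi - pi / 2))) (at (pi / 2))"
    by (rule has_real_derivative_reflect[OF Re_Im_deriv(2)])
  moreover have "(\<lambda>t. Im (\<gamma> (pi - t))) = (\<lambda>t. Im (\<gamma> t))"
    by (simp add: reflect)
  ultimately have "((\<lambda>t. Im (\<gamma> t)) has_real_derivative - Im (w (pi / 2))) (at (pi / 2))" by simp
  from DERIV_unique[OF this Re_Im_deriv(2)] show ?thesis by simp
qed

text \<open>On this interval both other bodies lie strictly below the body.\<close>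

lemma Im_acc_neg:
  assumes "6/10 \<le> t" "t \<le> pi / 2"
  shows "Im (acc t) < 0"
proof -
  have pi: "pi < 3142/1000" "3141/1000 < pi" using pi_approx by simp_all
  have 1: "0 < Im (\<eta> (t - pi / 3))"
  proof -
    have "8/10 \<le> Im (\<eta> (t - pi / 3))"
      by (rule norm_eta_large) (use assms pi in linarith)
    then show ?thesis by simp
  qed
  have 2: "Im (\<eta> (t + pi / 3)) < 0"
  proof -
    define s where "s = 2 * pi / 3 - t"
    have e: "\<eta> (t + pi / 3) = cnj (\<eta> s)"
      using eta_reflect[of s] by (simp add: s_def algebra_simps)
    \<comment> \<open>For \<open>t \<ge> 6/10\<close> the angle \<open>s\<close> stays 7/100 short
      of \<open>pi / 2\<close>, enough for \<open>110/100 * cos s\<close> to exceed the error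
      26/1000.\<close>
    have "sin (7/100) \<le> sin (pi / 2 - s)"
      using assms pi by (intro sin_monotone_2pi_le) (auto simp: s_def)
    moreover have "69/1000 \<le> sin (7/100 :: real)" using sin_ge_cubic[of "7/100"] by (simp add: power3_eq_cube)
    ultimately have "69/1000 \<le> cos s" by (simp add: sin_diff)
    then have "0 < Im (\<eta> s)" using Im_eta_ge[of s] by simp
    then show ?thesis by (simp add: e)
  qed
  have "\<eta> (t + pi / 3) \<noteq> 0" "\<eta> (t - pi / 3) \<noteq> 0" using 1 2 by auto
  then have "Im (kf (\<eta> (t + pi / 3))) < 0" "0 < Im (kf (\<eta> (t - pi / 3)))"
    using 1 2 by (simp_all add: kf_def divide_neg_pos)
  then show ?thesis by (simp add: acc_def)
qed

text \<open>Up to 6/10 the secant of \<open>gamma0\<close> over \<open>t - 1/10\<close>,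
  \<open>t + 1/10\<close> is, in thousandths, at least 92, of which closeness and curvature cost at
  most 35 each. Later the height is concave with slope 0 at \<open>pi / 2\<close>.\<close>

lemma Im_w_pos:
  assumes "0 \<le> t" "t < pi / 2"
  shows "0 < Im (w t)"
proof (cases "t \<le> 6/10")
  case True
  have sec: "Im (\<gamma> (t + 1/10)) - Im (\<gamma> (t - 1/10)) \<le> 2 * (1/10) * Im (w t) + 35/10 * (1/10)\<^sup>2"
  proof (rule derivative_ge_secant[OF Re_Im_deriv(2,4)])
    show "\<bar>Im (acc s)\<bar> \<le> 35/10" for s
      using abs_Im_le_cmod[of "acc s"] norm_acc_global[of s] by linarith
  qed simp
  have "t\<^sup>2 \<le> (6/10)\<^sup>2" using assms True by (intro power_mono) auto
  then have ct: "82/100 \<le> cos t" using cos_ge_quadratic[of t] by (simp add: power_divide)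
  have sd: "998/10000 \<le> sin (1/10 :: real)" using sin_ge_cubic[of "1/10"] by (simp add: power3_eq_cube)
  have main: "82/100 * (998/10000) \<le> cos t * sin (1/10)"
    using ct sd by (intro mult_mono) auto
  have small: "\<bar>cos (k * t) * sin (k * (1/10))\<bar> \<le> k / 10" if "0 \<le> k" for k :: real
  proof -
    have "\<bar>cos (k * t) * sin (k * (1/10))\<bar> \<le> 1 * \<bar>k * (1/10)\<bar>"
      unfolding abs_mult[of "cos _"] by (intro mult_mono abs_sin_x_le_abs_x) auto
    then show ?thesis using that by simp
  qed
  have num: "16/100 \<le> (131606 * (cos t * sin (1/10)) - 3035 * (cos (5 * t) * sin (5 * (1/10)))
     - 702 * (cos (7 * t) * sin (7 * (1/10))) + 50 * (cos (11 * t) * sin (11 * (1/10)))) / 50000"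
    using main small[of 5] small[of 7] small[of 11] by (simp add: abs_le_iff)
  have "577/1000 * (16/100) \<le> Im (gamma0 (t + 1/10)) - Im (gamma0 (t - 1/10))"
    unfolding Im_gamma0_diff by (rule mult_mono[OF sqrt3_bounds(1) num]) simp_all
  moreover have "35/10 * (1/10)\<^sup>2 = (35/1000 :: real)" by (simp add: power_divide)
  ultimately show ?thesis
    using sec Im_close[of "t + 1/10"] Im_close[of "t - 1/10"] by linarith
next
  case False
  have "Im (w (pi / 2)) < Im (w t)"
    by (rule DERIV_neg_imp_decreasing[OF assms(2)])
      (use False Re_Im_deriv(4) Im_acc_neg in \<open>metis less_eq_real_def order_trans not_le\<close>)
  then show ?thesis by (simp add: Im_w_half_pi)
qed

end

section \<open>Symmetry class and figure-eight shape\<close>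


context eight_solution
begin

lemma Im_gamma_mono:
  assumes "0 \<le> s" "s < t" "t \<le> pi / 2"
  shows "Im (\<gamma> s) < Im (\<gamma> t)"
proof -
  obtain c where c: "s < c" "c < t" "Im (\<gamma> t) - Im (\<gamma> s) = (t - s) * Im (w c)"
    using MVT2[OF assms(2) Re_Im_deriv(2)] by auto
  then have "0 < (t - s) * Im (w c)"
    using assms Im_w_pos[of c] by (intro mult_pos_pos) auto
  then show ?thesis using c by simp
qed

lemma Im_gamma_pos: "0 < t \<Longrightarrow> t < pi \<Longrightarrow> 0 < Im (\<gamma> t)"
proof -
  assume t: "0 < t" "t < pi"
  have half: "0 < Im (\<gamma> s)" if "0 < s" "s \<le> pi / 2" for s
    using Im_gamma_mono[of 0 s] that gamma_0 by simp
  show ?thesis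
    using half[of t] half[of "pi - t"] reflect[of t] t by (cases "t \<le> pi / 2") auto
qed

lemma gamma_inj_half:
  "0 \<le> s \<Longrightarrow> s \<le> pi / 2 \<Longrightarrow> 0 \<le> t \<Longrightarrow> t \<le> pi / 2 \<Longrightarrow> \<gamma> s = \<gamma> t \<Longrightarrow> s = t"
  using Im_gamma_mono[of s t] Im_gamma_mono[of t s] by (cases s t rule: linorder_cases) auto

text \<open>Points of the two halves at equal height are mirror images in the imaginary axis, so
  they coincide only where \<open>Re\<close> vanishes. On \<open>{0..pi/2}\<close> this leaves the
  endpoints, and \<open>pi / 2\<close> is excluded by \<open>pi / 2 < t\<close>.\<close>

lemma gamma_crossing:
  assumes "0 \<le> s" "s \<le> pi / 2" "pi / 2 < t" "t \<le> pi" "\<gamma> s = \<gamma> t"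
  shows "s = 0 \<and> t = pi"
proof -
  have r: "\<gamma> t = - cnj (\<gamma> (pi - t))" using reflect[of "pi - t"] by simp
  have "Im (\<gamma> s) = Im (\<gamma> (pi - t))" unfolding assms(5) r by simp
  then have eq: "s = pi - t"
    using Im_gamma_mono[of s "pi - t"] Im_gamma_mono[of "pi - t" s] assms
    by (cases s "pi - t" rule: linorder_cases) auto
  have "Re (\<gamma> s) = 0"
    using assms(5) r unfolding eq by (simp add: complex_eq_iff)
  then have "\<not> (0 < s \<and> s < pi / 2)" using Re_gamma_pos[of s] by auto
  then show ?thesis using assms eq by auto
qed

lemma gamma_lobe_inj:
  assumes "s \<in> {0..pi}" "t \<in> {0..pi}" "\<gamma> s = \<gamma> t"
  shows "s = t \<or> s = 0 \<and> t = pi \<or> s = pi \<and> t = 0"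
proof -
  consider "s \<le> pi / 2" "t \<le> pi / 2" | "s \<le> pi / 2" "pi / 2 < t" | "pi / 2 < s" "t \<le> pi / 2" | "pi / 2 < s" "pi / 2 < t"
    by linarith
  then show ?thesis
  proof cases
    case 1 then show ?thesis using gamma_inj_half assms by auto
  next
    case 2 then show ?thesis using gamma_crossing[of s t] assms by auto
  next
    case 3 then show ?thesis using gamma_crossing[of t s] assms by auto
  next
    case 4
    have "\<gamma> (pi - s) = \<gamma> (pi - t)" using assms(3) by (simp add: reflect)
    then have "pi - s = pi - t" using 4 assms by (intro gamma_inj_half) auto
    then show ?thesis by simp
  qed
qed

lemma continuous_gamma: "continuous_on A \<gamma>"
  by (rule continuous_on_vector_derivative) (rule has_vector_derivative_at_within[OF d1])

lemma continuous_w: "continuous_on A w"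
  by (rule continuous_on_vector_derivative) (rule has_vector_derivative_at_within[OF d2])

section \<open>The two lobes as simple closed paths\<close>

definition lobe :: "real \<Rightarrow> complex" where "lobe = subpath 0 pi \<gamma>"

lemma lobe_eq: "lobe x = \<gamma> (pi * x)"
  by (simp add: lobe_def subpath_def)

lemma lower_lobe: "subpath pi (2 * pi) \<gamma> = cnj \<circ> lobe"
  using shift_pi by (auto simp: lobe_eq subpath_def)

lemma path_lobe: "path lobe"
  unfolding path_def lobe_eq[abs_def]
  by (rule continuous_on_compose2[OF continuous_gamma[of UNIV]]) (auto intro!: continuous_intros)

lemma simple_path_lobe: "simple_path lobe"
  unfolding simple_path_def loop_free_def
proof (intro conjI ballI impI path_lobe)
  fix x y :: real assume xy: "x \<in> {0..1}" "y \<in> {0..1}" "lobe x = lobe y"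
  have "pi * x \<in> {0..pi}" "pi * y \<in> {0..pi}" using xy by (auto simp: mult_left_le)
  from gamma_lobe_inj[OF this] xy(3)
  show "x = y \<or> x = 0 \<and> y = 1 \<or> x = 1 \<and> y = 0" by (auto simp: lobe_eq)
qed

lemma lobe_ends: "pathstart lobe = 0" "pathfinish lobe = 0"
  by (simp_all add: pathstart_def pathfinish_def lobe_eq gamma_0 gamma_pi)

lemma lobe_image: "z \<in> path_image lobe \<Longrightarrow> z = 0 \<or> 0 < Im z"
proof -
  assume "z \<in> path_image lobe"
  then obtain x where x: "0 \<le> x" "x \<le> 1" "z = \<gamma> (pi * x)"
    by (auto simp: path_image_def lobe_eq)
  show ?thesis
  proof (cases "x = 0 \<or> x = 1")
    case True then show ?thesis using x gamma_0 gamma_pi by auto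
  next
    case False
    then have "0 < Im (\<gamma> (pi * x))" using x by (intro Im_gamma_pos) auto
    then show ?thesis using x by simp
  qed
qed

lemma path_image_cnj: "path_image (cnj \<circ> p) = cnj ` path_image p"
  by (auto simp: path_image_def)

text \<open>The lobes lie in opposite closed half planes, and whatever is off a convex set
  containing a curve is outside the curve.\<close>

lemma lobes_outside:
  "path_image lobe - {0} \<subseteq> outside (path_image (cnj \<circ> lobe))"
  "path_image (cnj \<circ> lobe) - {0} \<subseteq> outside (path_image lobe)"
proof -
  have low: "path_image (cnj \<circ> lobe) \<subseteq> {z. Im z \<le> 0}"
    unfolding path_image_cnj using lobe_image by fastforce
  have up: "path_image lobe \<subseteq> {z. Im z \<ge> 0}"
    using lobe_image by fastforce
  have out: "- {z. Im z \<le> 0} \<subseteq> outside (path_image (cnj \<circ> lobe))" "- {z. Im z \<ge> 0} \<subseteq> outside (path_image lobe)"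
    by (rule outside_subset_convex[OF convex_halfspace_Im_le low])
      (rule outside_subset_convex[OF convex_halfspace_Im_ge up])
  have "path_image lobe - {0} \<subseteq> - {z. Im z \<le> 0}"
    using lobe_image by fastforce
  with out(1) show "path_image lobe - {0} \<subseteq> outside (path_image (cnj \<circ> lobe))" by blast
  have "path_image (cnj \<circ> lobe) - {0} \<subseteq> - {z. Im z \<ge> 0}"
    unfolding path_image_cnj using lobe_image by fastforce
  with out(2) show "path_image (cnj \<circ> lobe) - {0} \<subseteq> outside (path_image lobe)" by blast
qed

text \<open>Conjugation maps one lobe to the other and reverses orientation. The winding number is
  constant inside a simple closed curve, so the unrelated points \<open>z\<close> and
  \<open>cnj v\<close> may be compared.\<close>

lemma lobes_winding:
  assumes z: "z \<in> inside (path_image lobe)" and v: "v \<in> inside (path_image (cnj \<circ> lobe))"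
  shows "winding_number lobe z = - winding_number (cnj \<circ> lobe) v"
proof -
  have simple: "simple_path (cnj \<circ> lobe)"
    using simple_path_lobe path_lobe
    by (auto simp: simple_path_def loop_free_def path_def intro!: continuous_intros)
  have off: "cnj v \<notin> path_image lobe"
    using v by (force simp: inside_def path_image_cnj)
  have wc: "winding_number (cnj \<circ> lobe) v = - cnj (winding_number lobe (cnj v))"
    using winding_number_cnj[OF path_lobe off] by simp
  have "winding_number (cnj \<circ> lobe) v = 1 \<or> winding_number (cnj \<circ> lobe) v = - 1"
    by (rule simple_closed_path_winding_number_inside[OF simple]) (use v in blast)+
  \<comment> \<open>A nonzero winding number is what places \<open>cnj v\<close> inside the first
    lobe.\<close>
  then have "winding_number (cnj \<circ> lobe) v \<noteq> 0" by auto
  then have "winding_number lobe (cnj v) \<noteq> 0" unfolding wc by auto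
  then have "cnj v \<notin> outside (path_image lobe)"
    using winding_number_zero_in_outside[OF path_lobe] lobe_ends by metis
  then have inside: "cnj v \<in> inside (path_image lobe)"
    using off inside_Un_outside[of "path_image lobe"] by blast
  show ?thesis
    unfolding wc
    by (rule simple_closed_path_winding_number_inside[OF simple_path_lobe]) (use z inside in simp)+
qed

lemma figure_eight: "figure_eight_curve (2 * pi) \<gamma>"
proof -
  define P where "P a b \<longleftrightarrow> a < b \<and> b < a + 2 * pi \<and> \<gamma> a = \<gamma> b \<and>
    (let L1 = subpath a b \<gamma>; L2 = subpath b (a + 2 * pi) \<gamma> in
      simple_path L1 \<and> simple_path L2 \<and>
      path_image L1 - {\<gamma> a} \<subseteq> outside (path_image L2) \<and>
      path_image L2 - {\<gamma> a} \<subseteq> outside (path_image L1) \<and>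
      (\<forall>z\<in>inside (path_image L1). \<forall>w\<in>inside (path_image L2).
        winding_number L1 z = - winding_number L2 w))" for a b
  have "simple_path (cnj \<circ> lobe)"
    using simple_path_lobe path_lobe
    by (auto simp: simple_path_def loop_free_def path_def intro!: continuous_intros)
  then have "P 0 pi"
    using simple_path_lobe lobes_outside lobes_winding
    by (simp add: P_def Let_def lower_lobe gamma_0 gamma_pi flip: lobe_def)
  then show ?thesis
    using continuous_gamma periodic
    unfolding figure_eight_curve_def P_def has_period_def by (intro conjI) (simp, blast+)
qed

lemma eta_next: "\<gamma> (t + 2 * pi / 3) \<noteq> \<gamma> t"
proof
  assume "\<gamma> (t + 2 * pi / 3) = \<gamma> t"
  then show False using next_body[of t] ge[of "t + pi / 3"] by simp
qed

lemma node: "\<gamma> (of_int k * pi) = 0"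
proof -
  have n: "\<gamma> (real n * pi) = 0" for n
  proof (induction n)
    case (Suc n)
    then show ?case using shift_pi[of "real n * pi"] by (simp add: algebra_simps)
  qed (simp add: gamma_0)
  show ?thesis
  proof (cases "k \<ge> 0")
    case True then show ?thesis using n[of "nat k"] by simp
  next
    case False then show ?thesis using n[of "nat (- k)"] odd[of "of_int k * pi"] by simp
  qed
qed

section \<open>Membership in the symmetric Sobolev class\<close>

lemma bounded_continuous_L2: "continuous_on UNIV f \<Longrightarrow> L2_circle f"
proof -
  assume f: "continuous_on UNIV f"
  have "set_integrable lborel {0..2*pi} (\<lambda>t. (norm (f t))\<^sup>2)"
    by (rule borel_integrable_atLeastAtMost') (intro continuous_intros continuous_on_subset[OF f], simp)
  then show ?thesis
    unfolding L2_circle_def using f by (simp add: borel_measurable_continuous_onI)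
qed

text \<open>The loop has a continuous classical derivative, so this is integration by parts with
  boundary terms that cancel by periodicity.\<close>

lemma weak_derivative: "weak_derivative_circle \<gamma> w"
  unfolding weak_derivative_circle_def
proof (intro allI impI)
  fix \<phi> :: "real \<Rightarrow> real" assume \<phi>: "smooth_fun \<phi> \<and> has_period (2 * pi) \<phi>"
  then have "(deriv ^^ 0) \<phi> differentiable (at t)" "(deriv ^^ 1) \<phi> differentiable (at t)" for t
    unfolding smooth_fun_def by blast+
  then have D: "\<phi> differentiable (at t)" "deriv \<phi> differentiable (at t)" for t by simp_all
  have d\<phi>: "(\<phi> has_real_derivative deriv \<phi> t) (at t)" for t
    using D(1) by (metis DERIV_imp_deriv real_differentiable_def)
  have cont: "continuous_on A \<phi>" "continuous_on A (deriv \<phi>)" for A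
    using D by (auto intro!: differentiable_imp_continuous_on differentiable_at_imp_differentiable_on)
  have int: "set_lebesgue_integral lborel {0..2*pi} f = integral {0..2*pi} f" if "continuous_on {0..2*pi} f"
    for f :: "real \<Rightarrow> complex"
    by (rule set_borel_integral_eq_integral(2)[OF borel_integrable_atLeastAtMost'[OF that]])
  have "((\<lambda>t. \<phi> t *\<^sub>R \<gamma> t) has_vector_derivative (\<phi> t *\<^sub>R w t + deriv \<phi> t *\<^sub>R \<gamma> t)) (at t within {0..2*pi})" for t
    by (rule has_vector_derivative_scaleR)
      (auto intro: has_vector_derivative_at_within d1 has_field_derivative_at_within d\<phi>)
  then have "((\<lambda>t. \<phi> t *\<^sub>R w t + deriv \<phi> t *\<^sub>R \<gamma> t) has_integral (\<phi> (2*pi) *\<^sub>R \<gamma> (2*pi) - \<phi> 0 *\<^sub>R \<gamma> 0)) {0..2*pi}"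
    by (intro fundamental_theorem_of_calculus) auto
  moreover have "\<phi> (2*pi) = \<phi> 0" "\<gamma> (2*pi) = \<gamma> 0"
    using \<phi> periodic[of 0] by (auto simp: has_period_def dest: spec[of _ 0])
  ultimately have "integral {0..2*pi} (\<lambda>t. \<phi> t *\<^sub>R w t + deriv \<phi> t *\<^sub>R \<gamma> t) = 0"
    by (simp add: integral_unique)
  then have "integral {0..2*pi} (\<lambda>t. \<phi> t *\<^sub>R w t) + integral {0..2*pi} (\<lambda>t. deriv \<phi> t *\<^sub>R \<gamma> t) = 0"
    by (subst (asm) integral_add)
      (auto intro!: integrable_continuous_interval continuous_intros cont continuous_gamma continuous_w)
  then show "set_lebesgue_integral lborel {0..2*pi} (\<lambda>t. deriv \<phi> t *\<^sub>R \<gamma> t) =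
      - set_lebesgue_integral lborel {0..2*pi} (\<lambda>t. \<phi> t *\<^sub>R w t)"
    by (subst (1 2) int) (auto intro!: continuous_intros cont continuous_gamma continuous_w simp: eq_neg_iff_add_eq_0 add.commute)
qed

lemma gamma_H_eight: "\<gamma> \<in> H_eight"
proof -
  have "\<gamma> \<in> H1_loops"
    unfolding H1_loops_def
    using weak_derivative continuous_gamma continuous_w periodic
    by (auto simp: has_period_def intro!: bounded_continuous_L2 exI[of _ w])
  moreover have "\<gamma> (pi / 2 + t) = Complex (- Re (\<gamma> (pi / 2 - t))) (Im (\<gamma> (pi / 2 - t)))" for t
    using reflect[of "pi / 2 - t"] by (simp add: complex_eq_iff)
  ultimately show ?thesis
    unfolding H_eight_def by (simp add: gamma_0 shift_pi complex_eq_iff)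
qed

end

section \<open>Newton's equation\<close>


lemma GDERIV_inverse_dist:
  fixes z p :: complex
  assumes "z \<noteq> p"
  shows "GDERIV (\<lambda>z. inverse (norm (z - p))) z :> kf (p - z)"
proof -
  have "((\<lambda>z. z - p) has_derivative (\<lambda>h. h)) (at z)"
    by (auto intro!: derivative_eq_intros)
  from has_derivative_compose[OF this GDERIV_norm[unfolded gderiv_def]] assms
  have "GDERIV (\<lambda>z. norm (z - p)) z :> sgn (z - p)"
    by (simp add: gderiv_def)
  from GDERIV_DERIV_compose[OF this DERIV_inverse] assms
  have "GDERIV (\<lambda>z. inverse (norm (z - p))) z :> (- (inverse (norm (z - p)) ^ Suc (Suc 0))) *\<^sub>R sgn (z - p)"
    by simp
  moreover have "(- (inverse (norm (z - p)) ^ Suc (Suc 0))) *\<^sub>R sgn (z - p) = kf (p - z)"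
    by (simp add: kf_def sgn_div_norm norm_minus_commute power3_eq_cube field_simps flip: scaleR_minus_right)
  ultimately show ?thesis by simp
qed

lemma newton_potential_expand:
  "newton_potential m p =
    m\<^sup>2 * (inverse (norm (p 0 - p 1)) + inverse (norm (p 0 - p 2)) + inverse (norm (p 1 - p 2)))"
  unfolding newton_potential_def by (simp add: numeral_eq_Suc lessThan_Suc algebra_simps)

context eight_solution
begin

abbreviation body :: "nat \<Rightarrow> real \<Rightarrow> complex" where
  "body i t \<equiv> \<gamma> (t + 2 * pi * real i / 3)"

lemma body_shift:
  "body 1 t = \<gamma> (t + 2 * pi / 3)" "body 2 t = \<gamma> (t - 2 * pi / 3)"
  "body 2 t = \<gamma> (t + 2 * pi / 3 + 2 * pi / 3)" "body 0 t = \<gamma> (t + 2 * pi * real 2 / 3 + 2 * pi / 3)"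
  "body 0 t = \<gamma> (t + 2 * pi / 3 - 2 * pi / 3)" "body 1 t = \<gamma> (t + 2 * pi * real 2 / 3 - 2 * pi / 3)"
proof -
  show "body 1 t = \<gamma> (t + 2 * pi / 3)" "body 0 t = \<gamma> (t + 2 * pi / 3 - 2 * pi / 3)" by simp_all
  show "body 2 t = \<gamma> (t - 2 * pi / 3)" using periodic[of "t - 2 * pi / 3"] by (simp add: algebra_simps)
  show "body 2 t = \<gamma> (t + 2 * pi / 3 + 2 * pi / 3)" by (rule arg_cong[where f = \<gamma>]) simp
  show "body 0 t = \<gamma> (t + 2 * pi * real 2 / 3 + 2 * pi / 3)" using periodic[of t] by (simp add: algebra_simps)
  show "body 1 t = \<gamma> (t + 2 * pi * real 2 / 3 - 2 * pi / 3)" by (rule arg_cong[where f = \<gamma>]) simp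
qed

lemma collision_free_body: "collision_free body"
proof -
  have ne: "body 0 t \<noteq> body 1 t" "body 1 t \<noteq> body 2 t" "body 2 t \<noteq> body 0 t" for t
    using eta_next[of t] eta_next[of "t + 2 * pi / 3"] eta_next[of "t + 2 * pi * real 2 / 3"]
      body_shift(1,3,4)[of t] by auto
  have "body i t \<noteq> body j t" if "i < 3" "j < 3" "i \<noteq> j" for i j t
  proof -
    have "i = 0 \<or> i = 1 \<or> i = 2" "j = 0 \<or> j = 1 \<or> j = 2" using that by auto
    then show ?thesis using ne[of t] that(3) by (elim disjE) metis+
  qed
  then show ?thesis unfolding collision_free_def by blast
qed

text \<open>Names the successor and the predecessor in cyclic order, so that one computation of the
  force serves all three bodies.\<close>

lemma neighbours:
  assumes "i < 3"
  obtains j k where "{i, j, k} = {0, 1, 2}" "j < 3" "k < 3" "i \<noteq> j" "i \<noteq> k" "j \<noteq> k"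
    "\<And>t. body j t = \<gamma> (t + 2 * pi * real i / 3 + 2 * pi / 3)"
    "\<And>t. body k t = \<gamma> (t + 2 * pi * real i / 3 - 2 * pi / 3)"
proof -
  have "i = 0 \<or> i = 1 \<or> i = 2" using assms by auto
  then show thesis
  proof (elim disjE)
    assume "i = 0" then show thesis using that[of 1 2] body_shift(1,2) by auto
  next
    assume "i = 1" then show thesis using that[of 2 0] body_shift(3,5) by auto
  next
    assume "i = 2" then show thesis using that[of 0 1] body_shift(4,6) by auto
  qed
qed

text \<open>Two of the three pairs involve body \<open>i\<close>; the third contributes the constant
  \<open>c\<close>. The factor 3 undoes the 1/3 in \<open>acc\<close>.\<close>

lemma gradient_potential:
  assumes "i < 3"
  shows "GDERIV (\<lambda>z. newton_potential m ((\<lambda>j. body j t)(i := z))) (body i t) :>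
    (3 * m\<^sup>2) *\<^sub>R acc (t + 2 * pi * real i / 3)"
proof -
  obtain j k where jk: "{i, j, k} = {0, 1, 2}" "j < 3" "k < 3" "i \<noteq> j" "i \<noteq> k" "j \<noteq> k"
    and J: "\<And>t. body j t = \<gamma> (t + 2 * pi * real i / 3 + 2 * pi / 3)"
    and K: "\<And>t. body k t = \<gamma> (t + 2 * pi * real i / 3 - 2 * pi / 3)"
    using neighbours[OF assms] by blast
  define c where "c = inverse (norm (body j t - body k t))"
  have pot: "(\<lambda>z. newton_potential m ((\<lambda>j. body j t)(i := z))) =
      (\<lambda>z. m\<^sup>2 * (inverse (norm (z - body j t)) + inverse (norm (z - body k t)) + c))"
  proof
    fix z
    have "(i, j, k) \<in> {(0, 1, 2), (0, 2, 1), (1, 0, 2), (1, 2, 0), (2, 0, 1), (2, 1, 0)}"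
      using jk assms by (auto simp: numeral_eq_Suc less_Suc_eq)
    then show "newton_potential m ((\<lambda>j. body j t)(i := z)) =
        m\<^sup>2 * (inverse (norm (z - body j t)) + inverse (norm (z - body k t)) + c)"
      unfolding newton_potential_expand c_def by (auto simp: norm_minus_commute)
  qed
  have ne: "body i t \<noteq> body j t" "body i t \<noteq> body k t"
    using collision_free_body jk assms unfolding collision_free_def by blast+
  have "((\<lambda>z. m\<^sup>2 * (inverse (norm (z - body j t)) + inverse (norm (z - body k t)) + c)) has_derivative
      (\<lambda>h. m\<^sup>2 * (h \<bullet> kf (body j t - body i t) + h \<bullet> kf (body k t - body i t) + 0))) (at (body i t))"
    by (intro has_derivative_mult_right has_derivative_add has_derivative_const
        GDERIV_inverse_dist[OF ne(1), unfolded gderiv_def] GDERIV_inverse_dist[OF ne(2), unfolded gderiv_def])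
  moreover have "(\<lambda>h. m\<^sup>2 * (h \<bullet> kf (body j t - body i t) + h \<bullet> kf (body k t - body i t) + 0)) =
      (\<lambda>h. h \<bullet> ((3 * m\<^sup>2) *\<^sub>R acc (t + 2 * pi * real i / 3)))"
    unfolding J K next_body prev_body kf_minus acc_def
    by (auto simp: inner_diff_right algebra_simps)
  ultimately show ?thesis
    unfolding gderiv_def pot by simp
qed

lemma newtonian:
  assumes m: "0 < m"
  shows "newtonian_solution m body"
proof -
  \<comment> \<open>Solves \<open>m * \<omega>\<^sup>2 = 3 * m\<^sup>2\<close>: each differentiation
    in the new time brings one factor \<omega>, and the right-hand side is the factor in
    \<open>gradient_potential\<close>.\<close>
  define \<omega> where "\<omega> = sqrt (3 * m)"
  have \<omega>: "0 < \<omega>" "\<omega> * \<omega> = 3 * m" using m by (simp_all add: \<omega>_def)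
  have chain: "((\<lambda>s. f (\<omega> * s + c)) has_vector_derivative \<omega> *\<^sub>R f' (\<omega> * s + c)) (at s)"
    if "\<And>t. (f has_vector_derivative f' t) (at t)" for f f' :: "real \<Rightarrow> complex" and c s
  proof -
    have "((\<lambda>s. \<omega> * s + c) has_vector_derivative \<omega>) (at s)"
      by (auto intro!: derivative_eq_intros simp: has_real_derivative_iff_has_vector_derivative[symmetric])
    from vector_diff_chain_at[OF this that] show ?thesis by (simp add: o_def)
  qed
  have d2': "(w has_vector_derivative acc t) (at t)" for t
    using d2[of t] by (simp add: acc_def)
  have "solves_newton m (\<lambda>i s. body i (\<omega> * s))"
    unfolding solves_newton_def
  proof (intro exI allI impI conjI)
    fix i :: nat and s :: real assume i: "i < 3"
    show "((\<lambda>s. body i (\<omega> * s)) has_vector_derivative \<omega> *\<^sub>R w (\<omega> * s + 2 * pi * real i / 3)) (at s)"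
      by (rule chain[OF d1])
    show "((\<lambda>s. \<omega> *\<^sub>R w (\<omega> * s + 2 * pi * real i / 3)) has_vector_derivative
        \<omega> *\<^sub>R \<omega> *\<^sub>R acc (\<omega> * s + 2 * pi * real i / 3)) (at s)"
      by (rule bounded_linear.has_vector_derivative[OF bounded_linear_scaleR_right chain[OF d2']])
    have eq: "m *\<^sub>R \<omega> *\<^sub>R \<omega> *\<^sub>R acc (\<omega> * s + 2 * pi * real i / 3) = (3 * m\<^sup>2) *\<^sub>R acc (\<omega> * s + 2 * pi * real i / 3)"
      using \<omega>(2) by (simp add: power2_eq_square mult_ac)
    show "GDERIV (\<lambda>z. newton_potential m ((\<lambda>j. body j (\<omega> * s))(i := z))) (body i (\<omega> * s)) :>
        (m *\<^sub>R \<omega> *\<^sub>R \<omega> *\<^sub>R acc (\<omega> * s + 2 * pi * real i / 3))"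
      unfolding eq by (rule gradient_potential[OF i])
  qed
  then show ?thesis unfolding newtonian_solution_def using \<omega>(1) by blast
qed

end

theorem corollary6p5:
  fixes m :: real
  assumes "m > 0"
  shows "\<exists>\<gamma> x. \<gamma> \<in> H_eight \<and>
           (\<forall>i<3. \<forall>t. x i t = \<gamma> (t + 2 * pi * real i / 3)) \<and>
           (\<forall>i<3. has_period (2 * pi) (x i)) \<and>
           collision_free x \<and>
           newtonian_solution m x \<and>
           node_at_origin \<gamma> \<and>
           figure_eight_orbit m (2 * pi) \<gamma>"
proof -
  obtain \<gamma> w \<eta> where sol: "eight_solution \<gamma> w \<eta>"
    by (rule gamma_exists)
  interpret eight_solution \<gamma> w \<eta> by (rule sol)
  have ch: "choreography (2 * pi) \<gamma> = body"
    by (simp add: choreography_def)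
  show ?thesis
  proof (intro exI[of _ \<gamma>] exI[of _ body] conjI allI impI)
    show "has_period (2 * pi) (body i)" for i
      unfolding has_period_def using periodic[of "_ + 2 * pi * real i / 3"] by (simp add: add_ac)
    show "node_at_origin \<gamma>" by (simp add: node_at_origin_def node)
    show "figure_eight_orbit m (2 * pi) \<gamma>"
      unfolding figure_eight_orbit_def ch
      by (intro conjI figure_eight collision_free_body newtonian assms)
  qed (auto intro: gamma_H_eight collision_free_body newtonian assms)
qed

end
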